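(* A topological space $Y$ is homeomorphic to the edge-end space $\Omega_E(G)$ of some connected graph $G$ if and only if there is a graph-theoretic tree $T$ and a subspace $X\subseteq \|T\|$ with $\Omega_E(T)\subseteq X$ such that $Y$ is homeomorphic to $X$.
   Context: Graphs may be infinite. A ray is a one-way infinite path. Two rays of a graph $G=(V,E)$ are edge-equivalent if no finite set of edges separates them; the equivalence classes are the edge-ends, forming $\Omega_E(G)$. A region of $G$ is a connected induced subgraph $C$ with finite boundary $\partial C=\{xy\in E: x\in C, y\notin C\}$. For a region $C$, $\Omega_E(C)$ is the set of edge-ends having a ray contained in $C$, and $\|C\|=V(C)\cup\Omega_E(C)$. The edge-end space $\Omega_E(G)$ has as basis the sets $\Omega_E(C)$ for regions $C$; the space $\|G\|=V(G)\cup\Omega_E(G)$ has as basis the sets $\|C\|$ for regions $C$ of $G$. For a tree $T$, $\|T\|$ is a compact Hausdorff space. *)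

theory Defs
  imports "HOL-Analysis.Analysis"
begin

definition graph :: "'a set \<Rightarrow> 'a set set \<Rightarrow> bool" where
  "graph V E \<longleftrightarrow> E \<subseteq> {{x, y} | x y. x \<in> V \<and> y \<in> V \<and> x \<noteq> y}"

definition walk :: "'a set \<Rightarrow> 'a set set \<Rightarrow> 'a list \<Rightarrow> bool" where
  "walk V E xs \<longleftrightarrow> xs \<noteq> [] \<and> set xs \<subseteq> V \<and>
     (\<forall>i. Suc i < length xs \<longrightarrow> {xs ! i, xs ! Suc i} \<in> E)"

definition connected_in :: "'a set \<Rightarrow> 'a set set \<Rightarrow> 'a \<Rightarrow> 'a \<Rightarrow> bool" where
  "connected_in V E x y \<longleftrightarrow> (\<exists>xs. walk V E xs \<and> hd xs = x \<and> last xs = y)"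

text \<open>Connected graphs are nonempty (Diestel's convention).\<close>

definition connected_graph :: "'a set \<Rightarrow> 'a set set \<Rightarrow> bool" where
  "connected_graph V E \<longleftrightarrow> V \<noteq> {} \<and> (\<forall>x\<in>V. \<forall>y\<in>V. connected_in V E x y)"

definition has_cycle :: "'a set \<Rightarrow> 'a set set \<Rightarrow> bool" where
  "has_cycle V E \<longleftrightarrow> (\<exists>xs. walk V E xs \<and> distinct xs \<and> length xs \<ge> 3 \<and>
                                 {last xs, hd xs} \<in> E)"

definition is_tree :: "'a set \<Rightarrow> 'a set set \<Rightarrow> bool" where
  "is_tree V E \<longleftrightarrow> graph V E \<and> connected_graph V E \<and> \<not> has_cycle V E"

definition ray :: "'a set \<Rightarrow> 'a set set \<Rightarrow> (nat \<Rightarrow> 'a) \<Rightarrow> bool" where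
  "ray V E R \<longleftrightarrow> inj R \<and> range R \<subseteq> V \<and> (\<forall>i. {R i, R (Suc i)} \<in> E)"

definition edge_equiv :: "'a set \<Rightarrow> 'a set set \<Rightarrow> (nat \<Rightarrow> 'a) \<Rightarrow> (nat \<Rightarrow> 'a) \<Rightarrow> bool" where
  "edge_equiv V E R1 R2 \<longleftrightarrow>
     (\<forall>F. F \<subseteq> E \<and> finite F \<longrightarrow>
        (\<exists>n. \<forall>i\<ge>n. \<forall>j\<ge>n. connected_in V (E - F) (R1 i) (R2 j)))"

definition edge_ends :: "'a set \<Rightarrow> 'a set set \<Rightarrow> (nat \<Rightarrow> 'a) set set" where
  "edge_ends V E = {{R'. ray V E R' \<and> edge_equiv V E R R'} | R. ray V E R}"

definition edge_boundary :: "'a set set \<Rightarrow> 'a set \<Rightarrow> 'a set set" where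
  "edge_boundary E C = {e \<in> E. e \<inter> C \<noteq> {} \<and> \<not> e \<subseteq> C}"

definition region :: "'a set \<Rightarrow> 'a set set \<Rightarrow> 'a set \<Rightarrow> bool" where
  "region V E C \<longleftrightarrow> C \<subseteq> V \<and> connected_graph C {e \<in> E. e \<subseteq> C} \<and>
                     finite (edge_boundary E C)"

definition region_ends :: "'a set \<Rightarrow> 'a set set \<Rightarrow> 'a set \<Rightarrow> (nat \<Rightarrow> 'a) set set" where
  "region_ends V E C = {\<omega> \<in> edge_ends V E. \<exists>R\<in>\<omega>. range R \<subseteq> C}"

definition edge_end_space :: "'a set \<Rightarrow> 'a set set \<Rightarrow> (nat \<Rightarrow> 'a) set topology" where
  "edge_end_space V E = topology_generated_by {region_ends V E C | C. region V E C}"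

text \<open>The space ||G|| = V(G) \<union> Omega_E(G), realised as a disjoint sum:
vertices as Inl, edge-ends as Inr.\<close>

definition region_closure :: "'a set \<Rightarrow> 'a set set \<Rightarrow> 'a set \<Rightarrow> ('a + (nat \<Rightarrow> 'a) set) set" where
  "region_closure V E C = Inl ` C \<union> Inr ` region_ends V E C"

definition graph_space :: "'a set \<Rightarrow> 'a set set \<Rightarrow> ('a + (nat \<Rightarrow> 'a) set) topology" where
  "graph_space V E = topology_generated_by {region_closure V E C | C. region V E C}"

end

(* Everything is expressed through vertex sets with finite edge boundary ("cuts"): they separate
   vertices and ends, and they form a base of both topologies.

   From T and X to G: glue an infinite clique to every vertex of T that lies in X.  No cut can split
   an infinite clique, so G has the same cuts as T, and the clique carries one end, inseparable
   from the vertex it is glued to.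

   From G to T: build a tree of nested regions.  The key step is a star decomposition: for a vertex r,
   all vertices and rays that can be separated from r are distributed over disjoint regions avoiding r.
   For p separable from r let M(p) be the smallest cut of minimal weight that contains p but not r, where
   an edge weighs more the further it is from r.  By submodularity the sets M(p) are laminar.  The
   members through a given vertex form a chain of order type at most omega; their differences have
   finite boundary, and their components are the required regions.
   Only finitely many of them are not contained in a given cut around r, by compactness.
   To iterate, a region is first split so that any two of its finitely many boundary vertices in the same
   piece are inseparable; the centre r of a piece is a boundary vertex if there is one.  So the
   boundary vertices are removed in each round, and every vertex of G leaves the regions after
   finitely many rounds.  An end of G either stays with the centre of a region forever, and is sent to that
   node, or follows a branch of the tree. *)

theory Submission
  imports Defs
begin

section \<open>Cuts, rays and ends\<close>

text \<open>Infinitely many lightest cuts may separate p from r, and a ray that eventually lies in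
  each of a family of cuts need not eventually lie in their intersection. Weights that grow with the
  distance from r remove this obstacle: a ray can enter or leave a lightest cut only near r, so once
  it stays far away, one tail of it lies in all lightest cuts. A ray that comes back near r
  infinitely often escapes this argument, but then some vertex lies in exactly the same cuts and can
  replace it. The second obstacle is that infinite unions of cuts may have infinite boundary;
  nestedness together with a common bound on the weight prevents this, since finitely many edges are
  already seen by a single member. Vertices are treated as constant sequences, so that vertices and
  rays share the notion of lying eventually in a cut. Both homeomorphisms come from one criterion
  for a map from the vertices of G to the nodes of T: preimages of cuts are cuts, cuts of G are
  refined by such preimages, and rays of G match the points of X.\<close>

definition adj :: "'a set set \<Rightarrow> ('a \<times> 'a) set" where
  "adj E = {(x, y). {x, y} \<in> E}"

text \<open>Unlike for regions, connectedness is not demanded, so these sets form a Boolean algebra.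
  Components of such sets are regions (\<open>cc_region\<close>), hence cuts may replace regions in
  both topologies.\<close>

definition fincut :: "'a set \<Rightarrow> 'a set set \<Rightarrow> 'a set \<Rightarrow> bool" where
  "fincut V E A \<longleftrightarrow> A \<subseteq> V \<and> finite (edge_boundary E A)"

text \<open>Formulated for arbitrary sequences: a constant sequence stands for a vertex, and the
  image of a ray under a map into another graph can be tested as well.\<close>

abbreviation ev_in :: "(nat \<Rightarrow> 'a) \<Rightarrow> 'a set \<Rightarrow> bool" where
  "ev_in p A \<equiv> (\<forall>\<^sub>F i in sequentially. p i \<in> A)"

abbreviation induced :: "'a set set \<Rightarrow> 'a set \<Rightarrow> 'a set set" where
  "induced E C \<equiv> {e \<in> E. e \<subseteq> C}"

definition cc :: "'a set set \<Rightarrow> 'a set \<Rightarrow> 'a \<Rightarrow> 'a set" where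
  "cc E A x = {y. (x, y) \<in> (adj (induced E A))\<^sup>*}"

lemma adj_iff [simp]: "(x, y) \<in> adj E \<longleftrightarrow> {x, y} \<in> E"
  by (simp add: adj_def)

lemma adj_sym: "sym (adj E)"
  by (auto simp: sym_def insert_commute)

lemma adj_rtrancl_sym: "(x, y) \<in> (adj E)\<^sup>* \<Longrightarrow> (y, x) \<in> (adj E)\<^sup>*"
  by (meson adj_sym sym_rtrancl symD)

lemma graphD:
  assumes "graph V E" "{x, y} \<in> E"
  shows "x \<in> V" "y \<in> V" "x \<noteq> y"
  using assms by (auto simp: graph_def doubleton_eq_iff)

lemma graph_edgeE:
  assumes "graph V E" "e \<in> E"
  obtains x y where "e = {x, y}" "x \<in> V" "y \<in> V" "x \<noteq> y"
  using assms by (auto simp: graph_def)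

lemma graph_subset: "graph V E \<Longrightarrow> E' \<subseteq> E \<Longrightarrow> graph V E'"
  by (auto simp: graph_def)

lemma graph_induced: "graph V E \<Longrightarrow> graph C (induced E C)"
  by (auto simp: graph_def) blast

lemma induced_whole: "graph V E \<Longrightarrow> induced E V = E"
  by (auto simp: graph_def)

lemma rtrancl_crossing:
  assumes "(x, y) \<in> r\<^sup>*" "x \<in> A" "y \<notin> A"
  shows "\<exists>a b. (x, a) \<in> r\<^sup>* \<and> (a, b) \<in> r \<and> (b, y) \<in> r\<^sup>* \<and> a \<in> A \<and> b \<notin> A"
  using assms
proof (induction rule: converse_rtrancl_induct)
  case (step x z)
  then show ?case
    by (cases "z \<in> A") (meson converse_rtrancl_into_rtrancl rtrancl.rtrancl_refl)+
qed simp

lemma rtrancl_adj_in: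
  assumes "(x, y) \<in> (adj E)\<^sup>*" "x \<in> V" "\<And>e. e \<in> E \<Longrightarrow> e \<subseteq> V"
  shows "y \<in> V"
  using assms(1,2) by induction (use assms(3) in auto)

lemma walk_rtrancl:
  assumes "walk V E xs"
  shows "(hd xs, last xs) \<in> (adj E)\<^sup>*"
proof -
  have "i < length xs \<Longrightarrow> (xs ! 0, xs ! i) \<in> (adj E)\<^sup>*" for i
  proof (induction i)
    case (Suc i)
    then have "{xs ! i, xs ! Suc i} \<in> E" using assms by (auto simp: walk_def)
    with Suc show ?case by (meson Suc_lessD adj_iff rtrancl.rtrancl_into_rtrancl)
  qed simp
  moreover have "xs \<noteq> []" using assms by (auto simp: walk_def)
  ultimately show ?thesis by (simp add: hd_conv_nth last_conv_nth)
qed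

lemma walk_prefix:
  assumes "walk V E (xs @ ys)" "xs \<noteq> []"
  shows "walk V E xs"
  unfolding walk_def
proof (intro conjI allI impI)
  fix i assume i: "Suc i < length xs"
  then have "{(xs @ ys) ! i, (xs @ ys) ! Suc i} \<in> E" using assms(1) by (simp add: walk_def)
  then show "{xs ! i, xs ! Suc i} \<in> E" using i by (simp add: nth_append)
qed (use assms in \<open>auto simp: walk_def\<close>)

text \<open>A repeated vertex is avoided by cutting the walk back to its occurrence. Distinctness
  matters in \<open>no_detour\<close>, where a walk is closed up to a cycle.\<close>

lemma distinct_walk:
  assumes "graph V E" "(x, y) \<in> (adj E)\<^sup>*" "x \<in> V"
  shows "\<exists>xs. walk V E xs \<and> hd xs = x \<and> last xs = y \<and> distinct xs"
  using assms(2)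
proof induction
  case base
  show ?case by (rule exI[of _ "[x]"]) (use assms in \<open>auto simp: walk_def\<close>)
next
  case (step y z)
  then obtain xs where xs: "walk V E xs" "hd xs = x" "last xs = y" "distinct xs" by blast
  have ne: "xs \<noteq> []" using xs by (simp add: walk_def)
  show ?case
  proof (cases "z \<in> set xs")
    case True
    then obtain ys zs where s: "xs = (ys @ [z]) @ zs" by (auto dest: split_list)
    then have "walk V E (ys @ [z])" using xs(1) walk_prefix by blast
    moreover have "hd (ys @ [z]) = x" using xs(2) s by (cases ys) auto
    ultimately show ?thesis using xs(4) s by (intro exI[of _ "ys @ [z]"]) auto
  next
    case False
    have "{y, z} \<in> E" using step by simp
    have "walk V E (xs @ [z])"
      unfolding walk_def
    proof (intro conjI allI impI)
      show "set (xs @ [z]) \<subseteq> V"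
        using xs(1) graphD[OF assms(1) \<open>{y, z} \<in> E\<close>] by (auto simp: walk_def)
      fix i assume i: "Suc i < length (xs @ [z])"
      show "{(xs @ [z]) ! i, (xs @ [z]) ! Suc i} \<in> E"
      proof (cases "Suc i < length xs")
        case True
        then show ?thesis using xs by (auto simp: walk_def nth_append)
      next
        case False
        then have "i = length xs - 1" using i by simp
        then show ?thesis using xs(3) \<open>{y, z} \<in> E\<close> ne by (auto simp: nth_append last_conv_nth)
      qed
    qed simp
    then show ?thesis using xs False ne by (intro exI[of _ "xs @ [z]"]) auto
  qed
qed

lemma connected_in_iff:
  assumes "graph V E"
  shows "connected_in V E x y \<longleftrightarrow> x \<in> V \<and> (x, y) \<in> (adj E)\<^sup>*"
proof
  assume "connected_in V E x y"
  then obtain xs where xs: "walk V E xs" "hd xs = x" "last xs = y"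
    by (auto simp: connected_in_def)
  then have "x \<in> V" by (metis hd_in_set subsetD walk_def)
  then show "x \<in> V \<and> (x, y) \<in> (adj E)\<^sup>*" using walk_rtrancl[OF xs(1)] xs by auto
next
  assume "x \<in> V \<and> (x, y) \<in> (adj E)\<^sup>*"
  then show "connected_in V E x y"
    using distinct_walk[OF assms, of x y] unfolding connected_in_def by blast
qed

lemma connected_graph_iff:
  assumes "graph V E"
  shows "connected_graph V E \<longleftrightarrow> V \<noteq> {} \<and> (\<forall>x\<in>V. \<forall>y\<in>V. (x, y) \<in> (adj E)\<^sup>*)"
  by (auto simp: connected_graph_def connected_in_iff[OF assms])

lemma in_boundary_iff:
  assumes "graph V E"
  shows "e \<in> edge_boundary E A \<longleftrightarrow> (\<exists>x y. e = {x, y} \<and> {x, y} \<in> E \<and> x \<in> A \<and> y \<notin> A)"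
proof
  assume "e \<in> edge_boundary E A"
  moreover from this obtain x y where "e = {x, y}"
    using assms by (metis (lifting) CollectD edge_boundary_def graph_edgeE)
  ultimately show "\<exists>x y. e = {x, y} \<and> {x, y} \<in> E \<and> x \<in> A \<and> y \<notin> A"
    by (auto simp: edge_boundary_def) (metis insert_commute)+
qed (auto simp: edge_boundary_def)

lemma boundaryE:
  assumes "graph V E" "e \<in> edge_boundary E A"
  obtains x y where "e = {x, y}" "{x, y} \<in> E" "x \<in> A" "y \<notin> A"
  using iffD1[OF in_boundary_iff[OF assms(1)] assms(2)] by (elim exE conjE) (rule that)

lemma edge_in_boundary:
  "{x, y} \<in> E \<Longrightarrow> x \<in> A \<Longrightarrow> y \<notin> A \<Longrightarrow> {x, y} \<in> edge_boundary E A"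
  by (auto simp: edge_boundary_def)

lemma boundary_Compl:
  assumes "graph V E" "A \<subseteq> V"
  shows "edge_boundary E (V - A) = edge_boundary E A"
proof -
  have "e \<subseteq> V" if "e \<in> E" for e using assms that by (auto elim: graph_edgeE)
  then show ?thesis using assms(2) unfolding edge_boundary_def by blast
qed

lemma fincut_whole: "graph V E \<Longrightarrow> fincut V E V"
proof -
  assume "graph V E"
  then have "edge_boundary E V = {}" by (auto simp: edge_boundary_def elim!: graph_edgeE)
  then show ?thesis by (simp add: fincut_def)
qed

lemma fincut_empty: "fincut V E {}"
  by (auto simp: fincut_def edge_boundary_def)

lemma fincut_Compl: "graph V E \<Longrightarrow> fincut V E A \<Longrightarrow> fincut V E (V - A)"
  by (auto simp: fincut_def boundary_Compl)

lemma fincut_Int: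
  assumes "fincut V E A" "fincut V E B"
  shows "fincut V E (A \<inter> B)"
proof -
  have "edge_boundary E (A \<inter> B) \<subseteq> edge_boundary E A \<union> edge_boundary E B"
    by (auto simp: edge_boundary_def)
  then show ?thesis using assms by (auto simp: fincut_def intro: finite_subset)
qed

lemma fincut_Un:
  assumes "fincut V E A" "fincut V E B"
  shows "fincut V E (A \<union> B)"
proof -
  have "edge_boundary E (A \<union> B) \<subseteq> edge_boundary E A \<union> edge_boundary E B"
    by (auto simp: edge_boundary_def)
  then show ?thesis using assms by (auto simp: fincut_def intro: finite_subset)
qed

lemma fincut_Diff:
  assumes "graph V E" "fincut V E A" "fincut V E B"
  shows "fincut V E (A - B)"
proof -
  have "A - B = A \<inter> (V - B)" using assms by (auto simp: fincut_def)
  then show ?thesis using assms by (simp add: fincut_Int fincut_Compl)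
qed

lemma fincut_Union: "finite \<A> \<Longrightarrow> (\<And>A. A \<in> \<A> \<Longrightarrow> fincut V E A) \<Longrightarrow> fincut V E (\<Union>\<A>)"
  by (induction \<A> rule: finite_induct) (auto simp: fincut_empty fincut_Un)

lemma region_iff: "region V E C \<longleftrightarrow> fincut V E C \<and> connected_graph C (induced E C)"
  by (auto simp: region_def fincut_def)

lemma cc_self: "x \<in> cc E A x"
  by (simp add: cc_def)

lemma cc_subset: "x \<in> A \<Longrightarrow> cc E A x \<subseteq> A"
  by (auto simp: cc_def intro: rtrancl_adj_in)

lemma cc_eq: "y \<in> cc E A x \<Longrightarrow> cc E A y = cc E A x"
  unfolding cc_def using adj_rtrancl_sym rtrancl_trans by (metis (mono_tags, lifting) mem_Collect_eq)

lemma cc_step: "y \<in> cc E A x \<Longrightarrow> {y, z} \<in> E \<Longrightarrow> y \<in> A \<Longrightarrow> z \<in> A \<Longrightarrow> z \<in> cc E A x"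
  unfolding cc_def by (auto intro: rtrancl_into_rtrancl)

lemma component_connected:
  assumes "graph V E" "E' \<subseteq> E"
  shows "connected_graph {y. (x, y) \<in> (adj E')\<^sup>*} (induced E {y. (x, y) \<in> (adj E')\<^sup>*})"
proof -
  let ?K = "{y. (x, y) \<in> (adj E')\<^sup>*}"
  have *: "(x, y) \<in> (adj (induced E ?K))\<^sup>*" if "(x, y) \<in> (adj E')\<^sup>*" for y
    using that
  proof induction
    case (step y z)
    then have "{y, z} \<in> induced E ?K" using assms(2)
      by (auto intro: rtrancl_into_rtrancl)
    with step show ?case by (metis (no_types, lifting) adj_iff rtrancl.rtrancl_into_rtrancl)
  qed simp
  show ?thesis
    unfolding connected_graph_iff[OF graph_induced[OF assms(1)]]
  proof (intro conjI ballI)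
    show "?K \<noteq> {}" by auto
    fix a b assume "a \<in> ?K" "b \<in> ?K"
    then show "(a, b) \<in> (adj (induced E ?K))\<^sup>*"
      using adj_rtrancl_sym[OF *, of a] *[of b] by (auto intro: rtrancl_trans)
  qed
qed

lemma cc_connected: "graph V E \<Longrightarrow> connected_graph (cc E A x) (induced E (cc E A x))"
  unfolding cc_def by (rule component_connected) auto

text \<open>An edge that leaves the component inside \<open>A\<close> would extend the component, so
  its boundary edges already leave \<open>A\<close>.\<close>

lemma cc_region:
  assumes "graph V E" "fincut V E A" "x \<in> A"
  shows "region V E (cc E A x)"
proof -
  have "edge_boundary E (cc E A x) \<subseteq> edge_boundary E A"
  proof
    fix e assume "e \<in> edge_boundary E (cc E A x)"
    then obtain a b where e: "e = {a, b}" "{a, b} \<in> E" "a \<in> cc E A x" "b \<notin> cc E A x"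
      using in_boundary_iff[OF assms(1)] by metis
    then have "a \<in> A" using cc_subset[OF assms(3)] by auto
    moreover have "b \<notin> A" using cc_step e \<open>a \<in> A\<close> by metis
    ultimately show "e \<in> edge_boundary E A" using e edge_in_boundary by metis
  qed
  moreover have "cc E A x \<subseteq> V" using cc_subset[OF assms(3), of E] assms(2) by (auto simp: fincut_def)
  ultimately show ?thesis using assms cc_connected[OF assms(1)]
    by (auto simp: region_iff fincut_def intro: finite_subset)
qed

text \<open>A path in \<open>C\<close> from \<open>x\<close> out of \<open>K\<close> would use a
  boundary edge of \<open>K\<close>. This places regions that avoid the ends of the boundary edges
  of a cut inside that cut.\<close>

lemma connected_avoiding_boundary:
  assumes "graph V E" "connected_graph C (induced E C)" "x \<in> C" "x \<in> K"
    and "\<And>e. e \<in> edge_boundary E K \<Longrightarrow> e \<inter> C = {}"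
  shows "C \<subseteq> K"
proof (rule ccontr)
  assume "\<not> C \<subseteq> K"
  then obtain y where y: "y \<in> C" "y \<notin> K" by auto
  have "(x, y) \<in> (adj (induced E C))\<^sup>*"
    using assms(2,3) y connected_graph_iff[OF graph_induced[OF assms(1)]] by blast
  from rtrancl_crossing[OF this assms(4) y(2)] obtain a b
    where "{a, b} \<in> induced E C" "a \<in> K" "b \<notin> K" by auto
  then have "{a, b} \<in> edge_boundary E K" "{a, b} \<inter> C \<noteq> {}" by (auto simp: edge_boundary_def)
  with assms(5) show False by blast
qed

section \<open>Rays and ends in terms of cuts\<close>

lemma rayD:
  assumes "ray V E R"
  shows "inj R" "R i \<in> V" "{R i, R (Suc i)} \<in> E"
  using assms by (auto simp: ray_def)

lemma ray_shift: "ray V E R \<Longrightarrow> ray V E (\<lambda>i. R (i + n))"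
  using inj_compose[of R "\<lambda>i. i + n"] by (auto simp: ray_def o_def)

lemma ray_tail:
  assumes "ray V E R" "\<And>i. i \<ge> n \<Longrightarrow> R i \<in> C"
  shows "ray C (induced E C) (\<lambda>i. R (i + n))"
  using ray_shift[OF assms(1), of n] assms(2) by (auto simp: ray_def)

lemma ev_in_shift: "ev_in (\<lambda>i. p (i + n)) A \<longleftrightarrow> ev_in p A"
  by (rule eventually_sequentially_seg[of "\<lambda>i. p i \<in> A"])

lemma ev_in_disjoint: "ev_in p A \<Longrightarrow> ev_in p B \<Longrightarrow> A \<inter> B \<noteq> {}"
  using eventually_happens'[OF _ eventually_conj, of sequentially "\<lambda>i. p i \<in> A" "\<lambda>i. p i \<in> B"] by auto

lemma ev_in_mono: "ev_in p A \<Longrightarrow> A \<subseteq> B \<Longrightarrow> ev_in p B"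
  by (erule eventually_mono) auto

lemma ev_in_Int: "ev_in p (A \<inter> B) \<longleftrightarrow> ev_in p A \<and> ev_in p B"
  by (auto simp: eventually_conj_iff)

lemma ray_edge_inj:
  assumes "ray V E R"
  shows "inj (\<lambda>i. {R i, R (Suc i)})"
proof (rule injI)
  fix i j assume "{R i, R (Suc i)} = {R j, R (Suc j)}"
  then show "i = j" using rayD(1)[OF assms] by (auto simp: doubleton_eq_iff inj_eq)
qed

lemma eventually_const_in:
  assumes "\<forall>\<^sub>F i in sequentially. p i \<in> A \<longleftrightarrow> p (Suc i) \<in> A"
  shows "ev_in p A \<or> (\<forall>\<^sub>F i in sequentially. p i \<notin> A)"
proof -
  obtain n where n: "\<And>i. i \<ge> n \<Longrightarrow> p i \<in> A \<longleftrightarrow> p (Suc i) \<in> A"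
    using assms by (auto simp: eventually_sequentially)
  have "p i \<in> A \<longleftrightarrow> p n \<in> A" if "i \<ge> n" for i
    using that
  proof (induction rule: dec_induct)
    case (step i)
    then show ?case using n[of i] by simp
  qed simp
  then show ?thesis unfolding eventually_sequentially by blast
qed

lemma ray_avoids_finite:
  assumes "ray V E R" "finite F"
  shows "\<forall>\<^sub>F i in sequentially. {R i, R (Suc i)} \<notin> F"
proof -
  have "finite ((\<lambda>i. {R i, R (Suc i)}) -` F)"
    by (rule finite_vimageI[OF assms(2) ray_edge_inj[OF assms(1)]])
  then obtain n where "\<forall>i \<in> (\<lambda>i. {R i, R (Suc i)}) -` F. i < n"
    using finite_nat_set_iff_bounded by blast
  then have "\<forall>i\<ge>n. {R i, R (Suc i)} \<notin> F" by (auto simp: not_less[symmetric])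
  then show ?thesis unfolding eventually_sequentially by blast
qed

text \<open>A ray uses every edge at most once, so it crosses the finite boundary of
  \<open>A\<close> only finitely often.\<close>

lemma ray_decides:
  assumes "ray V E R" "fincut V E A"
  shows "ev_in R A \<or> ev_in R (V - A)"
proof -
  have "\<forall>\<^sub>F i in sequentially. {R i, R (Suc i)} \<notin> edge_boundary E A"
    using ray_avoids_finite assms by (auto simp: fincut_def)
  then have "\<forall>\<^sub>F i in sequentially. R i \<in> A \<longleftrightarrow> R (Suc i) \<in> A"
    by (rule eventually_mono) (use rayD[OF assms(1)] in \<open>auto simp: edge_boundary_def\<close>)
  from eventually_const_in[OF this] show ?thesis using rayD[OF assms(1)] by auto
qed

lemma ray_not_in_iff:
  assumes "ray V E R" "fincut V E A"
  shows "\<not> ev_in R A \<longleftrightarrow> ev_in R (V - A)"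
  using ray_decides[OF assms] ev_in_disjoint[of R A "V - A"] by auto

lemma ray_frequently_in:
  assumes "ray V E R" "fincut V E A" "infinite {i. R i \<in> A}"
  shows "ev_in R A"
proof (rule ccontr)
  assume "\<not> ev_in R A"
  then have "ev_in R (V - A)" using ray_decides assms by blast
  then obtain n where "\<And>i. i \<ge> n \<Longrightarrow> R i \<notin> A" by (auto simp: eventually_sequentially)
  then have "{i. R i \<in> A} \<subseteq> {..<n}" by (auto simp: not_le[symmetric])
  with assms(3) show False using finite_subset by blast
qed

text \<open>Edge sets are replaced by vertex sets with finite boundary: for a finite set \<open>F\<close> of edges
  the component of a tail of a ray in \<open>E - F\<close> is such a set.\<close>

lemma edge_equiv_iff:
  assumes "graph V E" "ray V E R" "ray V E R'"
  shows "edge_equiv V E R R' \<longleftrightarrow> (\<forall>A. fincut V E A \<and> ev_in R A \<longrightarrow> ev_in R' A)"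
proof (intro iffI allI impI)
  fix A assume eq: "edge_equiv V E R R'" and A: "fincut V E A \<and> ev_in R A"
  show "ev_in R' A"
  proof (rule ccontr)
    assume "\<not> ev_in R' A"
    then have "ev_in R' (V - A)" using ray_decides[OF assms(3)] A by blast
    then obtain m where m: "\<And>i. i \<ge> m \<Longrightarrow> R' i \<in> V - A" by (auto simp: eventually_sequentially)
    obtain n where n: "\<And>i. i \<ge> n \<Longrightarrow> R i \<in> A" using A by (auto simp: eventually_sequentially)
    let ?F = "edge_boundary E A"
    have "?F \<subseteq> E" "finite ?F" using A by (auto simp: fincut_def edge_boundary_def)
    then obtain k where "\<forall>i\<ge>k. \<forall>j\<ge>k. connected_in V (E - ?F) (R i) (R' j)"
      using eq by (auto simp: edge_equiv_def)
    then have "connected_in V (E - ?F) (R (max k n)) (R' (max k m))" by simp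
    then have "(R (max k n), R' (max k m)) \<in> (adj (E - ?F))\<^sup>*"
      using connected_in_iff[OF graph_subset[OF assms(1)]] by blast
    from rtrancl_crossing[OF this, of A] n m obtain a b
      where "{a, b} \<in> E - ?F" "a \<in> A" "b \<notin> A" by fastforce
    then show False by (auto simp: edge_boundary_def)
  qed
next
  assume *: "\<forall>A. fincut V E A \<and> ev_in R A \<longrightarrow> ev_in R' A"
  show "edge_equiv V E R R'"
    unfolding edge_equiv_def
  proof (intro allI impI)
    fix F assume F: "F \<subseteq> E \<and> finite F"
    have g: "graph V (E - F)" by (rule graph_subset[OF assms(1)]) auto
    obtain n where n: "\<And>i. i \<ge> n \<Longrightarrow> {R i, R (Suc i)} \<notin> F"
      using ray_avoids_finite[OF assms(2), of F] F by (auto simp: eventually_sequentially)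
    let ?K = "{y. (R n, y) \<in> (adj (E - F))\<^sup>*}"
    have RK: "R i \<in> ?K" if "i \<ge> n" for i
      using that
    proof (induction rule: dec_induct)
      case (step i)
      then have "(R i, R (Suc i)) \<in> adj (E - F)" using n rayD(3)[OF assms(2)] by simp
      with step show ?case by (simp add: rtrancl.rtrancl_into_rtrancl)
    qed simp
    have KV: "?K \<subseteq> V"
      using connected_in_iff[OF g] rayD(2)[OF assms(2)] assms(1)
      by (auto simp: graph_def intro: rtrancl_adj_in)
    have "edge_boundary E ?K \<subseteq> F"
    proof
      fix e assume "e \<in> edge_boundary E ?K"
      then obtain a b where "e = {a, b}" "{a, b} \<in> E" "a \<in> ?K" "b \<notin> ?K"
        using in_boundary_iff[OF assms(1)] by metis
      then show "e \<in> F" by (auto intro: rtrancl_into_rtrancl)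
    qed
    then have "fincut V E ?K" using F KV by (auto simp: fincut_def intro: finite_subset)
    moreover have "ev_in R ?K" using RK by (auto simp: eventually_sequentially)
    ultimately have "ev_in R' ?K" using * by blast
    then obtain m where m: "\<And>i. i \<ge> m \<Longrightarrow> R' i \<in> ?K" by (auto simp: eventually_sequentially)
    have "connected_in V (E - F) (R i) (R' j)" if "i \<ge> max n m" "j \<ge> max n m" for i j
    proof -
      have "R i \<in> ?K" "R' j \<in> ?K" using that RK m by auto
      then have "(R i, R' j) \<in> (adj (E - F))\<^sup>*"
        using adj_rtrancl_sym[of "R n" "R i"] rtrancl_trans[of "R i" "R n"] by auto
      then show ?thesis using connected_in_iff[OF g] rayD(2)[OF assms(2)] by blast
    qed
    then show "\<exists>n. \<forall>i\<ge>n. \<forall>j\<ge>n. connected_in V (E - F) (R i) (R' j)" by blast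
  qed
qed

lemma edge_equiv_ev_in:
  assumes "graph V E" "ray V E R" "ray V E R'" "edge_equiv V E R R'" "fincut V E A"
  shows "ev_in R A \<longleftrightarrow> ev_in R' A"
proof -
  have "ev_in R B \<Longrightarrow> ev_in R' B" if "fincut V E B" for B
    using assms that edge_equiv_iff by blast
  from this[of A] this[of "V - A"] show ?thesis
    using fincut_Compl[OF assms(1)] assms ray_not_in_iff[OF assms(2)] ray_not_in_iff[OF assms(3)]
    by blast
qed

definition end_in :: "(nat \<Rightarrow> 'a) set \<Rightarrow> 'a set \<Rightarrow> bool" where
  "end_in \<omega> A \<longleftrightarrow> (\<exists>R\<in>\<omega>. ev_in R A)"

definition end_of :: "'a set \<Rightarrow> 'a set set \<Rightarrow> (nat \<Rightarrow> 'a) \<Rightarrow> (nat \<Rightarrow> 'a) set" where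
  "end_of V E R = {R'. ray V E R' \<and> edge_equiv V E R R'}"

lemma edge_ends_eq: "edge_ends V E = {end_of V E R | R. ray V E R}"
  by (simp add: edge_ends_def end_of_def)

lemma end_of_self: "graph V E \<Longrightarrow> ray V E R \<Longrightarrow> R \<in> end_of V E R"
  by (auto simp: end_of_def edge_equiv_iff)

lemma end_of_in: "ray V E R \<Longrightarrow> end_of V E R \<in> edge_ends V E"
  by (auto simp: edge_ends_eq)

lemma end_ofE:
  assumes "graph V E" "\<omega> \<in> edge_ends V E"
  obtains R where "ray V E R" "\<omega> = end_of V E R" "R \<in> \<omega>"
  using assms by (auto simp: edge_ends_eq intro: end_of_self)

lemma end_in_end_of:
  assumes "graph V E" "ray V E R" "fincut V E A"
  shows "end_in (end_of V E R) A \<longleftrightarrow> ev_in R A"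
  using assms edge_equiv_ev_in[OF assms(1,2) _ _ assms(3)] end_of_self
  by (fastforce simp: end_in_def end_of_def)

lemma end_of_eq:
  assumes "graph V E" "ray V E R" "ray V E R'" "\<And>A. fincut V E A \<Longrightarrow> ev_in R A \<longleftrightarrow> ev_in R' A"
  shows "end_of V E R = end_of V E R'"
  using assms by (auto simp: end_of_def edge_equiv_iff)

lemma region_ends_eq:
  assumes "graph V E" "fincut V E C"
  shows "region_ends V E C = {\<omega> \<in> edge_ends V E. end_in \<omega> C}"
proof (intro set_eqI iffI)
  fix \<omega> assume "\<omega> \<in> region_ends V E C"
  then show "\<omega> \<in> {\<omega> \<in> edge_ends V E. end_in \<omega> C}"
    by (auto simp: region_ends_def end_in_def intro!: bexI eventuallyI)
next
  fix \<omega> assume "\<omega> \<in> {\<omega> \<in> edge_ends V E. end_in \<omega> C}"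
  then have \<omega>: "\<omega> \<in> edge_ends V E" "end_in \<omega> C" by auto
  obtain R where R: "ray V E R" "\<omega> = end_of V E R" by (rule end_ofE[OF assms(1) \<omega>(1)])
  then have "ev_in R C" using end_in_end_of[OF assms(1) _ assms(2)] \<omega> by auto
  then obtain n where n: "\<And>i. i \<ge> n \<Longrightarrow> R i \<in> C" by (auto simp: eventually_sequentially)
  \<comment> \<open>\<open>region_ends\<close> asks for a ray contained in \<open>C\<close>; this
    tail is one, and it represents the same end.\<close>
  let ?R = "\<lambda>i. R (i + n)"
  have "ray V E ?R" using ray_shift R by blast
  then have "?R \<in> \<omega>"
    using R edge_equiv_iff[OF assms(1)] by (auto simp: end_of_def ev_in_shift)
  then show "\<omega> \<in> region_ends V E C" using \<omega> n by (auto simp: region_ends_def intro!: bexI[of _ ?R])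
qed

lemma end_in_mono: "end_in \<omega> A \<Longrightarrow> A \<subseteq> B \<Longrightarrow> end_in \<omega> B"
  by (auto simp: end_in_def elim: ev_in_mono)

lemma end_in_cc:
  assumes "graph V E" "\<omega> \<in> edge_ends V E" "fincut V E A" "end_in \<omega> A"
  obtains x where "x \<in> A" "end_in \<omega> (cc E A x)"
proof -
  obtain R where R: "ray V E R" "\<omega> = end_of V E R" by (rule end_ofE[OF assms(1,2)])
  then have "ev_in R A" using end_in_end_of[OF assms(1) _ assms(3)] assms(4) by auto
  then obtain n where n: "\<And>i. i \<ge> n \<Longrightarrow> R i \<in> A" by (auto simp: eventually_sequentially)
  have "R i \<in> cc E A (R n)" if "i \<ge> n" for i
    using that
  proof (induction rule: dec_induct)
    case base
    show ?case by (rule cc_self)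
  next
    case (step i)
    show ?case by (rule cc_step[OF step(3) rayD(3)[OF R(1)]]) (use n step in auto)
  qed
  then have "ev_in R (cc E A (R n))" by (auto simp: eventually_sequentially)
  then have "end_in \<omega> (cc E A (R n))"
    using R end_of_self[OF assms(1)] by (auto simp: end_in_def)
  with n show ?thesis using that by blast
qed

lemma end_in_Int:
  assumes "graph V E" "\<omega> \<in> edge_ends V E" "fincut V E A" "fincut V E B"
  shows "end_in \<omega> (A \<inter> B) \<longleftrightarrow> end_in \<omega> A \<and> end_in \<omega> B"
proof -
  obtain R where R: "ray V E R" "\<omega> = end_of V E R" by (rule end_ofE[OF assms(1,2)])
  then show ?thesis
    using end_in_end_of[OF assms(1) R(1)] assms(3,4) fincut_Int[OF assms(3,4)]
    by (simp add: ev_in_Int[unfolded Int_iff])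
qed

lemma end_in_whole:
  assumes "graph V E" "\<omega> \<in> edge_ends V E"
  shows "end_in \<omega> V"
proof -
  obtain R where R: "ray V E R" "\<omega> = end_of V E R" by (rule end_ofE[OF assms])
  then show ?thesis
    using end_in_end_of[OF assms(1) R(1) fincut_whole[OF assms(1)]] rayD(2)[OF R(1)] by simp
qed

section \<open>Cuts as a base of the two topologies\<close>

lemma bex_setcompr:
  "(\<exists>C\<in>{{x \<in> S. Q x A} | A. P A}. y \<in> C \<and> C \<subseteq> U) \<longleftrightarrow>
   y \<in> S \<and> (\<exists>A. P A \<and> Q y A \<and> {x \<in> S. Q x A} \<subseteq> U)"
proof -
  have "(\<exists>C\<in>{f A | A. P A}. R C) \<longleftrightarrow> (\<exists>A. P A \<and> R (f A))" for f R
    by blast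
  then show ?thesis by auto
qed

text \<open>Intersections of regions need not be connected, so the sets given by regions, in the
  role of \<open>\<B>\<close>, need not be closed under intersection. The sets given by all cuts, in
  the role of \<open>\<C>\<close>, are closed, and each of them is a union of members of
  \<open>\<B>\<close>.\<close>

lemma openin_generated_by_base:
  assumes sub: "\<B> \<subseteq> \<C>"
    and Int: "\<And>A B. A \<in> \<C> \<Longrightarrow> B \<in> \<C> \<Longrightarrow> A \<inter> B \<in> \<C>"
    and cover: "\<And>C x. C \<in> \<C> \<Longrightarrow> x \<in> C \<Longrightarrow> \<exists>B\<in>\<B>. x \<in> B \<and> B \<subseteq> C"
  shows "openin (topology_generated_by \<B>) U \<longleftrightarrow> (\<forall>x\<in>U. \<exists>C\<in>\<C>. x \<in> C \<and> C \<subseteq> U)"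
proof
  assume "openin (topology_generated_by \<B>) U"
  then have "generate_topology_on \<B> U" by (simp add: openin_topology_generated_by_iff)
  then show "\<forall>x\<in>U. \<exists>C\<in>\<C>. x \<in> C \<and> C \<subseteq> U"
  proof induction
    case (Int A B)
    show ?case
    proof
      fix x assume "x \<in> A \<inter> B"
      then obtain C D where "C \<in> \<C>" "x \<in> C" "C \<subseteq> A" "D \<in> \<C>" "x \<in> D" "D \<subseteq> B"
        using Int by (meson IntD1 IntD2)
      then show "\<exists>C\<in>\<C>. x \<in> C \<and> C \<subseteq> A \<inter> B"
        by (intro bexI[of _ "C \<inter> D"]) (use assms(2) in auto)
    qed
  next
    case (UN K)
    then show ?case by (meson Union_iff Sup_upper2)
  next
    case (Basis s)
    then show ?case using sub by blast
  qed auto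
next
  assume *: "\<forall>x\<in>U. \<exists>C\<in>\<C>. x \<in> C \<and> C \<subseteq> U"
  have "\<forall>x\<in>U. \<exists>B\<in>\<B>. x \<in> B \<and> B \<subseteq> U" using * cover by (meson subset_trans)
  then have "U = \<Union>{B \<in> \<B>. B \<subseteq> U}" by auto
  moreover have "openin (topology_generated_by \<B>) (\<Union>{B \<in> \<B>. B \<subseteq> U})"
    by (rule openin_Union) (auto intro: topology_generated_by_Basis)
  ultimately show "openin (topology_generated_by \<B>) U" by metis
qed

lemma openin_edge_end_space:
  assumes "graph V E"
  shows "openin (edge_end_space V E) U \<longleftrightarrow>
    (\<forall>\<omega>\<in>U. \<omega> \<in> edge_ends V E \<and>
       (\<exists>A. fincut V E A \<and> end_in \<omega> A \<and> {\<omega> \<in> edge_ends V E. end_in \<omega> A} \<subseteq> U))"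
proof -
  let ?C = "{{\<omega> \<in> edge_ends V E. end_in \<omega> A} | A. fincut V E A}"
  have "openin (edge_end_space V E) U \<longleftrightarrow> (\<forall>x\<in>U. \<exists>C\<in>?C. x \<in> C \<and> C \<subseteq> U)"
    unfolding edge_end_space_def
  proof (rule openin_generated_by_base)
    show "{region_ends V E C |C. region V E C} \<subseteq> ?C"
      using region_ends_eq[OF assms] by (auto simp: region_iff)
  next
    fix X Y assume "X \<in> ?C" "Y \<in> ?C"
    then obtain A B where "fincut V E A" "fincut V E B"
      "X = {\<omega> \<in> edge_ends V E. end_in \<omega> A}" "Y = {\<omega> \<in> edge_ends V E. end_in \<omega> B}" by auto
    then show "X \<inter> Y \<in> ?C" using end_in_Int[OF assms]
      by (auto intro!: exI[of _ "A \<inter> B"] fincut_Int)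
  next
    fix X \<omega> assume "X \<in> ?C" "\<omega> \<in> X"
    then obtain A where A: "fincut V E A" "X = {\<omega> \<in> edge_ends V E. end_in \<omega> A}"
      "\<omega> \<in> edge_ends V E" "end_in \<omega> A" by auto
    obtain x where x: "x \<in> A" "end_in \<omega> (cc E A x)" using end_in_cc[OF assms A(3,1,4)] .
    have r: "region V E (cc E A x)" using cc_region[OF assms A(1) x(1)] .
    then have "region_ends V E (cc E A x) = {\<omega> \<in> edge_ends V E. end_in \<omega> (cc E A x)}"
      using region_ends_eq[OF assms] by (auto simp: region_iff)
    moreover from this have "region_ends V E (cc E A x) \<subseteq> X"
      using A(2) end_in_mono[OF _ cc_subset[OF x(1)]] by auto
    ultimately show "\<exists>B\<in>{region_ends V E C |C. region V E C}. \<omega> \<in> B \<and> B \<subseteq> X"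
      using r x A by (intro bexI[of _ "region_ends V E (cc E A x)"]) auto
  qed
  also have "\<dots> \<longleftrightarrow> (\<forall>\<omega>\<in>U. \<omega> \<in> edge_ends V E \<and>
       (\<exists>A. fincut V E A \<and> end_in \<omega> A \<and> {\<omega> \<in> edge_ends V E. end_in \<omega> A} \<subseteq> U))"
    by (simp only: bex_setcompr)
  finally show ?thesis .
qed

lemma topspace_edge_end_space:
  assumes "graph V E"
  shows "topspace (edge_end_space V E) = edge_ends V E"
proof -
  have "end_in \<omega> V" if "\<omega> \<in> edge_ends V E" for \<omega>
    using that end_in_whole[OF assms] by blast
  then have "openin (edge_end_space V E) (edge_ends V E)"
    unfolding openin_edge_end_space[OF assms] using fincut_whole[OF assms] by blast
  moreover have "U \<subseteq> edge_ends V E" if "openin (edge_end_space V E) U" for U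
    using that openin_edge_end_space[OF assms] by blast
  ultimately show ?thesis by (meson openin_subset openin_topspace subset_antisym)
qed

fun pt_in :: "'a + (nat \<Rightarrow> 'a) set \<Rightarrow> 'a set \<Rightarrow> bool" where
  "pt_in (Inl v) A \<longleftrightarrow> v \<in> A"
| "pt_in (Inr \<omega>) A \<longleftrightarrow> end_in \<omega> A"

definition pts :: "'a set \<Rightarrow> 'a set set \<Rightarrow> ('a + (nat \<Rightarrow> 'a) set) set" where
  "pts V E = Inl ` V \<union> Inr ` edge_ends V E"

lemma region_closure_eq:
  assumes "graph V E" "fincut V E C"
  shows "region_closure V E C = {x \<in> pts V E. pt_in x C}"
  using assms by (auto simp: region_closure_def region_ends_eq pts_def fincut_def)

lemma pt_in_Int:
  assumes "graph V E" "x \<in> pts V E" "fincut V E A" "fincut V E B"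
  shows "pt_in x (A \<inter> B) \<longleftrightarrow> pt_in x A \<and> pt_in x B"
  using assms end_in_Int[OF assms(1) _ assms(3,4)] by (auto simp: pts_def)

lemma pt_in_mono: "pt_in x A \<Longrightarrow> A \<subseteq> B \<Longrightarrow> pt_in x B"
  by (cases x) (auto intro: end_in_mono)

lemma openin_graph_space:
  assumes "graph V E"
  shows "openin (graph_space V E) U \<longleftrightarrow>
    (\<forall>x\<in>U. x \<in> pts V E \<and> (\<exists>A. fincut V E A \<and> pt_in x A \<and> {x \<in> pts V E. pt_in x A} \<subseteq> U))"
proof -
  let ?C = "{{x \<in> pts V E. pt_in x A} | A. fincut V E A}"
  have "openin (graph_space V E) U \<longleftrightarrow> (\<forall>x\<in>U. \<exists>C\<in>?C. x \<in> C \<and> C \<subseteq> U)"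
    unfolding graph_space_def
  proof (rule openin_generated_by_base)
    show "{region_closure V E C |C. region V E C} \<subseteq> ?C"
      using region_closure_eq[OF assms] by (auto simp: region_iff)
  next
    fix X Y assume "X \<in> ?C" "Y \<in> ?C"
    then obtain A B where "fincut V E A" "fincut V E B"
      "X = {x \<in> pts V E. pt_in x A}" "Y = {x \<in> pts V E. pt_in x B}" by auto
    then show "X \<inter> Y \<in> ?C" using pt_in_Int[OF assms]
      by (auto intro!: exI[of _ "A \<inter> B"] fincut_Int)
  next
    fix X x assume "X \<in> ?C" "x \<in> X"
    then obtain A where A: "fincut V E A" "X = {x \<in> pts V E. pt_in x A}"
      "x \<in> pts V E" "pt_in x A" by auto
    obtain a where a: "a \<in> A" "pt_in x (cc E A a)"
    proof (cases x)
      case (Inl v)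
      then show ?thesis using that[of v] A(4) cc_self[of v E A] by auto
    next
      case (Inr \<omega>)
      then have "\<omega> \<in> edge_ends V E" "end_in \<omega> A" using A by (auto simp: pts_def)
      then show ?thesis using end_in_cc[OF assms _ A(1)] that Inr by auto
    qed
    have r: "region V E (cc E A a)" using cc_region[OF assms A(1) a(1)] .
    then have "region_closure V E (cc E A a) = {x \<in> pts V E. pt_in x (cc E A a)}"
      using region_closure_eq[OF assms] by (auto simp: region_iff)
    moreover from this have "region_closure V E (cc E A a) \<subseteq> X"
      using A(2) pt_in_mono[OF _ cc_subset[OF a(1)]] by auto
    ultimately show "\<exists>B\<in>{region_closure V E C |C. region V E C}. x \<in> B \<and> B \<subseteq> X"
      using r a A by (intro bexI[of _ "region_closure V E (cc E A a)"]) auto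
  qed
  also have "\<dots> \<longleftrightarrow> (\<forall>x\<in>U. x \<in> pts V E \<and>
       (\<exists>A. fincut V E A \<and> pt_in x A \<and> {x \<in> pts V E. pt_in x A} \<subseteq> U))"
    by (simp only: bex_setcompr)
  finally show ?thesis .
qed

lemma topspace_graph_space:
  assumes "graph V E"
  shows "topspace (graph_space V E) = pts V E"
proof -
  have "pt_in x V" if "x \<in> pts V E" for x
    using that end_in_whole[OF assms] by (auto simp: pts_def)
  then have "openin (graph_space V E) (pts V E)"
    unfolding openin_graph_space[OF assms] using fincut_whole[OF assms] by blast
  moreover have "U \<subseteq> pts V E" if "openin (graph_space V E) U" for U
    using that openin_graph_space[OF assms] by blast
  ultimately show ?thesis by (meson openin_subset openin_topspace subset_antisym)
qed

section \<open>Compactness\<close>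

definition lev :: "'a set set \<Rightarrow> 'a \<Rightarrow> 'a \<Rightarrow> nat" where
  "lev E r x = (LEAST n. (r, x) \<in> adj E ^^ n)"

text \<open>Edges leading one step further away from \<open>r\<close>. Paths along them climb one
  level per step and take the place of a breadth-first spanning tree.\<close>

definition up :: "'a set set \<Rightarrow> 'a \<Rightarrow> ('a \<times> 'a) set" where
  "up E r = {(x, y). {x, y} \<in> E \<and> lev E r y = Suc (lev E r x)}"

lemma lev_le: "(r, x) \<in> adj E ^^ n \<Longrightarrow> lev E r x \<le> n"
  unfolding lev_def by (rule Least_le)

lemma lev_reach: "(r, x) \<in> (adj E)\<^sup>* \<Longrightarrow> (r, x) \<in> adj E ^^ lev E r x"
  unfolding lev_def rtrancl_power by (rule LeastI_ex)

lemma lev_self [simp]: "lev E r r = 0"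
  using lev_le[of r r 0 E] by simp

lemma lev_pred:
  assumes "(r, x) \<in> (adj E)\<^sup>*" "x \<noteq> r"
  obtains y where "(y, x) \<in> up E r" "(r, y) \<in> (adj E)\<^sup>*"
proof -
  have "lev E r x \<noteq> 0" using lev_reach[OF assms(1)] assms(2) by (auto intro!: Nat.gr0I)
  then obtain n where n: "lev E r x = Suc n" by (cases "lev E r x") auto
  then obtain y where y: "(r, y) \<in> adj E ^^ n" "{y, x} \<in> E"
    using lev_reach[OF assms(1)] by auto
  have ry: "(r, y) \<in> (adj E)\<^sup>*" using y(1) rtrancl_power by blast
  have "lev E r x \<le> Suc (lev E r y)"
    by (rule lev_le) (use lev_reach[OF ry] y(2) in auto)
  moreover have "lev E r y \<le> n" using lev_le y(1) .
  ultimately have "(y, x) \<in> up E r" using n y(2) by (simp add: up_def)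
  with ry show ?thesis using that by blast
qed

lemma up_reach:
  assumes "(r, x) \<in> (adj E)\<^sup>*"
  shows "(r, x) \<in> (up E r)\<^sup>*"
  using assms
proof (induction "lev E r x" arbitrary: x rule: less_induct)
  case less
  show ?case
  proof (cases "x = r")
    case False
    obtain y where y: "(y, x) \<in> up E r" "(r, y) \<in> (adj E)\<^sup>*"
      using lev_pred[OF less(2) False] .
    then have "lev E r y < lev E r x" by (simp add: up_def)
    from less(1)[OF this y(2)] y(1) show ?thesis by (rule rtrancl_into_rtrancl)
  qed simp
qed

lemma up_lev: "(x, y) \<in> (up E r)\<^sup>* \<Longrightarrow> lev E r x \<le> lev E r y"
  by (induction rule: rtrancl_induct) (auto simp: up_def)

lemma up_edge: "(x, y) \<in> up E r \<Longrightarrow> {x, y} \<in> E"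
  by (simp add: up_def)

lemma finite_boundary_verts:
  assumes "graph V E" "fincut V E A"
  shows "finite (\<Union>(edge_boundary E A))"
proof (rule finite_Union)
  show "finite (edge_boundary E A)" using assms by (simp add: fincut_def)
  fix e assume "e \<in> edge_boundary E A"
  then have "e \<in> E" by (simp add: edge_boundary_def)
  then show "finite e" using assms(1) by (auto elim: graph_edgeE)
qed

locale conn_graph =
  fixes V :: "'a set" and E :: "'a set set"
  assumes graph: "graph V E" and conn: "connected_graph V E"
begin

lemma reach: "x \<in> V \<Longrightarrow> y \<in> V \<Longrightarrow> (x, y) \<in> (adj E)\<^sup>*"
  using conn by (simp add: connected_graph_iff[OF graph])

text \<open>All but finitely many targets lie outside \<open>A\<close>, and each climbing path to
  them passes one of the finitely many ends of boundary edges. By pigeonhole infinitely many are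
  reached through one such vertex \<open>b\<close>; the first step towards \<open>b\<close> gives
  \<open>z\<close>.\<close>

lemma infinite_above_step:
  assumes "S \<subseteq> V" "y \<in> V" "infinite {s \<in> S. (y, s) \<in> (up E r)\<^sup>*}"
    and A: "fincut V E A" "y \<in> A" "finite (A \<inter> S)"
  shows "\<exists>z. (y, z) \<in> up E r \<and> infinite {s \<in> S. (z, s) \<in> (up E r)\<^sup>*}"
proof -
  let ?S = "\<lambda>z. {s \<in> S. (z, s) \<in> (up E r)\<^sup>*}"
  let ?B = "{b \<in> \<Union>(edge_boundary E A). (y, b) \<in> (up E r)\<^sup>+}"
  have fin: "finite ?B" using finite_boundary_verts[OF graph A(1)] by (rule rev_finite_subset) auto
  have "?S y - A \<subseteq> (\<Union>b\<in>?B. ?S b)"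
  proof
    fix s assume s: "s \<in> ?S y - A"
    then have "(y, s) \<in> (up E r)\<^sup>*" "s \<notin> A" by auto
    from rtrancl_crossing[OF this(1) A(2) this(2)] obtain a b
      where ab: "(y, a) \<in> (up E r)\<^sup>*" "(a, b) \<in> up E r" "(b, s) \<in> (up E r)\<^sup>*" "a \<in> A" "b \<notin> A"
      by blast
    then have "{a, b} \<in> edge_boundary E A" by (intro edge_in_boundary) (auto dest: up_edge)
    moreover have "(y, b) \<in> (up E r)\<^sup>+" using ab(1,2) by (rule rtrancl_into_trancl1)
    ultimately have "b \<in> ?B" by blast
    then show "s \<in> (\<Union>b\<in>?B. ?S b)" using ab(3) s by blast
  qed
  moreover have "infinite (?S y - A)"
  proof
    assume "finite (?S y - A)"
    then have "finite ((?S y - A) \<union> (A \<inter> S))" using A(3) by simp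
    then have "finite (?S y)" by (rule rev_finite_subset) auto
    with assms(3) show False by simp
  qed
  ultimately have "infinite (\<Union>b\<in>?B. ?S b)" using finite_subset by blast
  then have "\<not> (\<forall>b\<in>?B. finite (?S b))" by (simp only: finite_UN[OF fin] not_False_eq_True)
  then obtain b where b: "b \<in> ?B" "infinite (?S b)" unfolding Ball_def not_all not_imp by (elim exE conjE) (rule that)
  then have "(y, b) \<in> (up E r)\<^sup>+" by simp
  then obtain z where z: "(y, z) \<in> up E r" "(z, b) \<in> (up E r)\<^sup>*" by (meson tranclD)
  have "?S b \<subseteq> ?S z" using z(2) by (auto intro: rtrancl_trans)
  then have "infinite (?S z)" using b(2) finite_subset by blast
  with z(1) show ?thesis by blast
qed

text \<open>Koenig's argument, with finite degrees replaced by a cut around each vertex that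
  contains only finitely many elements of \<open>S\<close>.\<close>

lemma ray_of_no_adherent_vertex:
  assumes r: "r \<in> V" and S: "S \<subseteq> V" "infinite S"
    and no: "\<And>c. c \<in> V \<Longrightarrow> \<exists>A. fincut V E A \<and> c \<in> A \<and> finite (A \<inter> S)"
  shows "\<exists>p. ray V E p \<and> (\<forall>i. lev E r (p i) = i) \<and>
    (\<forall>i. infinite {s \<in> S. (p i, s) \<in> (up E r)\<^sup>*})"
proof -
  let ?S = "\<lambda>z. {s \<in> S. (z, s) \<in> (up E r)\<^sup>*}"
  let ?P = "\<lambda>(n::nat) y. y \<in> V \<and> infinite (?S y) \<and> lev E r y = n"
  have "(r, s) \<in> (up E r)\<^sup>*" if "s \<in> S" for s
    using up_reach[OF reach[OF r]] that S(1) by blast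
  then have "?S r = S" by auto
  then have 0: "\<exists>y. ?P 0 y" using r S by (intro exI[of _ r]) simp
  have "\<exists>z. ?P (Suc n) z \<and> (y, z) \<in> up E r" if "?P n y" for n y
  proof -
    have y: "y \<in> V" "infinite (?S y)" using that by simp_all
    obtain A where A: "fincut V E A" "y \<in> A" "finite (A \<inter> S)" using no[OF y(1)] by auto
    obtain z where z: "(y, z) \<in> up E r" "infinite (?S z)"
      using infinite_above_step[OF S(1) y A] by auto
    then show ?thesis using graphD(2)[OF graph up_edge[OF z(1)]] that by (auto simp: up_def)
  qed
  from dependent_nat_choice[of ?P "\<lambda>n y z. (y, z) \<in> up E r", OF 0 this]
  obtain p where p: "\<And>n. ?P n (p n)" "\<And>n. (p n, p (Suc n)) \<in> up E r" by blast
  have "inj p" by (rule injI) (metis p(1))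
  then have "ray V E p" using p(1) up_edge[OF p(2)] by (auto simp: ray_def)
  with p(1) show ?thesis by (intro exI[of _ p]) blast
qed

text \<open>The elements of \<open>S\<close> accumulate at the point given by \<open>p\<close>: a
  vertex if \<open>p\<close> is constant, an end if \<open>p\<close> is a ray.\<close>

definition adherent :: "'a set \<Rightarrow> (nat \<Rightarrow> 'a) \<Rightarrow> bool" where
  "adherent S p \<longleftrightarrow> (\<forall>A. fincut V E A \<and> ev_in p A \<longrightarrow> infinite (A \<inter> S))"

theorem compactness:
  assumes S: "S \<subseteq> V" "infinite S"
  shows "(\<exists>c\<in>V. adherent S (\<lambda>_. c)) \<or> (\<exists>p. ray V E p \<and> adherent S p)"
proof (rule disjCI)
  assume "\<not> (\<exists>p. ray V E p \<and> adherent S p)"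
  show "\<exists>c\<in>V. adherent S (\<lambda>_. c)"
  proof (rule ccontr)
    assume "\<not> (\<exists>c\<in>V. adherent S (\<lambda>_. c))"
    then have no: "\<exists>A. fincut V E A \<and> c \<in> A \<and> finite (A \<inter> S)" if "c \<in> V" for c
      using that by (auto simp: adherent_def)
    obtain r where r: "r \<in> V" using conn by (auto simp: connected_graph_def)
    obtain p where p: "ray V E p" "\<And>i. lev E r (p i) = i"
      "\<And>i. infinite {s \<in> S. (p i, s) \<in> (up E r)\<^sup>*}"
      using ray_of_no_adherent_vertex[OF r S no] by auto
    have "adherent S p"
      unfolding adherent_def
    proof (intro allI impI, elim conjE)
      fix A assume A: "fincut V E A" "ev_in p A"
      \<comment> \<open>Ends of boundary edges have level below \<open>m\<close>, so no climbing
        path that starts in \<open>A\<close> at level \<open>m\<close> or higher can leave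
        \<open>A\<close>.\<close>
      obtain m where m: "\<forall>v\<in>\<Union>(edge_boundary E A). lev E r v < m"
        using finite_nat_set_iff_bounded[of "lev E r ` \<Union>(edge_boundary E A)"]
          finite_boundary_verts[OF graph A(1)] by auto
      obtain n where n: "\<And>i. i \<ge> n \<Longrightarrow> p i \<in> A" using A(2) by (auto simp: eventually_sequentially)
      define i where "i = max m n"
      have "{s \<in> S. (p i, s) \<in> (up E r)\<^sup>*} \<subseteq> A \<inter> S"
      proof (rule ccontr)
        assume "\<not> ?thesis"
        then obtain s where s: "(p i, s) \<in> (up E r)\<^sup>*" "s \<notin> A" by auto
        have "p i \<in> A" using n by (simp add: i_def)
        from rtrancl_crossing[OF s(1) this s(2)] obtain a b
          where ab: "(p i, a) \<in> (up E r)\<^sup>*" "(a, b) \<in> up E r" "a \<in> A" "b \<notin> A" by blast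
        then have "{a, b} \<in> edge_boundary E A" by (intro edge_in_boundary) (auto dest: up_edge)
        then have "lev E r a < m" using m by blast
        moreover have "i \<le> lev E r a" using up_lev[OF ab(1)] p(2) by simp
        ultimately show False by (simp add: i_def)
      qed
      then show "infinite (A \<inter> S)" using p(3) finite_subset by blast
    qed
    with p(1) show False using \<open>\<not> (\<exists>p. ray V E p \<and> adherent S p)\<close> by blast
  qed
qed

text \<open>Otherwise the climbing ray of \<open>ray_of_no_adherent_vertex\<close> would have
  elements of \<open>S\<close> above its vertex of level \<open>Suc k\<close>.\<close>

lemma bounded_level_adherent:
  assumes r: "r \<in> V" and S: "S \<subseteq> V" "infinite S" "\<And>s. s \<in> S \<Longrightarrow> lev E r s \<le> k"
  shows "\<exists>c\<in>V. \<forall>A. fincut V E A \<and> c \<in> A \<longrightarrow> infinite (A \<inter> S)"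
proof (rule ccontr)
  assume "\<not> ?thesis"
  then have no: "\<exists>A. fincut V E A \<and> c \<in> A \<and> finite (A \<inter> S)" if "c \<in> V" for c
    using that by blast
  obtain p where p: "\<And>i. lev E r (p i) = i" "\<And>i. infinite {s \<in> S. (p i, s) \<in> (up E r)\<^sup>*}"
    using ray_of_no_adherent_vertex[OF r S(1,2) no] by auto
  have "{s \<in> S. (p (Suc k), s) \<in> (up E r)\<^sup>*} = {}"
    using up_lev[of "p (Suc k)" _ E r] p(1)[of "Suc k"] S(3) by fastforce
  with p(2)[of "Suc k"] show False by simp
qed

end

section \<open>Star decompositions\<close>

locale rooted_graph = conn_graph V E for V :: "'a set" and E :: "'a set set" +
  fixes r :: 'a
  assumes root: "r \<in> V"
begin

text \<open>The weight dominates the level of each end, so light cuts have their boundary near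
  \<open>r\<close>. The \<open>Suc\<close> makes weights visibly positive, so that a bound on the
  weight also bounds the number of edges.\<close>

definition wt :: "'a set \<Rightarrow> nat" where
  "wt e = Suc (\<Sum>v\<in>e. lev E r v)"

definition W :: "'a set \<Rightarrow> nat" where
  "W A = sum wt (edge_boundary E A)"

definition point :: "(nat \<Rightarrow> 'a) \<Rightarrow> bool" where
  "point p \<longleftrightarrow> (\<exists>c\<in>V. p = (\<lambda>_. c)) \<or> ray V E p"

definition sepcut :: "(nat \<Rightarrow> 'a) \<Rightarrow> 'a set \<Rightarrow> bool" where
  "sepcut p A \<longleftrightarrow> fincut V E A \<and> r \<notin> A \<and> ev_in p A"

definition kap :: "(nat \<Rightarrow> 'a) \<Rightarrow> nat" where
  "kap p = (LEAST k. \<exists>A. sepcut p A \<and> W A = k)"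

definition optcut :: "(nat \<Rightarrow> 'a) \<Rightarrow> 'a set \<Rightarrow> bool" where
  "optcut p A \<longleftrightarrow> sepcut p A \<and> W A = kap p"

text \<open>An infinite intersection of cuts may fail to have a finite boundary or to contain a tail
  of \<open>p\<close>; \<open>mincut_optcut\<close> excludes both.\<close>

definition mincut :: "(nat \<Rightarrow> 'a) \<Rightarrow> 'a set" where
  "mincut p = \<Inter>{A. optcut p A}"

definition sep :: "(nat \<Rightarrow> 'a) \<Rightarrow> bool" where
  "sep p \<longleftrightarrow> point p \<and> (\<exists>A. sepcut p A)"

lemma point_decides: "point p \<Longrightarrow> fincut V E A \<Longrightarrow> ev_in p A \<or> ev_in p (V - A)"
  using ray_decides by (fastforce simp: point_def)

lemma point_not_in:
  assumes "point p" "fincut V E A" "\<not> ev_in p A"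
  shows "ev_in p (V - A)"
  using point_decides assms by blast

section \<open>Submodularity and limits of cuts of bounded weight\<close>

lemma W_eq:
  assumes "finite F" "edge_boundary E A \<subseteq> F"
  shows "W A = (\<Sum>e\<in>F. if e \<in> edge_boundary E A then wt e else 0)"
  unfolding W_def using assms by (simp add: sum.If_cases Int_absorb1)

text \<open>Comparison edge by edge over the union of the boundaries of \<open>A\<close> and
  \<open>B\<close>: each edge is counted at most as often on the left as on the right.\<close>

lemma W_sum_le:
  assumes "fincut V E A" "fincut V E B"
    and "\<And>e. e \<in> edge_boundary E C \<Longrightarrow> e \<in> edge_boundary E A \<or> e \<in> edge_boundary E B"
    and "\<And>e. e \<in> edge_boundary E D \<Longrightarrow> e \<in> edge_boundary E A \<or> e \<in> edge_boundary E B"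
    and "\<And>e. e \<in> edge_boundary E C \<Longrightarrow> e \<in> edge_boundary E D \<Longrightarrow>
      e \<in> edge_boundary E A \<and> e \<in> edge_boundary E B"
  shows "W C + W D \<le> W A + W B"
proof -
  define F where "F = edge_boundary E A \<union> edge_boundary E B"
  have F: "finite F" using assms by (simp add: F_def fincut_def)
  have "W C + W D = (\<Sum>e\<in>F. (if e \<in> edge_boundary E C then wt e else 0) +
      (if e \<in> edge_boundary E D then wt e else 0))"
    using W_eq[OF F, of C] W_eq[OF F, of D] assms(3,4) by (simp add: F_def subset_iff sum.distrib)
  also have "\<dots> \<le> (\<Sum>e\<in>F. (if e \<in> edge_boundary E A then wt e else 0) +
      (if e \<in> edge_boundary E B then wt e else 0))"
    by (rule sum_mono) (use assms(3-5) in auto)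
  also have "\<dots> = W A + W B"
    using W_eq[OF F, of A] W_eq[OF F, of B] by (simp add: F_def sum.distrib)
  finally show ?thesis .
qed

lemma W_Int_Un: "fincut V E A \<Longrightarrow> fincut V E B \<Longrightarrow> W (A \<inter> B) + W (A \<union> B) \<le> W A + W B"
  by (rule W_sum_le) (auto simp: edge_boundary_def)

lemma W_Diff: "fincut V E A \<Longrightarrow> fincut V E B \<Longrightarrow> W (A - B) + W (B - A) \<le> W A + W B"
  by (rule W_sum_le) (unfold edge_boundary_def, blast+)

text \<open>A cut that agrees with \<open>Z\<close> on the ends of finitely many boundary edges of
  \<open>Z\<close> has all these edges in its own boundary, so together they weigh at most
  \<open>k\<close>. As weights are positive, \<open>Z\<close> has at most \<open>k\<close> boundary
  edges.\<close>

lemma limit_of_cuts: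
  assumes Z: "Z \<subseteq> V"
    and approx: "\<And>F. finite F \<Longrightarrow> F \<subseteq> V \<Longrightarrow> \<exists>A. fincut V E A \<and> W A \<le> k \<and> A \<inter> F = Z \<inter> F"
  shows "fincut V E Z \<and> W Z \<le> k"
proof -
  have *: "sum wt G \<le> k" if G: "finite G" "G \<subseteq> edge_boundary E Z" for G
  proof -
    have GE: "e \<in> E" if "e \<in> G" for e using G(2) that by (auto simp: edge_boundary_def)
    have "finite e \<and> e \<subseteq> V" if "e \<in> G" for e
      using graph_edgeE[OF graph GE[OF that]] by auto
    then have "finite (\<Union>G)" "\<Union>G \<subseteq> V" using G(1) by auto
    then obtain A where A: "fincut V E A" "W A \<le> k" "A \<inter> \<Union>G = Z \<inter> \<Union>G"
      using approx[of "\<Union>G"] by metis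
    have "G \<subseteq> edge_boundary E A"
    proof
      fix e assume e: "e \<in> G"
      then have "e \<inter> A = e \<inter> Z" using A(3) by blast
      moreover have "e \<in> edge_boundary E Z" using e G by blast
      ultimately show "e \<in> edge_boundary E A" by (auto simp: edge_boundary_def)
    qed
    then have "sum wt G \<le> W A"
      unfolding W_def using A(1) by (intro sum_mono2) (auto simp: fincut_def)
    with A(2) show ?thesis by simp
  qed
  have "finite (edge_boundary E Z)"
  proof (rule ccontr)
    assume "infinite (edge_boundary E Z)"
    then obtain G where G: "finite G" "card G = Suc k" "G \<subseteq> edge_boundary E Z"
      using infinite_arbitrarily_large by blast
    have "card G = (\<Sum>e\<in>G. 1)" by simp
    also have "\<dots> \<le> sum wt G" by (rule sum_mono) (simp add: wt_def)
    finally show False using *[OF G(1,3)] G(2) by simp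
  qed
  with *[OF this] Z show ?thesis by (simp add: fincut_def W_def)
qed

section \<open>Minimal cuts separating a point from the root\<close>

lemma kap_le: "sepcut p A \<Longrightarrow> kap p \<le> W A"
  unfolding kap_def by (rule Least_le) blast

lemma optcut_exists: "sep p \<Longrightarrow> \<exists>A. optcut p A"
  unfolding sep_def optcut_def kap_def by (elim conjE exE) (rule LeastI_ex, blast)

lemma optcut_Int:
  assumes "optcut p A" "optcut p B"
  shows "optcut p (A \<inter> B)"
proof -
  have s: "sepcut p A" "sepcut p B" "W A = kap p" "W B = kap p" using assms by (auto simp: optcut_def)
  then have i: "sepcut p (A \<inter> B)" by (auto simp: sepcut_def fincut_Int eventually_conj)
  have "ev_in p (A \<union> B)" using s(1) by (auto simp: sepcut_def elim: eventually_mono)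
  then have u: "sepcut p (A \<union> B)" using s by (auto simp: sepcut_def fincut_Un)
  have "W (A \<inter> B) + W (A \<union> B) \<le> W A + W B" using s by (intro W_Int_Un) (auto simp: sepcut_def)
  then show ?thesis using kap_le[OF i] kap_le[OF u] i s by (simp add: optcut_def)
qed

lemma mincut_subset: "optcut p A \<Longrightarrow> mincut p \<subseteq> A"
  by (auto simp: mincut_def)

text \<open>Each vertex of \<open>F\<close> outside the intersection is omitted by some lightest
  cut, and finitely many of these may be intersected by \<open>optcut_Int\<close>. This is the
  approximation that \<open>limit_of_cuts\<close> asks for.\<close>

lemma mincut_approx:
  assumes "sep p" "finite F"
  shows "\<exists>A. optcut p A \<and> A \<inter> F = mincut p \<inter> F"
proof -
  have "\<exists>A. optcut p A \<and> A \<inter> F \<subseteq> mincut p"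
    using assms(2)
  proof (induction F rule: finite_induct)
    case empty
    show ?case using optcut_exists[OF assms(1)] by simp
  next
    case (insert v F)
    then obtain A where A: "optcut p A" "A \<inter> F \<subseteq> mincut p" by blast
    show ?case
    proof (cases "v \<in> mincut p")
      case True
      then show ?thesis using A by blast
    next
      case False
      then obtain B where "optcut p B" "v \<notin> B" by (auto simp: mincut_def)
      then show ?thesis using A optcut_Int[OF A(1)] by (intro exI[of _ "A \<inter> B"]) auto
    qed
  qed
  then show ?thesis using mincut_subset by blast
qed

lemma mincut_cut:
  assumes "sep p"
  shows "fincut V E (mincut p)" "W (mincut p) \<le> kap p" "r \<notin> mincut p"
proof -
  obtain A where A: "optcut p A" using optcut_exists[OF assms] by blast
  have "mincut p \<subseteq> V" "r \<notin> mincut p"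
    using mincut_subset[OF A] A by (auto simp: optcut_def sepcut_def fincut_def)
  moreover have "\<exists>A. fincut V E A \<and> W A \<le> kap p \<and> A \<inter> F = mincut p \<inter> F" if "finite F" for F
    using mincut_approx[OF assms that] by (auto simp: optcut_def sepcut_def)
  ultimately show "fincut V E (mincut p)" "W (mincut p) \<le> kap p" "r \<notin> mincut p"
    using limit_of_cuts[of "mincut p" "kap p"] by blast+
qed

lemma mincut_const: "c \<in> mincut (\<lambda>_. c)"
  by (auto simp: mincut_def optcut_def sepcut_def)

text \<open>The vertices of low level on the ray accumulate at a vertex \<open>c\<close>. A cut
  around \<open>c\<close> meets the ray infinitely often and hence contains a tail; complements give
  the converse.\<close>

lemma ray_dominated:
  assumes p: "ray V E p" and inf: "infinite {i. lev E r (p i) \<le> k}"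
  obtains c where "c \<in> V" "\<And>A. fincut V E A \<Longrightarrow> ev_in p A \<longleftrightarrow> c \<in> A"
proof -
  let ?S = "p ` {i. lev E r (p i) \<le> k}"
  have "infinite ?S" using inf rayD(1)[OF p] by (simp add: finite_image_iff inj_on_subset)
  moreover have "?S \<subseteq> V" using rayD(2)[OF p] by auto
  moreover have "lev E r s \<le> k" if "s \<in> ?S" for s using that by auto
  ultimately obtain c where c: "c \<in> V" "\<And>A. fincut V E A \<Longrightarrow> c \<in> A \<Longrightarrow> infinite (A \<inter> ?S)"
    using bounded_level_adherent[OF root, of ?S k] by metis
  have 1: "ev_in p A" if "fincut V E A" "c \<in> A" for A
  proof -
    have "A \<inter> ?S \<subseteq> p ` {i. p i \<in> A}" by auto
    then have "infinite {i. p i \<in> A}" using c(2)[OF that] finite_subset by blast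
    then show ?thesis by (rule ray_frequently_in[OF p that(1)])
  qed
  have "ev_in p A \<longleftrightarrow> c \<in> A" if "fincut V E A" for A
    using 1[OF that] 1[OF fincut_Compl[OF graph that]] ray_not_in_iff[OF p that] c(1) by blast
  with c(1) show ?thesis using that by blast
qed

text \<open>A ray meets few edges of small weight, unless some vertex cannot be separated from it.\<close>

lemma mincut_ev_in:
  assumes "sep p"
  shows "ev_in p (mincut p)"
proof -
  consider (vertex) c where "c \<in> V" "p = (\<lambda>_. c)"
    | (dominated) k where "ray V E p" "infinite {i. lev E r (p i) \<le> k}"
    | (escaping) "ray V E p" "finite {i. lev E r (p i) \<le> kap p}"
    using assms by (auto simp: sep_def point_def)
  then show ?thesis
  proof cases
    case vertex
    then show ?thesis using mincut_const by simp
  next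
    case dominated
    obtain c where c: "c \<in> V" "\<And>A. fincut V E A \<Longrightarrow> ev_in p A \<longleftrightarrow> c \<in> A"
      using ray_dominated[OF dominated] by blast
    \<comment> \<open>Lying in the same cuts, \<open>p\<close> and \<open>c\<close> have the same
      lightest cuts, which reduces this case to that of a vertex.\<close>
    have "sepcut p A \<longleftrightarrow> sepcut (\<lambda>_. c) A" for A using c(2) by (auto simp: sepcut_def)
    then have "mincut p = mincut (\<lambda>_. c)" by (simp add: mincut_def optcut_def kap_def)
    then have "c \<in> mincut p" using mincut_const by simp
    then show ?thesis using c(2)[OF mincut_cut(1)[OF assms]] by blast
  next
    case escaping
    then obtain n where n: "\<forall>i\<in>{i. lev E r (p i) \<le> kap p}. i < n"
      using finite_nat_set_iff_bounded by blast
    have "p i \<in> A" if i: "i \<ge> n" and A: "optcut p A" for i A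
    proof (rule ccontr)
      assume "p i \<notin> A"
      have A': "fincut V E A" "ev_in p A" "W A = kap p" using A by (auto simp: optcut_def sepcut_def)
      obtain m where m: "\<And>j. j \<ge> m \<Longrightarrow> p j \<in> A" using A'(2) by (auto simp: eventually_sequentially)
      have "\<exists>j\<ge>i. p j \<notin> A \<and> p (Suc j) \<in> A"
      proof (rule ccontr)
        assume no: "\<not> ?thesis"
        have "p j \<notin> A" if "j \<ge> i" for j
          using that
        proof (induction rule: dec_induct)
          case (step j)
          then show ?case using no by blast
        qed (rule \<open>p i \<notin> A\<close>)
        then show False using m[of "max m i"] by simp
      qed
      then obtain j where j: "j \<ge> i" "p j \<notin> A" "p (Suc j) \<in> A" by blast
      have e: "{p (Suc j), p j} \<in> edge_boundary E A"
        by (rule edge_in_boundary[OF _ j(3,2)]) (use rayD(3)[OF escaping(1)] in \<open>simp add: insert_commute\<close>)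
      \<comment> \<open>The edge by which the ray enters \<open>A\<close> weighs at most
        \<open>kap p\<close>, which bounds the level of its outer end. As \<open>n\<close> was
        chosen independently of \<open>A\<close>, one tail lies in all lightest cuts.\<close>
      have "lev E r (p j) \<le> wt {p (Suc j), p j}"
        using rayD(1)[OF escaping(1)] by (simp add: wt_def inj_eq)
      also have "\<dots> \<le> W A"
        unfolding W_def using e A'(1) by (intro member_le_sum) (auto simp: fincut_def)
      finally have "j < n" using n A'(3) by simp
      with i j show False by simp
    qed
    then show ?thesis by (auto simp: mincut_def eventually_sequentially)
  qed
qed

lemma mincut_optcut: "sep p \<Longrightarrow> optcut p (mincut p)"
  using mincut_cut[of p] mincut_ev_in[of p] kap_le[of p "mincut p"]
  by (simp add: optcut_def sepcut_def)

text \<open>If \<open>q\<close> lies in the cut of \<open>p\<close>, that cut is also lightest for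
  \<open>q\<close>, because of \<open>pq\<close>. Otherwise the two cuts are uncrossed: by
  intersection and union if \<open>p\<close> lies in the cut of \<open>q\<close>, by the two
  differences if not. Of the resulting sets one separates \<open>p\<close> and the other
  \<open>q\<close>, so no weight can drop and the set for \<open>p\<close> is lightest; minimality
  of \<open>mincut p\<close> then gives inclusion or disjointness.\<close>

lemma mincut_laminar:
  assumes p: "sep p" and q: "sep q" and pq: "kap p \<le> kap q"
  shows "mincut p \<subseteq> mincut q \<or> mincut q \<subseteq> mincut p \<or> mincut p \<inter> mincut q = {}"
proof -
  let ?A = "mincut p" and ?B = "mincut q"
  have A: "fincut V E ?A" "r \<notin> ?A" "ev_in p ?A" "W ?A = kap p"
    using mincut_optcut[OF p] by (auto simp: optcut_def sepcut_def)
  have B: "fincut V E ?B" "r \<notin> ?B" "ev_in q ?B" "W ?B = kap q"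
    using mincut_optcut[OF q] by (auto simp: optcut_def sepcut_def)
  note cuts = fincut_Int[OF A(1) B(1)] fincut_Un[OF A(1) B(1)]
    fincut_Diff[OF graph A(1) B(1)] fincut_Diff[OF graph B(1) A(1)]
  show ?thesis
  proof (cases "ev_in q ?A")
    case True
    then have "sepcut q ?A" using A by (simp add: sepcut_def)
    then have "optcut q ?A" using kap_le[of q ?A] pq A by (simp add: optcut_def)
    then show ?thesis using mincut_subset by blast
  next
    case qA: False
    have qA': "ev_in q (V - ?A)" using point_not_in q A(1) qA by (auto simp: sep_def)
    show ?thesis
    proof (cases "ev_in p ?B")
      case True
      have i: "sepcut p (?A \<inter> ?B)"
        using True A cuts by (auto simp: sepcut_def eventually_conj)
      have "ev_in q (?A \<union> ?B)" by (rule ev_in_mono[OF B(3)]) auto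
      then have "sepcut q (?A \<union> ?B)" using A B cuts by (auto simp: sepcut_def)
      from kap_le[OF this] kap_le[OF i] W_Int_Un[OF A(1) B(1)] A B
      have "optcut p (?A \<inter> ?B)" using i by (simp add: optcut_def)
      then show ?thesis using mincut_subset by blast
    next
      case False
      have pB: "ev_in p (V - ?B)" using point_not_in p B(1) False by (auto simp: sep_def)
      have "ev_in p (?A - ?B)" using eventually_conj[OF A(3) pB] by (rule eventually_mono) auto
      then have d: "sepcut p (?A - ?B)" using A cuts by (auto simp: sepcut_def)
      have "ev_in q (?B - ?A)" using eventually_conj[OF B(3) qA'] by (rule eventually_mono) auto
      then have "sepcut q (?B - ?A)" using B cuts by (auto simp: sepcut_def)
      from kap_le[OF this] kap_le[OF d] W_Diff[OF A(1) B(1)] A B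
      have "optcut p (?A - ?B)" using d by (simp add: optcut_def)
      then show ?thesis using mincut_subset by blast
    qed
  qed
qed

lemma mincut_nested:
  assumes "sep p" "sep q" "x \<in> mincut p" "x \<in> mincut q"
  shows "mincut p \<subseteq> mincut q \<or> mincut q \<subseteq> mincut p"
  using mincut_laminar[OF assms(1,2)] mincut_laminar[OF assms(2,1)] assms(3,4)
  by (meson disjoint_iff nle_le)

section \<open>Hulls and their differences\<close>

definition khull :: "nat \<Rightarrow> 'a \<Rightarrow> 'a set" where
  "khull k x = \<Union>{mincut p | p. sep p \<and> x \<in> mincut p \<and> kap p \<le> k}"

lemma khull_iff: "y \<in> khull k x \<longleftrightarrow> (\<exists>p. sep p \<and> x \<in> mincut p \<and> y \<in> mincut p \<and> kap p \<le> k)"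
  by (auto simp: khull_def)

text \<open>The members of the union form a chain, so on a finite set the union agrees with one
  member, of weight at most \<open>k\<close>, and \<open>limit_of_cuts\<close> applies. Indexing by
  \<open>k\<close> is what turns the chain through \<open>x\<close> into a sequence of order type at
  most \<omega>.\<close>

lemma khull_cut: "fincut V E (khull k x)"
proof (cases "\<exists>p. sep p \<and> x \<in> mincut p \<and> kap p \<le> k")
  case False
  then have "khull k x = {}" unfolding khull_def by blast
  then show ?thesis by (simp add: fincut_empty)
next
  case True
  let ?M = "{mincut p | p. sep p \<and> x \<in> mincut p \<and> kap p \<le> k}"
  have ne: "?M \<noteq> {}" using True by blast
  have chain: "subset.chain UNIV ?M"
    unfolding subset.chain_def using mincut_nested by blast
  have "khull k x \<subseteq> V" using mincut_cut(1) unfolding khull_def fincut_def by blast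
  moreover have "\<exists>A. fincut V E A \<and> W A \<le> k \<and> A \<inter> F = khull k x \<inter> F" if F: "finite F" for F
  proof -
    obtain A where A: "A \<in> ?M" "khull k x \<inter> F \<subseteq> A"
      using finite_subset_Union_chain[of "khull k x \<inter> F" ?M UNIV] F ne chain
      unfolding khull_def by blast
    then obtain p where p: "sep p" "kap p \<le> k" "A = mincut p" by blast
    have "A \<subseteq> khull k x" using A(1) unfolding khull_def by blast
    then have "A \<inter> F = khull k x \<inter> F" using A(2) by blast
    then show ?thesis using mincut_cut[OF p(1)] p(2,3) le_trans by blast
  qed
  ultimately show ?thesis using limit_of_cuts[of "khull k x" k] by blast
qed

lemma root_notin_khull: "r \<notin> khull k x"
  using mincut_cut(3) by (auto simp: khull_iff)

text \<open>An equivalence relation on the vertices covered by minimal cuts. Its classes are the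
  unions of the chains, and transitivity is laminarity.\<close>

definition linked :: "'a \<Rightarrow> 'a \<Rightarrow> bool" where
  "linked x y \<longleftrightarrow> (\<exists>p. sep p \<and> x \<in> mincut p \<and> y \<in> mincut p)"

lemma linked_khull: "linked x y \<longleftrightarrow> (\<exists>k. y \<in> khull k x)"
  unfolding linked_def khull_iff by blast

lemma linked_sym: "linked x y \<Longrightarrow> linked y x"
  unfolding linked_def by blast

lemma linked_trans:
  assumes "linked x y" "linked y z"
  shows "linked x z"
proof -
  obtain p q where pq: "sep p" "x \<in> mincut p" "y \<in> mincut p" "sep q" "y \<in> mincut q" "z \<in> mincut q"
    using assms by (auto simp: linked_def)
  from mincut_nested[OF pq(1,4,3,5)] show ?thesis
    using pq unfolding linked_def by blast
qed

text \<open>The hulls at different vertices of one class may differ in their early members; taking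
  them at a common representative makes the pieces of a class disjoint.\<close>

definition rep :: "'a \<Rightarrow> 'a" where
  "rep x = (SOME y. linked x y)"

lemma rep_eq: "linked x y \<Longrightarrow> rep x = rep y"
proof -
  assume xy: "linked x y"
  have "linked x z \<longleftrightarrow> linked y z" for z
    using linked_trans[OF xy] linked_trans[OF linked_sym[OF xy]] by blast
  then show ?thesis by (simp add: rep_def)
qed

lemma linked_rep: "linked x y \<Longrightarrow> linked x (rep x)"
  unfolding rep_def by (rule someI)

text \<open>Only finitely many hulls are subtracted, so the difference is again a cut.\<close>

definition piece :: "'a \<Rightarrow> nat \<Rightarrow> 'a set" where
  "piece x k = khull k x - \<Union>((\<lambda>j. khull j x) ` {..<k})"

lemma piece_cut: "fincut V E (piece x k)"
  unfolding piece_def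
  by (rule fincut_Diff[OF graph khull_cut fincut_Union]) (auto simp: khull_cut)

lemma piece_unique: "y \<in> piece x k \<Longrightarrow> y \<in> piece x l \<Longrightarrow> k = l"
  unfolding piece_def by (cases k l rule: linorder_cases) auto

theorem star_decomposition:
  "\<exists>\<D>. (\<forall>D\<in>\<D>. region V E D \<and> r \<notin> D) \<and>
    (\<forall>D\<in>\<D>. \<forall>D'\<in>\<D>. D \<noteq> D' \<longrightarrow> D \<inter> D' = {}) \<and> (\<forall>p. sep p \<longrightarrow> (\<exists>D\<in>\<D>. ev_in p D))"
proof -
  define \<D> where "\<D> = {cc E (piece (rep y) k) y | y k. y \<in> piece (rep y) k}"
  have rep_piece: "rep z = rep y" if "z \<in> piece (rep y) k" "y \<in> piece (rep y) l" for y z k l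
  proof -
    have "linked (rep y) z" "linked (rep y) y" using that unfolding linked_khull piece_def by blast+
    then show ?thesis using rep_eq by metis
  qed
  have 1: "region V E D" if "D \<in> \<D>" for D
    using that cc_region[OF graph piece_cut] by (auto simp: \<D>_def)
  have 2: "r \<notin> D" if D: "D \<in> \<D>" for D
  proof -
    obtain y k where y: "y \<in> piece (rep y) k" "D = cc E (piece (rep y) k) y"
      using D by (auto simp: \<D>_def)
    then have "D \<subseteq> khull k (rep y)" using cc_subset[OF y(1), of E] by (auto simp: piece_def)
    then show ?thesis using root_notin_khull by blast
  qed
  have 3: "D \<inter> D' = {}" if DD: "D \<in> \<D>" "D' \<in> \<D>" "D \<noteq> D'" for D D'
  proof (rule ccontr)
    assume "D \<inter> D' \<noteq> {}"
    then obtain z where z: "z \<in> D" "z \<in> D'" by blast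
    obtain y k where y: "y \<in> piece (rep y) k" "D = cc E (piece (rep y) k) y"
      using DD by (auto simp: \<D>_def)
    obtain y' k' where y': "y' \<in> piece (rep y') k'" "D' = cc E (piece (rep y') k') y'"
      using DD by (auto simp: \<D>_def)
    have zp: "z \<in> piece (rep y) k" "z \<in> piece (rep y') k'"
      using z y(2) y'(2) cc_subset[OF y(1), of E] cc_subset[OF y'(1), of E] by auto
    have "rep y = rep y'" using rep_piece[OF zp(1) y(1)] rep_piece[OF zp(2) y'(1)] by simp
    moreover from this have "k = k'" using piece_unique zp by metis
    ultimately have "D = D'" using z y(2) y'(2) cc_eq by metis
    with DD show False by simp
  qed
  have 4: "\<exists>D\<in>\<D>. ev_in p D" if p: "sep p" for p
  proof -
    have pt: "point p" using p by (simp add: sep_def)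
    obtain x where x: "x \<in> mincut p"
      using eventually_happens'[OF _ mincut_ev_in[OF p]] by auto
    then have xx: "linked x x" using p by (auto simp: linked_def)
    define x0 where "x0 = rep x"
    have "linked x x0" using linked_rep[OF xx] by (simp add: x0_def)
    then obtain q where q: "sep q" "x \<in> mincut q" "x0 \<in> mincut q" by (auto simp: linked_def)
    \<comment> \<open>The minimal cut of \<open>q\<close> contains \<open>x\<close> and
      \<open>x0\<close>, and it is nested with \<open>mincut p\<close> because both contain
      \<open>x\<close>. The larger of the two contains \<open>x0\<close> and so lies in a hull of
      \<open>x0\<close>.\<close>
    have "\<exists>k. mincut p \<subseteq> khull k x0"
    proof (cases "mincut q \<subseteq> mincut p")
      case True
      then have "mincut p \<subseteq> khull (kap p) x0" using p q unfolding khull_def by blast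
      then show ?thesis by blast
    next
      case False
      then have "mincut p \<subseteq> mincut q" using mincut_nested[OF p q(1) x q(2)] by blast
      moreover have "mincut q \<subseteq> khull (kap q) x0" using q unfolding khull_def by blast
      ultimately show ?thesis by blast
    qed
    then have ex: "\<exists>k. ev_in p (khull k x0)" using ev_in_mono[OF mincut_ev_in[OF p]] by blast
    \<comment> \<open>With the least index, \<open>p\<close> eventually avoids each of the finitely
      many earlier hulls and thus ends up in \<open>piece x0 k\<close>.\<close>
    define k where "k = (LEAST k. ev_in p (khull k x0))"
    have k: "ev_in p (khull k x0)" unfolding k_def by (rule LeastI_ex[OF ex])
    have "\<forall>\<^sub>F i in sequentially. \<forall>j\<in>{..<k}. p i \<in> V - khull j x0"
    proof (rule eventually_ball_finite)
      show "\<forall>j\<in>{..<k}. ev_in p (V - khull j x0)"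
      proof
        fix j assume "j \<in> {..<k}"
        then have "\<not> ev_in p (khull j x0)" using not_less_Least unfolding k_def by blast
        then show "ev_in p (V - khull j x0)" by (rule point_not_in[OF pt khull_cut])
      qed
    qed simp
    with k have pp: "ev_in p (piece x0 k)"
      by eventually_elim (auto simp: piece_def)
    then obtain n where n: "\<And>i. i \<ge> n \<Longrightarrow> p i \<in> piece x0 k" by (auto simp: eventually_sequentially)
    have "linked x0 (p n)" using n[of n] unfolding linked_khull piece_def by blast
    then have r: "rep (p n) = x0" using rep_eq \<open>linked x x0\<close> by (metis x0_def)
    let ?D = "cc E (piece x0 k) (p n)"
    have "?D \<in> \<D>" using n[of n] r unfolding \<D>_def by blast
    moreover have "p i \<in> ?D" if "i \<ge> n" for i
    proof (cases "ray V E p")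
      case True
      show ?thesis using that
      proof (induction rule: dec_induct)
        case base
        show ?case by (rule cc_self)
      next
        case (step i)
        show ?case by (rule cc_step[OF step(3) rayD(3)[OF True]]) (use n step in auto)
      qed
    next
      case False
      then have "p i = p n" using pt by (auto simp: point_def)
      then show ?thesis by (simp add: cc_self)
    qed
    then have "ev_in p ?D" by (auto simp: eventually_sequentially)
    ultimately show ?thesis by blast
  qed
  show ?thesis by (intro exI[of _ \<D>] conjI ballI allI impI) (fact 1 2 3 4)+
qed

end

section \<open>Nested regions\<close>

lemma fincut_restrict:
  assumes "fincut V E A"
  shows "fincut C (induced E C) (A \<inter> C)"
proof -
  have "edge_boundary (induced E C) (A \<inter> C) \<subseteq> edge_boundary E A"
    unfolding edge_boundary_def by blast
  then show ?thesis using assms by (auto simp: fincut_def intro: finite_subset)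
qed

text \<open>New boundary edges can only be boundary edges of \<open>C\<close>. Decompositions found
  inside a region may therefore be used in the whole graph.\<close>

lemma fincut_extend:
  assumes "fincut V E C" "fincut C (induced E C) A"
  shows "fincut V E A"
proof -
  have "A \<subseteq> C" using assms by (simp add: fincut_def)
  then have "edge_boundary E A \<subseteq> edge_boundary (induced E C) A \<union> edge_boundary E C"
    unfolding edge_boundary_def by blast
  then show ?thesis using assms by (auto simp: fincut_def intro: finite_subset)
qed

lemma region_extend:
  assumes "fincut V E C" "region C (induced E C) D"
  shows "region V E D"
proof -
  have "D \<subseteq> C" using assms by (simp add: region_def)
  then have "{e \<in> induced E C. e \<subseteq> D} = induced E D" by auto
  then show ?thesis using assms fincut_extend[OF assms(1)] by (auto simp: region_iff)
qed

context conn_graph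
begin

lemma region_conn_graph: "region V E C \<Longrightarrow> conn_graph C (induced E C)"
  using graph_induced[OF graph] by unfold_locales (simp_all add: region_def)

lemma region_nonempty: "region V E C \<Longrightarrow> C \<noteq> {}"
  by (simp add: region_def connected_graph_def)

section \<open>Splitting regions and decomposing them into stars\<close>

lemma separating_cuts:
  assumes "finite B"
  shows "\<exists>\<A>. finite \<A> \<and> (\<forall>A\<in>\<A>. fincut V E A) \<and>
    (\<forall>b\<in>B. \<forall>b'\<in>B. \<forall>A. fincut V E A \<and> b \<in> A \<and> b' \<notin> A \<longrightarrow> (\<exists>A\<in>\<A>. b \<in> A \<and> b' \<notin> A))"
proof -
  let ?P = "\<lambda>(b, b') A. fincut V E A \<and> b \<in> A \<and> b' \<notin> A"
  let ?I = "{x \<in> B \<times> B. \<exists>A. ?P x A}"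
  let ?\<A> = "(\<lambda>x. SOME A. ?P x A) ` ?I"
  have 1: "finite ?\<A>" using assms by simp
  have *: "?P x (SOME A. ?P x A)" if "x \<in> ?I" for x
    using that by (intro someI_ex[of "?P x"]) auto
  have 2: "fincut V E A" if A: "A \<in> ?\<A>" for A
  proof -
    obtain x where "x \<in> ?I" "A = (SOME A. ?P x A)" using A by (elim imageE)
    then show ?thesis using *[of x] by (cases x) simp
  qed
  have 3: "\<exists>A\<in>?\<A>. b \<in> A \<and> b' \<notin> A" if "b \<in> B" "b' \<in> B" "fincut V E A" "b \<in> A" "b' \<notin> A" for b b' A
  proof -
    have "(b, b') \<in> ?I" using that by auto
    from imageI[OF this, of "\<lambda>x. SOME A. ?P x A"] *[OF this] show ?thesis
      by (intro bexI[of _ "SOME A. ?P (b, b') A"]) simp_all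
  qed
  show ?thesis
    using 1 2 3 by (intro exI[of _ ?\<A>] conjI ballI allI impI) (elim conjE, assumption | blast)+
qed

text \<open>Inseparability refers to cuts of the whole graph, because it will be applied to regions
  produced by a star inside \<open>K\<close>.\<close>

definition splitting :: "'a set \<Rightarrow> 'a set \<Rightarrow> 'a set set \<Rightarrow> bool" where
  "splitting C B \<K> \<longleftrightarrow>
    (\<forall>K\<in>\<K>. region V E K \<and> K \<subseteq> C) \<and> (\<forall>K\<in>\<K>. \<forall>K'\<in>\<K>. K \<noteq> K' \<longrightarrow> K \<inter> K' = {}) \<and>
    (\<forall>R. ray V E R \<and> ev_in R C \<longrightarrow> (\<exists>K\<in>\<K>. ev_in R K)) \<and>
    (\<forall>K\<in>\<K>. \<forall>b\<in>B \<inter> K. \<forall>b'\<in>B \<inter> K. \<forall>A. fincut V E A \<and> b \<in> A \<longrightarrow> b' \<in> A)"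

lemma splittingD:
  assumes "splitting C B \<K>"
  shows "K \<in> \<K> \<Longrightarrow> region V E K" "K \<in> \<K> \<Longrightarrow> K \<subseteq> C"
    "K \<in> \<K> \<Longrightarrow> K' \<in> \<K> \<Longrightarrow> K \<noteq> K' \<Longrightarrow> K \<inter> K' = {}"
    "ray V E R \<Longrightarrow> ev_in R C \<Longrightarrow> \<exists>K\<in>\<K>. ev_in R K"
    "K \<in> \<K> \<Longrightarrow> b \<in> B \<Longrightarrow> b \<in> K \<Longrightarrow> b' \<in> B \<Longrightarrow> b' \<in> K \<Longrightarrow> fincut V E A \<Longrightarrow> b \<in> A \<Longrightarrow> b' \<in> A"
proof -
  from assms have 1: "\<forall>K\<in>\<K>. region V E K \<and> K \<subseteq> C"
    and 2: "\<forall>K\<in>\<K>. \<forall>K'\<in>\<K>. K \<noteq> K' \<longrightarrow> K \<inter> K' = {}"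
    and 3: "\<forall>R. ray V E R \<and> ev_in R C \<longrightarrow> (\<exists>K\<in>\<K>. ev_in R K)"
    and 4: "\<forall>K\<in>\<K>. \<forall>b\<in>B \<inter> K. \<forall>b'\<in>B \<inter> K. \<forall>A. fincut V E A \<and> b \<in> A \<longrightarrow> b' \<in> A"
    by - (unfold splitting_def, (elim conjE, assumption)+)
  show "K \<in> \<K> \<Longrightarrow> region V E K" "K \<in> \<K> \<Longrightarrow> K \<subseteq> C" using 1 by blast+
  show "K \<in> \<K> \<Longrightarrow> K' \<in> \<K> \<Longrightarrow> K \<noteq> K' \<Longrightarrow> K \<inter> K' = {}" using 2 by blast
  show "ray V E R \<Longrightarrow> ev_in R C \<Longrightarrow> \<exists>K\<in>\<K>. ev_in R K" using 3 by blast
  show "K \<in> \<K> \<Longrightarrow> b \<in> B \<Longrightarrow> b \<in> K \<Longrightarrow> b' \<in> B \<Longrightarrow> b' \<in> K \<Longrightarrow> fincut V E A \<Longrightarrow> b \<in> A \<Longrightarrow> b' \<in> A"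
    using 4 by blast
qed

text \<open>Delete the boundary edges of the finitely many cuts of \<open>separating_cuts\<close>
  from the graph induced on \<open>C\<close> and take components. Separable vertices of
  \<open>B\<close> land in different components, and only finitely many edges were added to the
  boundaries.\<close>

lemma splitting_exists:
  assumes C: "fincut V E C" and B: "finite B"
  shows "\<exists>\<K>. splitting C B \<K>"
proof -
  obtain \<A> where \<A>: "finite \<A>" "\<forall>A\<in>\<A>. fincut V E A"
    "\<forall>b\<in>B. \<forall>b'\<in>B. \<forall>A. fincut V E A \<and> b \<in> A \<and> b' \<notin> A \<longrightarrow> (\<exists>A\<in>\<A>. b \<in> A \<and> b' \<notin> A)"
    using separating_cuts[OF B] by (elim exE conjE) (rule that)
  define F where "F = \<Union>(edge_boundary E ` \<A>)"
  define E' where "E' = induced E C - F"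
  define K where "K = (\<lambda>x. {y. (x, y) \<in> (adj E')\<^sup>*})"
  have F: "finite F" using \<A> by (auto simp: F_def fincut_def)
  have E': "E' \<subseteq> E" by (auto simp: E'_def)
  have KC: "K x \<subseteq> C" if "x \<in> C" for x
    using that by (auto simp: K_def E'_def intro: rtrancl_adj_in)
  have Keq: "K y = K x" if "y \<in> K x" for x y
    using that adj_rtrancl_sym[of x y E'] by (auto simp: K_def intro: rtrancl_trans)
  have reg: "region V E (K x)" if x: "x \<in> C" for x
  proof -
    have "edge_boundary E (K x) \<subseteq> edge_boundary E C \<union> F"
    proof
      fix e assume "e \<in> edge_boundary E (K x)"
      then obtain a b where e: "e = {a, b}" "{a, b} \<in> E" "a \<in> K x" "b \<notin> K x"
        using in_boundary_iff[OF graph] by metis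
      then have "{a, b} \<notin> E'" by (auto simp: K_def intro: rtrancl_into_rtrancl)
      then have "b \<notin> C \<or> e \<in> F" using e KC[OF x] by (auto simp: E'_def)
      then show "e \<in> edge_boundary E C \<union> F" using e KC[OF x] by (auto simp: edge_boundary_def)
    qed
    then have "fincut V E (K x)"
      using C F KC[OF x] by (auto simp: fincut_def intro: finite_subset)
    then show ?thesis using component_connected[OF graph E'] by (simp add: region_iff K_def)
  qed
  have "splitting C B (K ` C)"
    unfolding splitting_def
  proof (intro conjI ballI allI impI)
    fix k assume "k \<in> K ` C"
    then show "region V E k" "k \<subseteq> C" using reg KC by auto
  next
    fix k k' assume "k \<in> K ` C" "k' \<in> K ` C" "k \<noteq> k'"
    then obtain x x' where k: "k = K x" "k' = K x'" by auto
    show "k \<inter> k' = {}"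
    proof (rule ccontr)
      assume "k \<inter> k' \<noteq> {}"
      then obtain y where "y \<in> K x" "y \<in> K x'" using k by auto
      then have "K x = K x'" using Keq by metis
      with k \<open>k \<noteq> k'\<close> show False by simp
    qed
  next
    fix R assume R: "ray V E R \<and> ev_in R C"
    then have "\<forall>\<^sub>F i in sequentially. R i \<in> C \<and> {R i, R (Suc i)} \<notin> F"
      using ray_avoids_finite[of V E R, OF _ F] by (simp add: eventually_conj)
    then obtain n where n: "\<And>i. i \<ge> n \<Longrightarrow> R i \<in> C \<and> {R i, R (Suc i)} \<notin> F"
      by (auto simp: eventually_sequentially)
    have "R i \<in> K (R n)" if "i \<ge> n" for i
      using that
    proof (induction rule: dec_induct)
      case (step i)
      then have "(R i, R (Suc i)) \<in> adj E'"
        using n[of i] n[of "Suc i"] rayD(3)[of V E R i] R by (simp add: E'_def)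
      with step(3) show ?case by (simp add: K_def rtrancl.rtrancl_into_rtrancl)
    qed (simp add: K_def)
    then have "ev_in R (K (R n))" by (auto simp: eventually_sequentially)
    then show "\<exists>K\<in>K ` C. ev_in R K" using n by blast
  next
    fix k b b' A assume k: "k \<in> K ` C" and b: "b \<in> B \<inter> k" "b' \<in> B \<inter> k"
      and A: "fincut V E A \<and> b \<in> A"
    show "b' \<in> A"
    proof (rule ccontr)
      assume "b' \<notin> A"
      then obtain A' where A': "A' \<in> \<A>" "b \<in> A'" "b' \<notin> A'" using \<A>(3) b A by blast
      obtain x where "k = K x" using k by auto
      then have "k = K b" using Keq b by auto
      then have "(b, b') \<in> (adj E')\<^sup>*" using b by (simp add: K_def)
      from rtrancl_crossing[OF this A'(2,3)] obtain u v
        where "{u, v} \<in> E'" "u \<in> A'" "v \<notin> A'" by auto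
      then show False using A'(1) E' by (auto simp: E'_def F_def edge_boundary_def)
    qed
  qed
  then show ?thesis by blast
qed

text \<open>The finiteness clause expresses that the leaves converge to \<open>r\<close>. Through it
  a cut around \<open>r\<close> can be refined by a cut of the tree with finite boundary.\<close>

definition star :: "'a set \<Rightarrow> 'a \<Rightarrow> 'a set set \<Rightarrow> bool" where
  "star K r \<D> \<longleftrightarrow>
    (\<forall>D\<in>\<D>. region V E D \<and> D \<subseteq> K \<and> r \<notin> D) \<and> (\<forall>D\<in>\<D>. \<forall>D'\<in>\<D>. D \<noteq> D' \<longrightarrow> D \<inter> D' = {}) \<and>
    (\<forall>A R. fincut V E A \<and> r \<notin> A \<and> ray V E R \<and> ev_in R K \<and> ev_in R A \<longrightarrow> (\<exists>D\<in>\<D>. ev_in R D)) \<and>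
    (\<forall>A. fincut V E A \<and> r \<in> A \<longrightarrow> finite {D \<in> \<D>. \<not> D \<subseteq> A})"

lemma starD:
  assumes "star K r \<D>"
  shows "D \<in> \<D> \<Longrightarrow> region V E D" "D \<in> \<D> \<Longrightarrow> D \<subseteq> K" "D \<in> \<D> \<Longrightarrow> r \<notin> D"
    "D \<in> \<D> \<Longrightarrow> D' \<in> \<D> \<Longrightarrow> D \<noteq> D' \<Longrightarrow> D \<inter> D' = {}"
    "fincut V E A \<Longrightarrow> r \<notin> A \<Longrightarrow> ray V E R \<Longrightarrow> ev_in R K \<Longrightarrow> ev_in R A \<Longrightarrow> \<exists>D\<in>\<D>. ev_in R D"
    "fincut V E A \<Longrightarrow> r \<in> A \<Longrightarrow> finite {D \<in> \<D>. \<not> D \<subseteq> A}"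
proof -
  from assms have 1: "\<forall>D\<in>\<D>. region V E D \<and> D \<subseteq> K \<and> r \<notin> D"
    and 2: "\<forall>D\<in>\<D>. \<forall>D'\<in>\<D>. D \<noteq> D' \<longrightarrow> D \<inter> D' = {}"
    and 3: "\<forall>A R. fincut V E A \<and> r \<notin> A \<and> ray V E R \<and> ev_in R K \<and> ev_in R A \<longrightarrow> (\<exists>D\<in>\<D>. ev_in R D)"
    and 4: "\<forall>A. fincut V E A \<and> r \<in> A \<longrightarrow> finite {D \<in> \<D>. \<not> D \<subseteq> A}"
    by - (unfold star_def, (elim conjE, assumption)+)
  show "D \<in> \<D> \<Longrightarrow> region V E D" "D \<in> \<D> \<Longrightarrow> D \<subseteq> K" "D \<in> \<D> \<Longrightarrow> r \<notin> D" using 1 by blast+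
  show "D \<in> \<D> \<Longrightarrow> D' \<in> \<D> \<Longrightarrow> D \<noteq> D' \<Longrightarrow> D \<inter> D' = {}" using 2 by blast
  show "fincut V E A \<Longrightarrow> r \<notin> A \<Longrightarrow> ray V E R \<Longrightarrow> ev_in R K \<Longrightarrow> ev_in R A \<Longrightarrow> \<exists>D\<in>\<D>. ev_in R D"
    using 3 by blast
  show "fincut V E A \<Longrightarrow> r \<in> A \<Longrightarrow> finite {D \<in> \<D>. \<not> D \<subseteq> A}" using 4 by blast
qed

lemma star_exists:
  assumes K: "region V E K" and r: "r \<in> K"
  shows "\<exists>\<D>. star K r \<D>"
proof -
  let ?E = "induced E K"
  interpret H: conn_graph K ?E by (rule region_conn_graph[OF K])
  interpret H: rooted_graph K ?E r using r by unfold_locales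
  have Kc: "fincut V E K" using K by (simp add: region_iff)
  obtain \<D> where \<D>: "\<forall>D\<in>\<D>. region K ?E D \<and> r \<notin> D"
    "\<forall>D\<in>\<D>. \<forall>D'\<in>\<D>. D \<noteq> D' \<longrightarrow> D \<inter> D' = {}" "\<forall>p. H.sep p \<longrightarrow> (\<exists>D\<in>\<D>. ev_in p D)"
    by (rule exE[OF H.star_decomposition], elim conjE) (rule that)
  note D = conjunct1[OF bspec[OF \<D>(1)]] conjunct2[OF bspec[OF \<D>(1)]]
    bspec[OF bspec[OF \<D>(2)], THEN mp] \<D>(3)[THEN spec, THEN mp]
  have "star K r \<D>"
    unfolding star_def
  proof (intro conjI ballI allI impI)
    fix D assume "D \<in> \<D>"
    then show "region V E D" "D \<subseteq> K" "r \<notin> D"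
      using D(1,2) region_extend[OF Kc] by (auto simp: region_def)
  next
    fix D D' assume "D \<in> \<D>" "D' \<in> \<D>" "D \<noteq> D'"
    then show "D \<inter> D' = {}" by (rule D(3))
  next
    fix A R assume AR: "fincut V E A \<and> r \<notin> A \<and> ray V E R \<and> ev_in R K \<and> ev_in R A"
    then obtain n where n: "\<And>i. i \<ge> n \<Longrightarrow> R i \<in> K" by (auto simp: eventually_sequentially)
    let ?R = "\<lambda>i. R (i + n)"
    have "ray K ?E ?R" using ray_tail[of V E R n K] AR n by auto
    moreover have "ev_in ?R (A \<inter> K)"
      using AR ev_in_shift[of R n A] n by (simp add: eventually_conj_iff)
    ultimately have "H.sep ?R"
      using AR fincut_restrict[of V E A K] unfolding H.sep_def H.point_def H.sepcut_def
      by (intro conjI disjI2 exI[of _ "A \<inter> K"]) auto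
    then obtain D where "D \<in> \<D>" "ev_in ?R D" using D(4) by blast
    then show "\<exists>D\<in>\<D>. ev_in R D" using ev_in_shift[of R n] by blast
  next
    fix A assume A: "fincut V E A \<and> r \<in> A"
    let ?\<D> = "{D \<in> \<D>. \<not> D \<subseteq> A}"
    show "finite ?\<D>"
    proof (rule ccontr)
      assume inf: "infinite ?\<D>"
      \<comment> \<open>One vertex outside \<open>A\<close> is chosen from each offending leaf.
        These vertices accumulate at a point outside \<open>A\<close>; it is separable from
        \<open>r\<close> and hence lies in some leaf, but a leaf contains at most one chosen
        vertex.\<close>
      define s where "s D = (SOME v. v \<in> D - A)" for D
      have s: "s D \<in> D - A" if "D \<in> ?\<D>" for D
        unfolding s_def by (rule someI_ex) (use that in auto)
      have one: "D = D'" if "D \<in> ?\<D>" "D' \<in> \<D>" "s D \<in> D'" for D D'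
        using D(3)[of D D'] s[OF that(1)] that by auto
      have "inj_on s ?\<D>"
      proof (rule inj_onI)
        fix D D' assume DD: "D \<in> ?\<D>" "D' \<in> ?\<D>" "s D = s D'"
        then have "s D \<in> D'" using s[OF DD(2)] by simp
        then show "D = D'" using one DD by blast
      qed
      then have infS: "infinite (s ` ?\<D>)" using inf finite_imageD by blast
      have "D \<subseteq> K" if "D \<in> \<D>" for D using D(1)[OF that] by (simp add: region_def)
      then have SK: "s ` ?\<D> \<subseteq> K" using s by blast
      obtain p where p: "H.point p" "H.adherent (s ` ?\<D>) p"
        using H.compactness[OF SK infS] unfolding H.point_def by blast
      have AK: "fincut K ?E (A \<inter> K)" using fincut_restrict A by blast
      have e: "A \<inter> K \<inter> s ` ?\<D> = {}" using s by blast
      have "\<not> ev_in p (A \<inter> K)"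
      proof
        assume "ev_in p (A \<inter> K)"
        then have "infinite (A \<inter> K \<inter> s ` ?\<D>)" using p(2) AK unfolding H.adherent_def by blast
        then show False unfolding e by simp
      qed
      then have "ev_in p (K - A \<inter> K)" using H.point_not_in[OF p(1) AK] by blast
      then have "H.sepcut p (K - A \<inter> K)"
        using A r fincut_Compl[OF H.graph AK] by (simp add: H.sepcut_def)
      then obtain D where Dp: "D \<in> \<D>" "ev_in p D" using D(4) p(1) unfolding H.sep_def by blast
      then have "infinite (D \<inter> s ` ?\<D>)"
        using p(2) D(1) unfolding H.adherent_def region_iff by blast
      moreover have "D \<inter> s ` ?\<D> \<subseteq> {s D}" using one Dp(1) by blast
      ultimately show False using finite_subset by blast
    qed
  qed
  then show ?thesis by blast
qed

text \<open>Endpoints of the boundary edges, plus one vertex to make the set nonempty also for \<open>C = V\<close>.\<close>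

definition bnd :: "'a set \<Rightarrow> 'a set" where
  "bnd C = insert (SOME v. v \<in> C) (\<Union>(edge_boundary E C))"

definition split :: "'a set \<Rightarrow> 'a set set" where
  "split C = (SOME \<K>. splitting C (bnd C) \<K>)"

definition centre :: "'a set \<Rightarrow> 'a set \<Rightarrow> 'a" where
  "centre C K = (SOME r. r \<in> K \<and> (bnd C \<inter> K \<noteq> {} \<longrightarrow> r \<in> bnd C))"

definition leaves :: "'a set \<Rightarrow> 'a set \<Rightarrow> 'a set set" where
  "leaves C K = (SOME \<D>. star K (centre C K) \<D>)"

section \<open>The regions of all rounds\<close>

primrec stage :: "nat \<Rightarrow> 'a set set" where
  "stage 0 = {V}"
| "stage (Suc m) = (\<Union>C\<in>stage m. \<Union>K\<in>split C. leaves C K)"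

text \<open>Each round contributes two levels: regions of a stage at even levels, the pieces of
  their splittings at odd levels. Since splittings keep all rays, a ray can stop only at an odd
  level, where the piece has a centre.\<close>

definition parts :: "nat \<Rightarrow> 'a set set" where
  "parts n = (if even n then stage (n div 2) else \<Union>(split ` stage (n div 2)))"

lemma split: "region V E C \<Longrightarrow> splitting C (bnd C) (split C)"
  unfolding split_def
  by (rule someI_ex, rule splitting_exists) (auto simp: region_iff bnd_def finite_boundary_verts[OF graph])

lemma split_region: "region V E C \<Longrightarrow> K \<in> split C \<Longrightarrow> region V E K \<and> K \<subseteq> C"
  using splittingD(1,2)[OF split] by auto

lemma centre:
  assumes "region V E K"
  shows "centre C K \<in> K" "bnd C \<inter> K \<noteq> {} \<Longrightarrow> centre C K \<in> bnd C"
proof -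
  have "\<exists>r. r \<in> K \<and> (bnd C \<inter> K \<noteq> {} \<longrightarrow> r \<in> bnd C)" using region_nonempty[OF assms] by blast
  from someI_ex[OF this] show "centre C K \<in> K" "bnd C \<inter> K \<noteq> {} \<Longrightarrow> centre C K \<in> bnd C"
    unfolding centre_def by auto
qed

lemma leaves: "region V E K \<Longrightarrow> star K (centre C K) (leaves C K)"
  unfolding leaves_def by (rule someI_ex, rule star_exists) (auto simp: centre)

lemma leaves_region: "region V E K \<Longrightarrow> D \<in> leaves C K \<Longrightarrow> region V E D \<and> D \<subseteq> K \<and> centre C K \<notin> D"
  using starD(1,2,3)[OF leaves] by auto

lemma stage_region: "C \<in> stage m \<Longrightarrow> region V E C"
proof (induction m arbitrary: C)
  case 0
  then show ?case using graph conn fincut_whole by (simp add: region_iff induced_whole)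
next
  case (Suc m)
  then obtain C0 K where "C0 \<in> stage m" "K \<in> split C0" "C \<in> leaves C0 K" by auto
  then show ?case using leaves_region[OF conjunct1[OF split_region[OF Suc.IH]]] by blast
qed

lemma split_disjoint:
  "region V E C \<Longrightarrow> K \<in> split C \<Longrightarrow> K' \<in> split C \<Longrightarrow> K \<inter> K' \<noteq> {} \<Longrightarrow> K = K'"
  using splittingD(3)[OF split] by metis

lemma leaves_disjoint:
  "region V E K \<Longrightarrow> D \<in> leaves C K \<Longrightarrow> D' \<in> leaves C K \<Longrightarrow> D \<inter> D' \<noteq> {} \<Longrightarrow> D = D'"
  using starD(4)[OF leaves] by metis

lemma stage_disjoint: "C \<in> stage m \<Longrightarrow> C' \<in> stage m \<Longrightarrow> x \<in> C \<Longrightarrow> x \<in> C' \<Longrightarrow> C = C'"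
proof (induction m arbitrary: C C')
  case (Suc m)
  obtain C0 K where 1: "C0 \<in> stage m" "K \<in> split C0" "C \<in> leaves C0 K" using Suc by auto
  obtain C0' K' where 2: "C0' \<in> stage m" "K' \<in> split C0'" "C' \<in> leaves C0' K'" using Suc by auto
  note reg = stage_region[OF 1(1)] stage_region[OF 2(1)]
  note reg2 = split_region[OF reg(1) 1(2)] split_region[OF reg(2) 2(2)]
  have sub: "C \<subseteq> K" "C' \<subseteq> K'" using leaves_region reg2 1 2 by blast+
  have "x \<in> C0" "x \<in> C0'" using sub reg2 Suc.prems by blast+
  then have C: "C0 = C0'" using Suc.IH[OF 1(1) 2(1)] by simp
  have "K \<inter> K' \<noteq> {}" using sub Suc.prems by blast
  then have "K = K'" using split_disjoint[OF reg(1) 1(2), of K'] 2(2) C by simp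
  then show ?case using leaves_disjoint[of K C C0 C'] reg2 1(3) 2(3) C Suc.prems by blast
qed simp

text \<open>If \<open>D\<close> met \<open>bnd C\<close>, the centre would be a boundary vertex in
  the same piece, inseparable from the one in \<open>D\<close>; but \<open>D\<close> is a cut that
  omits the centre.\<close>

lemma leaves_avoid_bnd:
  assumes "region V E C" "K \<in> split C" "D \<in> leaves C K"
  shows "D \<inter> bnd C = {}"
proof (rule ccontr)
  assume "D \<inter> bnd C \<noteq> {}"
  then obtain b where b: "b \<in> D" "b \<in> bnd C" by auto
  have K: "region V E K" using split_region assms by blast
  have D: "region V E D" "D \<subseteq> K" "centre C K \<notin> D" using leaves_region[OF K assms(3)] by auto
  have "centre C K \<in> K" "centre C K \<in> bnd C" using centre[OF K] b D by auto
  then have "centre C K \<in> D"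
    using splittingD(5)[OF split[OF assms(1)] assms(2) b(2) _ _ _ _ b(1)] b D(1,2)
    by (auto simp: region_iff)
  with D(3) show False by simp
qed

lemma stage_avoid_bnd:
  assumes "C \<in> stage m" "D \<in> stage (Suc m)"
  shows "D \<inter> (C \<inter> bnd C) = {}"
proof (rule ccontr)
  assume "D \<inter> (C \<inter> bnd C) \<noteq> {}"
  then obtain b where b: "b \<in> D" "b \<in> C" "b \<in> bnd C" by auto
  obtain C' K where D: "C' \<in> stage m" "K \<in> split C'" "D \<in> leaves C' K" using assms(2) by auto
  note reg = stage_region[OF D(1)]
  have "D \<subseteq> C'" using leaves_region[OF _ D(3)] split_region[OF reg D(2)] by blast
  then have "C = C'" using stage_disjoint[OF assms(1) D(1) b(2)] b(1) by blast
  then show False using leaves_avoid_bnd[OF reg D(2,3)] b by blast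
qed

lemma parts_region: "C \<in> parts n \<Longrightarrow> region V E C"
  using stage_region split_region by (auto simp: parts_def split: if_splits)

lemma parts_0: "parts 0 = {V}"
  by (simp add: parts_def)

lemma parts_parent:
  assumes "D \<in> parts (Suc n)"
  shows "\<exists>C\<in>parts n. D \<subseteq> C"
proof (cases "even n")
  case True
  then obtain C where "C \<in> stage (n div 2)" "D \<in> split C" using assms by (auto simp: parts_def)
  then show ?thesis using True split_region[OF stage_region, of C _ D] by (auto simp: parts_def)
next
  case False
  then have "Suc n div 2 = Suc (n div 2)" by presburger
  then obtain C K where CK: "C \<in> stage (n div 2)" "K \<in> split C" "D \<in> leaves C K"
    using assms False by (auto simp: parts_def)
  then have "D \<subseteq> K" using stage_region split_region leaves_region by blast
  then show ?thesis using CK False by (auto simp: parts_def)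
qed

lemma parts_disjoint:
  assumes "C \<in> parts n" "C' \<in> parts n" "x \<in> C" "x \<in> C'"
  shows "C = C'"
proof (cases "even n")
  case True
  then show ?thesis using assms stage_disjoint by (auto simp: parts_def)
next
  case False
  then obtain D D' where D: "D \<in> stage (n div 2)" "C \<in> split D" "D' \<in> stage (n div 2)" "C' \<in> split D'"
    using assms by (auto simp: parts_def)
  then have "D = D'" using stage_disjoint[of D _ D' x] split_region stage_region assms by blast
  then show ?thesis using D assms stage_region split_disjoint by blast
qed

lemma parts_mono:
  assumes "m \<le> n" "x \<in> \<Union>(parts n)"
  shows "x \<in> \<Union>(parts m)"
  using assms
proof (induction rule: dec_induct)
  case (step n)
  then show ?case using parts_parent by (metis UnionE UnionI subsetD)
qed

text \<open>The vertices that leave the partitions are closed under adjacency, because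
  \<open>bnd C\<close> is removed from \<open>C\<close> in the next stage.\<close>

lemma parts_leave:
  assumes "v \<in> V"
  shows "\<exists>n. v \<notin> \<Union>(parts n)"
proof (rule ccontr)
  define X where "X = {v. \<exists>n. v \<notin> \<Union>(parts n)}"
  assume "\<not> ?thesis"
  then have v: "v \<notin> X" by (simp add: X_def)
  have bndX: "b \<in> X" if "b \<in> bnd C" "b \<in> C" "C \<in> stage m" for b C m
  proof -
    have "b \<notin> \<Union>(stage (Suc m))" using stage_avoid_bnd[OF that(3)] that by blast
    then have "b \<notin> \<Union>(parts (2 * Suc m))" by (simp add: parts_def)
    then show ?thesis by (auto simp: X_def)
  qed
  let ?r = "SOME v. v \<in> V"
  have r: "?r \<in> V" using assms by (rule someI)
  \<comment> \<open>The extra vertex in \<open>bnd V\<close> supplies a first element of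
    \<open>X\<close>, as \<open>V\<close> has no boundary edges.\<close>
  then have "?r \<in> X" using bndX[of ?r V 0] by (simp add: bnd_def)
  from rtrancl_crossing[OF reach[OF r assms] this v] obtain a b
    where ab: "{a, b} \<in> E" "a \<in> X" "b \<notin> X" by auto
  then obtain n where "a \<notin> \<Union>(parts n)" by (auto simp: X_def)
  then have "a \<notin> \<Union>(parts (2 * n))" using parts_mono[of n "2 * n" a] by auto
  then have a: "a \<notin> \<Union>(stage n)" by (simp add: parts_def)
  have "b \<in> \<Union>(parts (2 * n))" using ab(3) by (auto simp: X_def)
  then obtain C where C: "C \<in> stage n" "b \<in> C" by (auto simp: parts_def)
  \<comment> \<open>The neighbour \<open>a\<close> has already left, which makes \<open>b\<close> a
    boundary vertex of its region; so \<open>b\<close> leaves in the next round.\<close>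
  have "a \<notin> C" using a C by blast
  then have "{b, a} \<in> edge_boundary E C"
    using ab C by (intro edge_in_boundary) (simp_all add: insert_commute)
  then have "b \<in> bnd C" by (auto simp: bnd_def)
  then show False using bndX C ab(3) by blast
qed

text \<open>A ray that stops at \<open>C\<close> is inseparable from the centre of \<open>C\<close>,
  because the star catches all separable rays. So the centre lies in \<open>A\<close>, only finitely
  many leaves stick out of \<open>A\<close>, and every other ray that stops at \<open>C\<close> lies
  in \<open>A\<close> too.\<close>

lemma parts_stop:
  assumes C: "C \<in> parts n" and A: "fincut V E A"
    and R: "ray V E R" "ev_in R C" "\<And>D. D \<in> parts (Suc n) \<Longrightarrow> \<not> ev_in R D" "ev_in R A"
  shows "finite {D \<in> parts (Suc n). D \<subseteq> C \<and> \<not> D \<subseteq> A}"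
    and "\<And>R'. ray V E R' \<Longrightarrow> ev_in R' C \<Longrightarrow> (\<And>D. D \<in> parts (Suc n) \<Longrightarrow> \<not> ev_in R' D) \<Longrightarrow> ev_in R' A"
proof -
  have "odd n"
  proof
    assume n: "even n"
    then have Cs: "C \<in> stage (n div 2)" using C by (simp add: parts_def)
    obtain K where "K \<in> split C" "ev_in R K"
      using splittingD(4)[OF split[OF stage_region[OF Cs]] R(1,2)] by blast
    moreover have "K \<in> parts (Suc n)" using n Cs \<open>K \<in> split C\<close> by (auto simp: parts_def)
    ultimately show False using R(3) by blast
  qed
  then have n: "Suc n div 2 = Suc (n div 2)" by presburger
  obtain C0 where C0: "C0 \<in> stage (n div 2)" "C \<in> split C0" using C \<open>odd n\<close> by (auto simp: parts_def)
  note regC = parts_region[OF C]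
  let ?r = "centre C0 C"
  have leaf: "D \<in> parts (Suc n)" if "D \<in> leaves C0 C" for D
    using that C0 \<open>odd n\<close> n by (auto simp: parts_def)
  \<comment> \<open>The parent of \<open>D\<close> and \<open>C\<close> share a vertex and are parts
    of one level, hence are equal; the same argument identifies the regions they were split
    from.\<close>
  have leaf': "D \<in> leaves C0 C" if D: "D \<in> parts (Suc n)" "D \<subseteq> C" for D
  proof -
    obtain C1 K where K: "C1 \<in> stage (n div 2)" "K \<in> split C1" "D \<in> leaves C1 K"
      using D \<open>odd n\<close> n by (auto simp: parts_def)
    have "K \<in> parts n" using K \<open>odd n\<close> by (auto simp: parts_def)
    obtain x where x: "x \<in> D" using region_nonempty[OF parts_region[OF D(1)]] by blast
    have regK: "region V E K" "K \<subseteq> C1" using split_region[OF stage_region[OF K(1)] K(2)] by auto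
    have "x \<in> K" using leaves_region[OF regK(1) K(3)] x by blast
    then have "K = C" using parts_disjoint[OF \<open>K \<in> parts n\<close> C] x D by blast
    moreover have "C1 = C0"
      using stage_disjoint[OF K(1) C0(1), of x] regK \<open>x \<in> K\<close> \<open>K = C\<close> split_region[OF stage_region[OF C0(1)] C0(2)]
      by blast
    ultimately show ?thesis using K by simp
  qed
  have st: "star C ?r (leaves C0 C)" by (rule leaves[OF regC])
  have sepr: "?r \<in> B" if "ray V E S" "ev_in S C" "\<And>D. D \<in> parts (Suc n) \<Longrightarrow> \<not> ev_in S D"
      "fincut V E B" "ev_in S B" for S B
    using starD(5)[OF st that(4) _ that(1,2,5)] leaf that(3) by blast
  have rA: "?r \<in> A" using sepr[OF R(1,2,3) A R(4)] .
  have "{D \<in> parts (Suc n). D \<subseteq> C \<and> \<not> D \<subseteq> A} \<subseteq> {D \<in> leaves C0 C. \<not> D \<subseteq> A}" using leaf' by blast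
  moreover have "finite {D \<in> leaves C0 C. \<not> D \<subseteq> A}" by (rule starD(6)[OF st A rA])
  ultimately show "finite {D \<in> parts (Suc n). D \<subseteq> C \<and> \<not> D \<subseteq> A}" by (rule finite_subset)
  show "ev_in R' A" if R': "ray V E R'" "ev_in R' C" "\<And>D. D \<in> parts (Suc n) \<Longrightarrow> \<not> ev_in R' D" for R'
  proof (rule ccontr)
    assume "\<not> ev_in R' A"
    then have "ev_in R' (V - A)" using ray_decides[OF R'(1) A] by blast
    from sepr[OF R' fincut_Compl[OF graph A] this] rA show False by simp
  qed
qed

end

section \<open>Comparing end spaces with trees\<close>

text \<open>The homeomorphism sends the end of a ray to the point that lies in the same cuts.\<close>

lemma end_space_homeomorphic:
  assumes G: "graph V E" and T: "graph TV TE" and X: "X \<subseteq> pts TV TE"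
    and separated: "\<And>x y. x \<in> pts TV TE \<Longrightarrow> y \<in> pts TV TE \<Longrightarrow> x \<noteq> y \<Longrightarrow>
      \<exists>A. fincut TV TE A \<and> pt_in x A \<and> \<not> pt_in y A"
    and cuts: "\<And>A. fincut TV TE A \<Longrightarrow> fincut V E {v \<in> V. t v \<in> A}"
    and refine: "\<And>R K. ray V E R \<Longrightarrow> fincut V E K \<Longrightarrow> ev_in R K \<Longrightarrow>
      \<exists>A. fincut TV TE A \<and> ev_in (\<lambda>i. t (R i)) A \<and>
        (\<forall>R'. ray V E R' \<and> ev_in (\<lambda>i. t (R' i)) A \<longrightarrow> ev_in R' K)"
    and total: "\<And>R. ray V E R \<Longrightarrow>
      \<exists>x\<in>X. \<forall>A. fincut TV TE A \<longrightarrow> (pt_in x A \<longleftrightarrow> ev_in (\<lambda>i. t (R i)) A)"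
    and onto: "\<And>x. x \<in> X \<Longrightarrow>
      \<exists>R. ray V E R \<and> (\<forall>A. fincut TV TE A \<longrightarrow> (pt_in x A \<longleftrightarrow> ev_in (\<lambda>i. t (R i)) A))"
  shows "edge_end_space V E homeomorphic_space subtopology (graph_space TV TE) X"
proof -
  define pre where "pre A = {v \<in> V. t v \<in> A}" for A
  have pre: "end_in (end_of V E R) (pre A) \<longleftrightarrow> ev_in (\<lambda>i. t (R i)) A"
    if "ray V E R" "fincut TV TE A" for R A
    using end_in_end_of[OF G that(1) cuts[OF that(2)]] rayD(2)[OF that(1)] by (simp add: pre_def)
  define m where "m x \<omega> \<longleftrightarrow> x \<in> X \<and> (\<forall>A. fincut TV TE A \<longrightarrow> (pt_in x A \<longleftrightarrow> end_in \<omega> (pre A)))" for x \<omega>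
  define \<phi> where "\<phi> \<omega> = (SOME x. m x \<omega>)" for \<omega>
  have total': "\<exists>x. m x \<omega>" if \<omega>: "\<omega> \<in> edge_ends V E" for \<omega>
  proof -
    obtain R where R: "ray V E R" "\<omega> = end_of V E R" by (rule end_ofE[OF G \<omega>])
    then show ?thesis using total[OF R(1)] pre[OF R(1)] by (auto simp: m_def)
  qed
  have \<phi>: "\<phi> \<omega> \<in> X" "\<And>A. fincut TV TE A \<Longrightarrow> pt_in (\<phi> \<omega>) A \<longleftrightarrow> end_in \<omega> (pre A)"
    if "\<omega> \<in> edge_ends V E" for \<omega>
    using someI_ex[OF total'[OF that]] by (auto simp: \<phi>_def m_def)
  have onto': "\<exists>\<omega>\<in>edge_ends V E. \<phi> \<omega> = x" if x: "x \<in> X" for x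
  proof -
    obtain R where R: "ray V E R"
      "\<And>A. fincut TV TE A \<Longrightarrow> pt_in x A \<longleftrightarrow> ev_in (\<lambda>i. t (R i)) A" using onto[OF x] by auto
    let ?\<omega> = "end_of V E R"
    have \<omega>: "?\<omega> \<in> edge_ends V E" using R by (rule_tac end_of_in)
    have "\<phi> ?\<omega> = x"
      using separated[of "\<phi> ?\<omega>" x] \<phi>[OF \<omega>] pre[OF R(1)] R(2) subsetD[OF X] x by metis
    then show ?thesis using \<omega> by blast
  qed
  have refine': "\<exists>A. fincut TV TE A \<and> pt_in (\<phi> \<omega>) A \<and>
      (\<forall>\<omega>'\<in>edge_ends V E. pt_in (\<phi> \<omega>') A \<longrightarrow> end_in \<omega>' K)"
    if \<omega>: "\<omega> \<in> edge_ends V E" and K: "fincut V E K" "end_in \<omega> K" for \<omega> K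
  proof -
    obtain R where R: "ray V E R" "\<omega> = end_of V E R" by (rule end_ofE[OF G \<omega>])
    have "ev_in R K" using K R end_in_end_of[OF G R(1) K(1)] by simp
    from refine[OF R(1) K(1) this] obtain A where A: "fincut TV TE A" "ev_in (\<lambda>i. t (R i)) A"
      "\<forall>R'. ray V E R' \<and> ev_in (\<lambda>i. t (R' i)) A \<longrightarrow> ev_in R' K" by (elim exE conjE) (rule that)
    have "end_in \<omega>' K" if \<omega>': "\<omega>' \<in> edge_ends V E" "pt_in (\<phi> \<omega>') A" for \<omega>'
    proof -
      obtain R' where R': "ray V E R'" "\<omega>' = end_of V E R'" by (rule end_ofE[OF G \<omega>'(1)])
      have "ev_in (\<lambda>i. t (R' i)) A" using \<phi>(2)[OF \<omega>'(1) A(1)] \<omega>'(2) pre[OF R'(1) A(1)] R' by simp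
      then have "ev_in R' K" using A(3) R'(1) by blast
      then show ?thesis using end_in_end_of[OF G R'(1) K(1)] R' by simp
    qed
    moreover have "pt_in (\<phi> \<omega>) A" using \<phi>(2)[OF \<omega> A(1)] pre[OF R(1) A(1)] R A(2) by simp
    ultimately show ?thesis using A(1) by blast
  qed
  have top1: "topspace (edge_end_space V E) = edge_ends V E" by (rule topspace_edge_end_space[OF G])
  have top2: "topspace (subtopology (graph_space TV TE) X) = X"
    using X by (simp add: topspace_graph_space[OF T] topspace_subtopology Int_absorb1)
  have "homeomorphic_map (edge_end_space V E) (subtopology (graph_space TV TE) X) \<phi>"
  proof (rule bijective_open_imp_homeomorphic_map)
    show "continuous_map (edge_end_space V E) (subtopology (graph_space TV TE) X) \<phi>"
      unfolding continuous_map_def top1 top2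
    proof (intro conjI allI impI)
      show "\<phi> \<in> edge_ends V E \<rightarrow> X" using \<phi>(1) by auto
      fix U assume "openin (subtopology (graph_space TV TE) X) U"
      then obtain O' where O': "openin (graph_space TV TE) O'" "U = O' \<inter> X"
        by (auto simp: openin_subtopology)
      show "openin (edge_end_space V E) {\<omega> \<in> edge_ends V E. \<phi> \<omega> \<in> U}"
        unfolding openin_edge_end_space[OF G]
      proof (intro ballI conjI)
        fix \<omega> assume "\<omega> \<in> {\<omega> \<in> edge_ends V E. \<phi> \<omega> \<in> U}"
        then have \<omega>: "\<omega> \<in> edge_ends V E" "\<phi> \<omega> \<in> O'" using O' by auto
        then show "\<omega> \<in> edge_ends V E" by simp
        obtain A where A: "fincut TV TE A" "pt_in (\<phi> \<omega>) A" "{x \<in> pts TV TE. pt_in x A} \<subseteq> O'"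
          using O'(1) \<omega>(2) unfolding openin_graph_space[OF T] by blast
        have "fincut V E (pre A)" unfolding pre_def by (rule cuts[OF A(1)])
        moreover have "end_in \<omega> (pre A)" using \<phi>(2)[OF \<omega>(1) A(1)] A(2) by simp
        moreover have "\<phi> \<omega>' \<in> U" if "\<omega>' \<in> edge_ends V E" "end_in \<omega>' (pre A)" for \<omega>'
          using \<phi>[OF that(1)] A(1,3) that(2) X O'(2) by blast
        ultimately show "\<exists>A. fincut V E A \<and> end_in \<omega> A \<and>
            {\<omega> \<in> edge_ends V E. end_in \<omega> A} \<subseteq> {\<omega> \<in> edge_ends V E. \<phi> \<omega> \<in> U}"
          by (intro exI[of _ "pre A"]) auto
      qed
    qed
    show "open_map (edge_end_space V E) (subtopology (graph_space TV TE) X) \<phi>"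
      unfolding open_map_def
    proof (intro allI impI)
      fix U assume U: "openin (edge_end_space V E) U"
      \<comment> \<open>These are the cuts whose trace on the image of \<open>\<phi>\<close> comes
        from \<open>U\<close>; by \<open>refine'\<close> they cover the image of
        \<open>U\<close>.\<close>
      define \<A> where "\<A> = {A. fincut TV TE A \<and> (\<forall>\<omega>\<in>edge_ends V E. pt_in (\<phi> \<omega>) A \<longrightarrow> \<omega> \<in> U)}"
      define O' where "O' = {x \<in> pts TV TE. \<exists>A\<in>\<A>. pt_in x A}"
      have "openin (graph_space TV TE) O'"
        unfolding openin_graph_space[OF T] O'_def \<A>_def by blast
      moreover have "\<phi> ` U = O' \<inter> X"
      proof (intro equalityI subsetI)
        fix x assume "x \<in> \<phi> ` U"
        then obtain \<omega> where \<omega>: "\<omega> \<in> U" "x = \<phi> \<omega>" by auto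
        then obtain K where K: "\<omega> \<in> edge_ends V E" "fincut V E K" "end_in \<omega> K"
          "{\<omega> \<in> edge_ends V E. end_in \<omega> K} \<subseteq> U"
          using U unfolding openin_edge_end_space[OF G] by blast
        obtain A where "fincut TV TE A" "pt_in (\<phi> \<omega>) A"
          "\<forall>\<omega>'\<in>edge_ends V E. pt_in (\<phi> \<omega>') A \<longrightarrow> end_in \<omega>' K"
          using refine'[OF K(1-3)] by (elim exE conjE) (rule that)
        then show "x \<in> O' \<inter> X" using \<phi>(1)[OF K(1)] X K(4) \<omega>(2) unfolding O'_def \<A>_def by blast
      next
        fix x assume x: "x \<in> O' \<inter> X"
        then obtain \<omega> where \<omega>: "\<omega> \<in> edge_ends V E" "\<phi> \<omega> = x" using onto' by blast
        then have "\<omega> \<in> U" using x unfolding O'_def \<A>_def by blast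
        then show "x \<in> \<phi> ` U" using \<omega> by blast
      qed
      ultimately show "openin (subtopology (graph_space TV TE) X) (\<phi> ` U)"
        unfolding openin_subtopology by blast
    qed
    show "\<phi> ` topspace (edge_end_space V E) = topspace (subtopology (graph_space TV TE) X)"
      unfolding top1 top2 using \<phi>(1) onto' by blast
    show "inj_on \<phi> (topspace (edge_end_space V E))"
      unfolding top1
    proof (rule inj_onI)
      fix \<omega> \<omega>' assume \<omega>: "\<omega> \<in> edge_ends V E" and \<omega>': "\<omega>' \<in> edge_ends V E" and eq: "\<phi> \<omega> = \<phi> \<omega>'"
      obtain R where R: "ray V E R" "\<omega> = end_of V E R" by (rule end_ofE[OF G \<omega>])
      obtain R' where R': "ray V E R'" "\<omega>' = end_of V E R'" by (rule end_ofE[OF G \<omega>'])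
      have sub: "end_in \<omega>' K" if "fincut V E K" "end_in \<omega> K" for K
        using refine'[OF \<omega> that] \<omega>' eq by metis
      have sub': "end_in \<omega> K" if "fincut V E K" "end_in \<omega>' K" for K
        using refine'[OF \<omega>' that] \<omega> eq by metis
      show "\<omega> = \<omega>'"
        unfolding R(2) R'(2)
        by (rule end_of_eq[OF G R(1) R'(1)])
          (use sub sub' end_in_end_of[OF G R(1)] end_in_end_of[OF G R'(1)] R(2) R'(2) in blast)
    qed
  qed
  then show ?thesis by (rule homeomorphic_map_imp_homeomorphic_space)
qed

section \<open>Cuts separating the points of a tree\<close>

locale tree =
  fixes V :: "'a set" and E :: "'a set set"
  assumes tree: "is_tree V E"
begin

sublocale conn_graph V E
  using tree by unfold_locales (auto simp: is_tree_def)

text \<open>Every edge of a tree is a bridge: a path around it has at least three vertices and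
  closes up to a cycle.\<close>

lemma no_detour:
  assumes e: "{a, b} \<in> E"
  shows "(a, b) \<notin> (adj (E - {{a, b}}))\<^sup>*"
proof
  assume "(a, b) \<in> (adj (E - {{a, b}}))\<^sup>*"
  moreover have "graph V (E - {{a, b}})" by (rule graph_subset[OF graph]) auto
  ultimately obtain xs where xs: "walk V (E - {{a, b}}) xs" "hd xs = a" "last xs = b" "distinct xs"
    using distinct_walk graphD(1)[OF graph e] by metis
  have ab: "a \<noteq> b" using graphD(3)[OF graph e] .
  have "length xs \<ge> 3"
  proof (rule ccontr)
    assume "\<not> ?thesis"
    moreover have "length xs \<noteq> 0" using xs(1) by (simp add: walk_def)
    ultimately have "length xs = 1 \<or> length xs = 2" by linarith
    then show False
    proof
      assume "length xs = 1"
      then show False using xs ab by (auto simp: length_Suc_conv)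
    next
      assume l: "length xs = 2"
      then obtain c d where "xs = [c, d]" by (auto simp: numeral_2_eq_2 length_Suc_conv)
      then show False using xs by (auto simp: walk_def)
    qed
  qed
  moreover have "walk V E xs" using xs(1) by (auto simp: walk_def)
  moreover have "{last xs, hd xs} \<in> E" using xs(2,3) e by (simp add: insert_commute)
  ultimately have "has_cycle V E"
    unfolding has_cycle_def using xs(4) by blast
  then show False using tree by (simp add: is_tree_def)
qed

text \<open>One side of the fundamental cut of an edge: deleting the edge leaves it as the only
  possible boundary edge.\<close>

definition side :: "'a \<Rightarrow> 'a \<Rightarrow> 'a set" where
  "side a b = {y. (a, y) \<in> (adj (E - {{a, b}}))\<^sup>*}"

lemma side_cut:
  assumes e: "{a, b} \<in> E"
  shows "fincut V E (side a b)" "a \<in> side a b" "b \<notin> side a b"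
proof -
  have "side a b \<subseteq> V"
  proof
    fix y assume "y \<in> side a b"
    then have "(a, y) \<in> (adj (E - {{a, b}}))\<^sup>*" by (simp add: side_def)
    then show "y \<in> V"
      by (rule rtrancl_adj_in) (use graphD(1)[OF graph e] graph in \<open>auto simp: graph_def\<close>)
  qed
  moreover have "edge_boundary E (side a b) \<subseteq> {{a, b}}"
  proof
    fix e assume "e \<in> edge_boundary E (side a b)"
    then obtain x y where xy: "e = {x, y}" "{x, y} \<in> E" "x \<in> side a b" "y \<notin> side a b"
      using in_boundary_iff[OF graph] by metis
    show "e \<in> {{a, b}}"
    proof (rule ccontr)
      assume "e \<notin> {{a, b}}"
      then have "(x, y) \<in> adj (E - {{a, b}})" using xy by simp
      with xy(3) have "y \<in> side a b" unfolding side_def mem_Collect_eq by (rule rtrancl_into_rtrancl)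
      with xy(4) show False by simp
    qed
  qed
  ultimately show "fincut V E (side a b)" by (auto simp: fincut_def intro: finite_subset)
  show "a \<in> side a b" "b \<notin> side a b" using no_detour[OF e] by (simp_all add: side_def)
qed

lemma up_avoiding:
  assumes "(u, y) \<in> (up E u)\<^sup>*"
    and e: "\<And>x z. (x, z) \<in> up E u \<Longrightarrow> lev E u z \<le> lev E u y \<Longrightarrow> {x, z} \<noteq> e"
  shows "(u, y) \<in> (adj (E - {e}))\<^sup>*"
  using assms
proof (induction rule: rtrancl_induct)
  case (step y z)
  have "lev E u y < lev E u z" using step(2) by (simp add: up_def)
  then have "(u, y) \<in> (adj (E - {e}))\<^sup>*" using step.IH step.prems by (meson less_imp_le order_trans)
  moreover have "(y, z) \<in> adj (E - {e})" using step.prems[OF step(2)] up_edge[OF step(2)] by simp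
  ultimately show ?case by (rule rtrancl_into_rtrancl)
qed simp

text \<open>The last edge of a shortest path from \<open>u\<close> to \<open>v\<close> is cut.
  Climbing from \<open>u\<close> to the lower end \<open>y\<close> never uses it, since all levels
  on the way are below that of \<open>v\<close>.\<close>

lemma separate_vertices:
  assumes "u \<in> V" "v \<in> V" "u \<noteq> v"
  shows "\<exists>A. fincut V E A \<and> v \<in> A \<and> u \<notin> A"
proof -
  obtain y where y: "(y, v) \<in> up E u" "(u, y) \<in> (adj E)\<^sup>*"
    using lev_pred[OF reach[OF assms(1,2)]] assms(3) by metis
  have e: "{v, y} \<in> E" using up_edge[OF y(1)] by (simp add: insert_commute)
  have "(u, y) \<in> (adj (E - {{v, y}}))\<^sup>*"
  proof (rule up_avoiding[OF up_reach[OF y(2)]])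
    fix x z assume "(x, z) \<in> up E u" "lev E u z \<le> lev E u y"
    then have "lev E u x < lev E u v" "lev E u z < lev E u v" using y(1) by (auto simp: up_def)
    then show "{x, z} \<noteq> {v, y}" by (auto simp: doubleton_eq_iff)
  qed
  then have "u \<in> side v y \<Longrightarrow> y \<in> side v y" by (auto simp: side_def)
  then show ?thesis using side_cut[OF e] by blast
qed

text \<open>Cut off the tail of \<open>q\<close> just after its last visit to a vertex closest to \<open>u\<close>.\<close>

lemma separate_vertex_sequence:
  assumes u: "u \<in> V" and q: "\<And>i. q i \<in> V" "\<And>i. q (Suc i) = q i \<or> {q i, q (Suc i)} \<in> E"
    and fin: "\<And>v. finite {i. q i = v}"
  shows "\<exists>A. fincut V E A \<and> u \<in> A \<and> ev_in q (V - A)"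
proof -
  define m where "m = (LEAST m. \<exists>i. lev E u (q i) = m)"
  have "\<exists>i. lev E u (q i) = m" unfolding m_def by (rule LeastI_ex) blast
  then obtain j0 where j0: "lev E u (q j0) = m" by blast
  have m: "m \<le> lev E u (q i)" for i unfolding m_def by (rule Least_le) blast
  define j where "j = Max {i. q i = q j0}"
  have j: "q j = q j0" using Max_in[OF fin[of "q j0"]] by (auto simp: j_def)
  have last: "q i \<noteq> q j" if "i > j" for i
    using Max_ge[OF fin[of "q j0"], of i] that j by (auto simp: j_def)
  let ?a = "q j" and ?b = "q (Suc j)"
  have e: "{?a, ?b} \<in> E" using q(2)[of j] last[of "Suc j"] by auto
  have "(u, ?a) \<in> (adj (E - {{?a, ?b}}))\<^sup>*"
  proof (rule up_avoiding[OF up_reach[OF reach[OF u q(1)]]])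
    fix x z assume "(x, z) \<in> up E u" "lev E u z \<le> lev E u ?a"
    \<comment> \<open>Edges climbing towards \<open>?a\<close> start below the minimal level
      \<open>m\<close>, whereas both ends of the cut edge have level at least
      \<open>m\<close>.\<close>
    then have "lev E u x < m" using j j0 by (auto simp: up_def)
    then show "{x, z} \<noteq> {?a, ?b}" using m[of j] m[of "Suc j"] by (auto simp: doubleton_eq_iff)
  qed
  then have "u \<in> side ?a ?b" using adj_rtrancl_sym by (auto simp: side_def)
  moreover have "q i \<notin> side ?a ?b" if "i \<ge> Suc j" for i
    using that
  proof (induction rule: dec_induct)
    case base
    show ?case using side_cut(3)[OF e] .
  next
    case (step i)
    have "q i \<noteq> ?a" "q (Suc i) \<noteq> ?a" using last step by simp_all
    then have "{q i, q (Suc i)} \<noteq> {?a, ?b}" by (auto simp: doubleton_eq_iff)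
    then have "q (Suc i) = q i \<or> (q (Suc i), q i) \<in> adj (E - {{?a, ?b}})"
      using q(2)[of i] unfolding adj_iff insert_commute[of "q (Suc i)"] by blast
    then have "q (Suc i) \<in> side ?a ?b \<Longrightarrow> q i \<in> side ?a ?b"
      unfolding side_def mem_Collect_eq by (metis rtrancl.rtrancl_into_rtrancl)
    with step show ?case by blast
  qed
  then have "ev_in q (V - side ?a ?b)" using q(1) by (auto simp: eventually_sequentially)
  ultimately show ?thesis using side_cut(1)[OF e] by blast
qed

lemma separate_vertex_ray:
  assumes "u \<in> V" "ray V E p"
  shows "\<exists>A. fincut V E A \<and> u \<in> A \<and> ev_in p (V - A)"
proof (rule separate_vertex_sequence[OF assms(1)])
  show "finite {i. p i = v}" for v
    using finite_vimageI[of "{v}" p] rayD(1)[OF assms(2)] by (simp add: vimage_def)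
qed (use rayD[OF assms(2)] in auto)

text \<open>Since complements of cuts are cuts, the order of the two points does not matter. Two
  ends are distinguished by the characterisation of ends through cuts; the cases with a vertex come
  from \<open>separate_vertices\<close> and \<open>separate_vertex_ray\<close>.\<close>

lemma separate_points:
  assumes "x \<in> pts V E" "y \<in> pts V E" "x \<noteq> y"
  shows "\<exists>A. fincut V E A \<and> pt_in x A \<and> \<not> pt_in y A"
proof -
  have vr: "\<exists>A. fincut V E A \<and> u \<in> A \<and> \<not> end_in \<omega> A \<and> end_in \<omega> (V - A)"
    if u: "u \<in> V" and \<omega>: "\<omega> \<in> edge_ends V E" for u \<omega>
  proof -
    obtain R where R: "ray V E R" "\<omega> = end_of V E R" by (rule end_ofE[OF graph \<omega>])
    obtain A where A: "fincut V E A" "u \<in> A" "ev_in R (V - A)"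
      using separate_vertex_ray[OF u R(1)] by blast
    then show ?thesis
      using end_in_end_of[OF graph R(1)] fincut_Compl[OF graph] ray_not_in_iff[OF R(1) A(1)] R(2)
      by blast
  qed
  consider (vv) u v where "x = Inl u" "y = Inl v" "u \<in> V" "v \<in> V"
    | (ve) u \<omega> where "x = Inl u" "y = Inr \<omega>" "u \<in> V" "\<omega> \<in> edge_ends V E"
    | (ev) \<omega> u where "x = Inr \<omega>" "y = Inl u" "u \<in> V" "\<omega> \<in> edge_ends V E"
    | (ee) \<omega> \<omega>' where "x = Inr \<omega>" "y = Inr \<omega>'" "\<omega> \<in> edge_ends V E" "\<omega>' \<in> edge_ends V E"
    using assms(1,2) unfolding pts_def by blast
  then show ?thesis
  proof cases
    case vv
    then show ?thesis using separate_vertices[of v u] assms(3) by auto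
  next
    case ve
    then show ?thesis using vr by fastforce
  next
    case ev
    then obtain A where "fincut V E A" "u \<in> A" "end_in \<omega> (V - A)" using vr by blast
    then show ?thesis using ev fincut_Compl[OF graph] by (intro exI[of _ "V - A"]) auto
  next
    case ee
    obtain R where R: "ray V E R" "\<omega> = end_of V E R" by (rule end_ofE[OF graph ee(3)])
    obtain R' where R': "ray V E R'" "\<omega>' = end_of V E R'" by (rule end_ofE[OF graph ee(4)])
    have "\<not> (\<forall>A. fincut V E A \<longrightarrow> (ev_in R A \<longleftrightarrow> ev_in R' A))"
      using end_of_eq[OF graph R(1) R'(1)] ee assms(3) R R' by blast
    then obtain A where A: "fincut V E A" "ev_in R A \<noteq> ev_in R' A" by blast
    then consider "ev_in R A" "\<not> ev_in R' A" | "ev_in R (V - A)" "\<not> ev_in R' (V - A)"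
      using ray_not_in_iff[OF R(1) A(1)] ray_not_in_iff[OF R'(1) A(1)] by blast
    then show ?thesis
      using ee A(1) fincut_Compl[OF graph A(1)] end_in_end_of[OF graph R(1)]
        end_in_end_of[OF graph R'(1)] R(2) R'(2)
      by cases (auto intro: exI[of _ A] exI[of _ "V - A"])
  qed
qed

end

section \<open>From trees to graphs\<close>

locale clique_extension = tree TV TE for TV :: "'w set" and TE :: "'w set set" +
  fixes X :: "('w + (nat \<Rightarrow> 'w) set) set"
  assumes X: "X \<subseteq> pts TV TE" and ends: "Inr ` edge_ends TV TE \<subseteq> X"
begin

text \<open>Index 0 carries the tree itself; the pairs over a node in \<open>X\<close> form its
  clique, which includes index 0. Singletons serve as vertices to fit the vertex type of the
  theorem.\<close>

definition VG :: "('w \<times> nat) set set" where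
  "VG = {{(w, n)} | w n. w \<in> TV \<and> (n = 0 \<or> Inl w \<in> X)}"

definition EG :: "('w \<times> nat) set set set" where
  "EG = {{{(a, 0)}, {(b, 0)}} | a b. {a, b} \<in> TE} \<union>
        {{{(w, m)}, {(w, n)}} | w m n. w \<in> TV \<and> Inl w \<in> X \<and> m \<noteq> n}"

definition t :: "('w \<times> nat) set \<Rightarrow> 'w" where
  "t v = fst (the_elem v)"

lemma t_simp [simp]: "t {(w, n)} = w"
  by (simp add: t_def)

lemma VG_iff [simp]: "{(w, n)} \<in> VG \<longleftrightarrow> w \<in> TV \<and> (n = 0 \<or> Inl w \<in> X)"
  by (auto simp: VG_def)

lemma VG_E:
  assumes "v \<in> VG"
  obtains w n where "v = {(w, n)}" "w \<in> TV" "n = 0 \<or> Inl w \<in> X"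
  using assms by (auto simp: VG_def)

lemma EG_E:
  assumes "e \<in> EG"
  obtains a b where "e = {{(a, 0)}, {(b, 0)}}" "{a, b} \<in> TE"
    | w k l where "e = {{(w, k)}, {(w, l)}}" "w \<in> TV" "Inl w \<in> X" "k \<noteq> l"
  using assms unfolding EG_def by (elim UnE CollectE exE conjE) (rule that; assumption)+

lemma EG_iff:
  "{{(a, m)}, {(b, n)}} \<in> EG \<longleftrightarrow>
    m = 0 \<and> n = 0 \<and> {a, b} \<in> TE \<or> a = b \<and> a \<in> TV \<and> Inl a \<in> X \<and> m \<noteq> n"
proof
  assume "{{(a, m)}, {(b, n)}} \<in> EG"
  then consider c d where "{{(a, m)}, {(b, n)}} = {{(c, 0)}, {(d, 0)}}" "{c, d} \<in> TE"
    | w k l where "{{(a, m)}, {(b, n)}} = {{(w, k)}, {(w, l)}}" "w \<in> TV" "Inl w \<in> X" "k \<noteq> l"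
    by (rule EG_E)
  then show "m = 0 \<and> n = 0 \<and> {a, b} \<in> TE \<or> a = b \<and> a \<in> TV \<and> Inl a \<in> X \<and> m \<noteq> n"
  proof cases
    case 1
    have "{d, c} \<in> TE" using 1(2) by (simp add: insert_commute)
    then show ?thesis using 1 unfolding doubleton_eq_iff by auto
  next
    case 2
    then show ?thesis unfolding doubleton_eq_iff by auto
  qed
next
  assume "m = 0 \<and> n = 0 \<and> {a, b} \<in> TE \<or> a = b \<and> a \<in> TV \<and> Inl a \<in> X \<and> m \<noteq> n"
  then show "{{(a, m)}, {(b, n)}} \<in> EG" unfolding EG_def by blast
qed

lemma graphG: "graph VG EG"
  unfolding graph_def
proof
  fix e assume "e \<in> EG"
  then consider a b where "e = {{(a, 0)}, {(b, 0)}}" "{a, b} \<in> TE"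
    | w k l where "e = {{(w, k)}, {(w, l)}}" "w \<in> TV" "Inl w \<in> X" "k \<noteq> l"
    by (rule EG_E)
  then show "e \<in> {{x, y} |x y. x \<in> VG \<and> y \<in> VG \<and> x \<noteq> y}"
  proof cases
    case 1
    then show ?thesis using graphD[OF graph 1(2)]
      by (intro CollectI exI[of _ "{(a, 0)}"] exI[of _ "{(b, 0)}"]) auto
  next
    case 2
    then show ?thesis by (intro CollectI exI[of _ "{(w, k)}"] exI[of _ "{(w, l)}"]) auto
  qed
qed

lemma connectedG: "connected_graph VG EG"
  unfolding connected_graph_iff[OF graphG]
proof (intro conjI ballI)
  obtain w where "w \<in> TV" using conn by (auto simp: connected_graph_def)
  then have "{(w, 0)} \<in> VG" by simp
  then show "VG \<noteq> {}" by blast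
  have down: "({(w, n)}, {(w, 0)}) \<in> (adj EG)\<^sup>*" if "{(w, n)} \<in> VG" for w n
    using that by (cases "n = 0") (auto simp: EG_iff)
  have base: "({(a, 0)}, {(b, 0)}) \<in> (adj EG)\<^sup>*" if "(a, b) \<in> (adj TE)\<^sup>*" for a b
    using that
  proof induction
    case (step y z)
    then have "({(y, 0)}, {(z, 0)}) \<in> adj EG" by (simp add: EG_iff)
    with step.IH show ?case by (rule rtrancl_into_rtrancl)
  qed simp
  fix x y assume "x \<in> VG" "y \<in> VG"
  then obtain a m b n where xy: "x = {(a, m)}" "y = {(b, n)}" "a \<in> TV" "b \<in> TV"
    by (elim VG_E)
  have "(x, {(a, 0)}) \<in> (adj EG)\<^sup>*" "({(b, 0)}, y) \<in> (adj EG)\<^sup>*"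
    using down[of a m] adj_rtrancl_sym[OF down[of b n]] \<open>x \<in> VG\<close> \<open>y \<in> VG\<close> xy by simp_all
  with base[OF reach[OF xy(3,4)]] show "(x, y) \<in> (adj EG)\<^sup>*" by (meson rtrancl_trans)
qed

text \<open>A clique edge projects to a single node, so only tree edges at index 0 can cross the
  preimage.\<close>

lemma cut_lift:
  assumes A: "fincut TV TE A"
  shows "fincut VG EG {v \<in> VG. t v \<in> A}"
proof -
  have "edge_boundary EG {v \<in> VG. t v \<in> A} \<subseteq> (\<lambda>e. (\<lambda>w. {(w, 0)}) ` e) ` edge_boundary TE A"
  proof
    fix e assume "e \<in> edge_boundary EG {v \<in> VG. t v \<in> A}"
    then obtain x y where e: "e = {x, y}" "{x, y} \<in> EG" "x \<in> {v \<in> VG. t v \<in> A}"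
      "y \<notin> {v \<in> VG. t v \<in> A}"
      by (rule boundaryE[OF graphG])
    then have "x \<in> VG" by simp
    have y: "y \<in> VG" using graphD(2)[OF graphG e(2)] .
    obtain a m b n where xy: "x = {(a, m)}" "y = {(b, n)}"
      using \<open>x \<in> VG\<close> y by (elim VG_E)
    then have "a \<in> A" "b \<notin> A" using e y by auto
    then have ab: "m = 0" "n = 0" "{a, b} \<in> TE" using e(2) unfolding xy EG_iff by auto
    then have "{a, b} \<in> edge_boundary TE A" using \<open>a \<in> A\<close> \<open>b \<notin> A\<close> by (simp add: edge_in_boundary)
    then show "e \<in> (\<lambda>e. (\<lambda>w. {(w, 0)}) ` e) ` edge_boundary TE A"
      using e(1) xy ab by (intro image_eqI[of _ _ "{a, b}"]) auto
  qed
  then show ?thesis using A by (auto simp: fincut_def intro: finite_subset)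
qed

text \<open>If the clique were split, a vertex on either side would be joined by boundary edges to
  all vertices of the other side, so both sides would be finite.\<close>

lemma clique_uncut:
  assumes K: "fincut VG EG K" and w: "w \<in> TV" "Inl w \<in> X" and m: "{(w, m)} \<in> K"
  shows "{(w, n)} \<in> K"
proof (rule ccontr)
  assume n: "{(w, n)} \<notin> K"
  have fin: "finite (edge_boundary EG K)" using K by (simp add: fincut_def)
  have edge: "{{(w, k)}, {(w, l)}} \<in> edge_boundary EG K" if "{(w, k)} \<in> K" "{(w, l)} \<notin> K" for k l
    using that w by (intro edge_in_boundary) (auto simp: EG_iff)
  have inj: "inj (\<lambda>k. {{(w, k)}, {(w, l)}})" for l :: nat
    by (rule injI) (auto simp: doubleton_eq_iff)
  have "finite {k. {(w, k)} \<notin> K}"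
    by (rule finite_subset[OF _ finite_vimageI[OF fin inj[of m]]])
      (use edge[OF m] in \<open>auto simp: insert_commute\<close>)
  moreover have "finite {k. {(w, k)} \<in> K}"
    by (rule finite_subset[OF _ finite_vimageI[OF fin inj[of n]]]) (use edge[OF _ n] in auto)
  ultimately have "finite ({k. {(w, k)} \<notin> K} \<union> {k. {(w, k)} \<in> K})" by blast
  moreover have "{k. {(w, k)} \<notin> K} \<union> {k. {(w, k)} \<in> K} = (UNIV :: nat set)" by blast
  ultimately show False by simp
qed

lemma cut_descend:
  assumes K: "fincut VG EG K"
  obtains A where "fincut TV TE A" "{v \<in> VG. t v \<in> A} = K"
proof
  let ?A = "{w \<in> TV. {(w, 0)} \<in> K}"
  have "(\<lambda>e. (\<lambda>w. {(w, 0::nat)}) ` e) ` edge_boundary TE ?A \<subseteq> edge_boundary EG K"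
  proof
    fix e' assume "e' \<in> (\<lambda>e. (\<lambda>w. {(w, 0::nat)}) ` e) ` edge_boundary TE ?A"
    then obtain e where e: "e' = (\<lambda>w. {(w, 0)}) ` e" "e \<in> edge_boundary TE ?A" by auto
    from e(2) obtain a b where ab: "e = {a, b}" "{a, b} \<in> TE" "a \<in> ?A" "b \<notin> ?A"
      by (rule boundaryE[OF graph])
    then have "{{(a, 0)}, {(b, 0)}} \<in> edge_boundary EG K"
      using graphD(2)[OF graph ab(2)] by (intro edge_in_boundary) (auto simp: EG_iff)
    then show "e' \<in> edge_boundary EG K" using e ab by simp
  qed
  then have "finite ((\<lambda>e. (\<lambda>w. {(w, 0::nat)}) ` e) ` edge_boundary TE ?A)"
    using K by (auto simp: fincut_def intro: finite_subset)
  moreover have "inj (\<lambda>e :: 'w set. (\<lambda>w. {(w, 0::nat)}) ` e)"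
    by (rule inj_on_image) (auto simp: inj_def)
  ultimately have "finite (edge_boundary TE ?A)"
    by (meson finite_imageD inj_on_subset subset_UNIV)
  then show "fincut TV TE ?A" by (simp add: fincut_def)
  show "{v \<in> VG. t v \<in> ?A} = K"
  proof (intro equalityI subsetI)
    fix v assume v: "v \<in> {v \<in> VG. t v \<in> ?A}"
    then have "v \<in> VG" by simp
    then obtain w n where w: "v = {(w, n)}" "w \<in> TV" "n = 0 \<or> Inl w \<in> X" by (elim VG_E)
    then have "{(w, 0)} \<in> K" using v by simp
    then show "v \<in> K" using w clique_uncut[OF K, of w 0 n] by (cases "n = 0") auto
  next
    fix v assume v: "v \<in> K"
    then have VG: "v \<in> VG" using K by (auto simp: fincut_def)
    then obtain w n where w: "v = {(w, n)}" "w \<in> TV" "n = 0 \<or> Inl w \<in> X" by (elim VG_E)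
    then have "{(w, 0)} \<in> K" using v clique_uncut[OF K, of w n 0] by (cases "n = 0") auto
    then show "v \<in> {v \<in> VG. t v \<in> ?A}" using w VG by simp
  qed
qed

text \<open>The projected ray is a walk in the tree that may pause. If it visits a node infinitely
  often, it converges to that node. Otherwise compactness yields an adherent point, which is no node
  because a cut separates a tail of the walk from any given node; so it is an end, and
  \<open>X\<close> contains all ends.\<close>

lemma ray_limit:
  assumes R: "ray VG EG R"
  shows "\<exists>x\<in>X. \<forall>A. fincut TV TE A \<longrightarrow> (pt_in x A \<longleftrightarrow> ev_in (\<lambda>i. t (R i)) A)"
proof -
  let ?q = "\<lambda>i. t (R i)"
  have form: "\<exists>n. R i = {(?q i, n)} \<and> ?q i \<in> TV \<and> (n = 0 \<or> Inl (?q i) \<in> X)" for i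
  proof -
    obtain w n where "R i = {(w, n)}" "w \<in> TV" "n = 0 \<or> Inl w \<in> X"
      by (rule VG_E[OF rayD(2)[OF R]])
    then show ?thesis by simp
  qed
  have qV: "?q i \<in> TV" for i using form by blast
  have pre: "ev_in ?q A \<longleftrightarrow> ev_in R {v \<in> VG. t v \<in> A}" for A
    using rayD(2)[OF R] by simp
  have infq: "ev_in ?q A" if A: "fincut TV TE A" and inf: "infinite {i. ?q i \<in> A}" for A
  proof -
    have "{i. ?q i \<in> A} = {i. R i \<in> {v \<in> VG. t v \<in> A}}" using rayD(2)[OF R] by simp
    then show ?thesis using ray_frequently_in[OF R cut_lift[OF A]] inf pre by simp
  qed
  \<comment> \<open>The walk decides every cut, so it suffices that it meets each cut around the
    point infinitely often; the converse follows by taking complements.\<close>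
  have match: "\<forall>A. fincut TV TE A \<longrightarrow> (P A \<longleftrightarrow> ev_in ?q A)"
    if P: "\<And>A. fincut TV TE A \<Longrightarrow> P A \<Longrightarrow> infinite {i. ?q i \<in> A}"
      "\<And>A. fincut TV TE A \<Longrightarrow> \<not> P A \<Longrightarrow> P (TV - A)" for P
  proof (intro allI impI)
    fix A assume A: "fincut TV TE A"
    show "P A \<longleftrightarrow> ev_in ?q A"
    proof (cases "P A")
      case True
      then show ?thesis using infq[OF A P(1)[OF A]] by simp
    next
      case False
      have "ev_in ?q (TV - A)"
        using infq[OF _ P(1)] fincut_Compl[OF graph A] P(2)[OF A False] by blast
      then have "\<not> ev_in ?q A" using ev_in_disjoint[of ?q A "TV - A"] by blast
      with False show ?thesis by simp
    qed
  qed
  show ?thesis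
  proof (cases "\<exists>w. infinite {i. ?q i = w}")
    case True
    then obtain w where w: "infinite {i. ?q i = w}" by blast
    \<comment> \<open>An injective ray cannot be at index 0 of \<open>w\<close> infinitely often,
      and another index occurs over \<open>w\<close> only if \<open>w\<close> belongs to
      \<open>X\<close>.\<close>
    have "\<exists>i\<in>{i. ?q i = w}. R i \<noteq> {(w, 0)}"
    proof (rule ccontr)
      assume "\<not> ?thesis"
      then have "R ` {i. ?q i = w} \<subseteq> {{(w, 0)}}" by blast
      then have "finite (R ` {i. ?q i = w})" using finite_subset by blast
      then show False using w rayD(1)[OF R] finite_imageD inj_on_subset by blast
    qed
    then obtain i where "?q i = w" "R i \<noteq> {(w, 0)}" by auto
    then have "Inl w \<in> X" using form[of i] by auto
    moreover have "w \<in> TV" using qV[of i] \<open>?q i = w\<close> by simp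
    have "\<forall>A. fincut TV TE A \<longrightarrow> (pt_in (Inl w) A \<longleftrightarrow> ev_in ?q A)"
    proof (rule match)
      fix A assume "pt_in (Inl w) A"
      then have "{i. ?q i = w} \<subseteq> {i. ?q i \<in> A}" by auto
      then show "infinite {i. ?q i \<in> A}" using w finite_subset by blast
    qed (use \<open>w \<in> TV\<close> in simp)
    ultimately show ?thesis by blast
  next
    case False
    then have fin: "finite {i. ?q i = w}" for w by blast
    have infS: "infinite (range ?q)"
    proof
      assume "finite (range ?q)"
      then have "finite (\<Union>w\<in>range ?q. {i. ?q i = w})" using fin by blast
      moreover have "(\<Union>w\<in>range ?q. {i. ?q i = w}) = UNIV" by blast
      ultimately show False by simp
    qed
    have SV: "range ?q \<subseteq> TV" using qV by blast
    have adh: "infinite {i. ?q i \<in> A}" if "adherent (range ?q) p" "fincut TV TE A" "ev_in p A" for p A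
    proof
      assume f: "finite {i. ?q i \<in> A}"
      have "A \<inter> range ?q \<subseteq> ?q ` {i. ?q i \<in> A}" by auto
      then have "finite (A \<inter> range ?q)" using f finite_surj by blast
      then show False using that unfolding adherent_def by blast
    qed
    have step: "?q (Suc i) = ?q i \<or> {?q i, ?q (Suc i)} \<in> TE" for i
    proof -
      obtain a m where a: "R i = {(a, m)}" by (rule VG_E[OF rayD(2)[OF R]])
      obtain b n where b: "R (Suc i) = {(b, n)}" by (rule VG_E[OF rayD(2)[OF R]])
      have "{{(a, m)}, {(b, n)}} \<in> EG" using rayD(3)[OF R, of i] a b by simp
      then show ?thesis unfolding EG_iff a b by auto
    qed
    have "\<not> adherent (range ?q) (\<lambda>_. c)" if c: "c \<in> TV" for c
    proof
      assume ad: "adherent (range ?q) (\<lambda>_. c)"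
      obtain A where A: "fincut TV TE A" "c \<in> A" "ev_in ?q (TV - A)"
        using separate_vertex_sequence[of c ?q, OF c qV step fin] by blast
      have "ev_in ?q A" using infq[OF A(1) adh[OF ad A(1)]] A(2) by simp
      then show False using ev_in_disjoint[OF _ A(3), of A] by blast
    qed
    then obtain p where p: "ray TV TE p" "adherent (range ?q) p"
      using compactness[OF SV infS] by blast
    have x: "Inr (end_of TV TE p) \<in> X" using ends end_of_in[OF p(1)] by blast
    have "\<forall>A. fincut TV TE A \<longrightarrow> (ev_in p A \<longleftrightarrow> ev_in ?q A)"
      by (rule match) (use adh[OF p(2)] ray_not_in_iff[OF p(1)] in blast)+
    then have "\<forall>A. fincut TV TE A \<longrightarrow> (pt_in (Inr (end_of TV TE p)) A \<longleftrightarrow> ev_in ?q A)"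
      using end_in_end_of[OF graph p(1)] by simp
    with x show ?thesis by blast
  qed
qed

lemma limit_ray:
  assumes x: "x \<in> X"
  shows "\<exists>R. ray VG EG R \<and> (\<forall>A. fincut TV TE A \<longrightarrow> (pt_in x A \<longleftrightarrow> ev_in (\<lambda>i. t (R i)) A))"
proof -
  consider w where "x = Inl w" "w \<in> TV" | \<omega> where "x = Inr \<omega>" "\<omega> \<in> edge_ends TV TE"
    using x X unfolding pts_def by blast
  then show ?thesis
  proof cases
    case 1
    let ?R = "\<lambda>n. {(w, n)}"
    have "ray VG EG ?R" using 1 x by (auto simp: ray_def inj_def EG_iff)
    then show ?thesis using 1 by (intro exI[of _ ?R]) simp
  next
    case 2
    obtain p where p: "ray TV TE p" "\<omega> = end_of TV TE p" by (rule end_ofE[OF graph 2(2)])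
    let ?R = "\<lambda>n. {(p n, 0)}"
    have "ray VG EG ?R" using rayD[OF p(1)] by (auto simp: ray_def inj_def EG_iff)
    then show ?thesis using 2 end_in_end_of[OF graph p(1)] p(2) by (intro exI[of _ ?R]) simp
  qed
qed

theorem end_space_clique_extension:
  "edge_end_space VG EG homeomorphic_space subtopology (graph_space TV TE) X"
proof (rule end_space_homeomorphic[where t = t])
  fix R K assume R: "ray VG EG R" "fincut VG EG K" "ev_in R K"
  obtain A where A: "fincut TV TE A" "{v \<in> VG. t v \<in> A} = K" using cut_descend[OF R(2)] .
  have "ev_in R' K \<longleftrightarrow> ev_in (\<lambda>i. t (R' i)) A" if "ray VG EG R'" for R'
    unfolding A(2)[symmetric] using rayD(2)[OF that] by simp
  then show "\<exists>A. fincut TV TE A \<and> ev_in (\<lambda>i. t (R i)) A \<and>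
      (\<forall>R'. ray VG EG R' \<and> ev_in (\<lambda>i. t (R' i)) A \<longrightarrow> ev_in R' K)"
    using A(1) R by blast
qed (fact graphG graph X separate_points cut_lift ray_limit limit_ray)+

end

section \<open>From graphs to trees\<close>

context conn_graph
begin

text \<open>The level is part of a node because a region may recur unchanged at the next level.
  Regions are nonempty, so the product determines both region and level.\<close>

definition treeV :: "('a \<times> nat) set set" where
  "treeV = {C \<times> {n} | C n. C \<in> parts n}"

definition treeE :: "('a \<times> nat) set set set" where
  "treeE = {{C \<times> {n}, D \<times> {Suc n}} | C D n. C \<in> parts n \<and> D \<in> parts (Suc n) \<and> D \<subseteq> C}"

definition lvl :: "('a \<times> nat) set \<Rightarrow> nat" where
  "lvl x = the_elem (snd ` x)"

lemma parts_nonempty: "C \<in> parts n \<Longrightarrow> C \<noteq> {}"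
  using region_nonempty parts_region by blast

lemma parts_cut: "C \<in> parts n \<Longrightarrow> fincut V E C"
  using parts_region by (simp add: region_iff)

lemma parts_subset: "C \<in> parts n \<Longrightarrow> C \<subseteq> V"
  using parts_cut by (simp add: fincut_def)

lemma lvl_node: "C \<in> parts n \<Longrightarrow> lvl (C \<times> {n}) = n"
  using parts_nonempty by (simp add: lvl_def)

lemma node_eq: "C \<in> parts n \<Longrightarrow> C \<times> {n} = D \<times> {m} \<longleftrightarrow> C = D \<and> n = m"
  using parts_nonempty by (auto simp: times_eq_iff)

lemma treeV_I: "C \<in> parts n \<Longrightarrow> C \<times> {n} \<in> treeV"
  unfolding treeV_def by blast

lemma treeV_E:
  assumes "x \<in> treeV"
  obtains C n where "x = C \<times> {n}" "C \<in> parts n"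
  using assms unfolding treeV_def by blast

lemma treeE_I: "C \<in> parts n \<Longrightarrow> D \<in> parts (Suc n) \<Longrightarrow> D \<subseteq> C \<Longrightarrow> {C \<times> {n}, D \<times> {Suc n}} \<in> treeE"
  unfolding treeE_def by blast

lemma treeE_E:
  assumes "e \<in> treeE"
  obtains C D n where "e = {C \<times> {n}, D \<times> {Suc n}}" "C \<in> parts n" "D \<in> parts (Suc n)" "D \<subseteq> C"
  using assms unfolding treeE_def by (elim CollectE exE conjE) (rule that)

lemma graphT: "graph treeV treeE"
  unfolding graph_def
proof
  fix e assume "e \<in> treeE"
  then obtain C D n where e: "e = {C \<times> {n}, D \<times> {Suc n}}" "C \<in> parts n" "D \<in> parts (Suc n)" "D \<subseteq> C"
    by (rule treeE_E)
  then show "e \<in> {{x, y} |x y. x \<in> treeV \<and> y \<in> treeV \<and> x \<noteq> y}"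
    using node_eq[OF e(2), of D "Suc n"] treeV_I[OF e(2)] treeV_I[OF e(3)]
    by (intro CollectI exI[of _ "C \<times> {n}"] exI[of _ "D \<times> {Suc n}"]) simp
qed

lemma parts_ancestor:
  assumes "m \<le> n" "C \<in> parts n"
  shows "\<exists>D\<in>parts m. C \<subseteq> D"
  using assms
proof (induction arbitrary: C rule: dec_induct)
  case (step n)
  then obtain C' where C': "C' \<in> parts n" "C \<subseteq> C'" using parts_parent[OF step.prems] by blast
  then obtain D where "D \<in> parts m" "C' \<subseteq> D" using step.IH by blast
  with C' show ?case by blast
qed blast

lemma parts_nested:
  assumes "m \<le> n" "C \<in> parts n" "D \<in> parts m" "x \<in> C" "x \<in> D"
  shows "C \<subseteq> D"
proof -
  obtain D' where D': "D' \<in> parts m" "C \<subseteq> D'" using parts_ancestor assms by blast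
  then have "D' = D" using parts_disjoint[OF D'(1) assms(3), of x] assms by blast
  with D' show ?thesis by simp
qed

lemma edge_level:
  assumes "{x, y} \<in> treeE"
  obtains C D n where "x = C \<times> {n}" "y = D \<times> {Suc n}" "C \<in> parts n" "D \<in> parts (Suc n)" "D \<subseteq> C"
    | C D n where "y = C \<times> {n}" "x = D \<times> {Suc n}" "C \<in> parts n" "D \<in> parts (Suc n)" "D \<subseteq> C"
proof -
  obtain C D n where e: "{x, y} = {C \<times> {n}, D \<times> {Suc n}}" "C \<in> parts n" "D \<in> parts (Suc n)" "D \<subseteq> C"
    using assms by (rule treeE_E)
  from e(1) consider "x = C \<times> {n}" "y = D \<times> {Suc n}" | "y = C \<times> {n}" "x = D \<times> {Suc n}"
    by (auto simp only: doubleton_eq_iff)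
  then show thesis using that e(2-4) by cases metis+
qed

lemma edge_lvl: "{x, y} \<in> treeE \<Longrightarrow> lvl y = Suc (lvl x) \<or> lvl x = Suc (lvl y)"
  by (erule edge_level) (simp_all add: lvl_node)

lemma lower_edge:
  assumes "{x, y} \<in> treeE" "lvl y \<le> lvl x"
  obtains C D n where "y = C \<times> {n}" "x = D \<times> {Suc n}" "C \<in> parts n" "D \<in> parts (Suc n)" "D \<subseteq> C"
  using assms(1)
proof (rule edge_level)
  fix C D n assume "x = C \<times> {n}" "y = D \<times> {Suc n}" "C \<in> parts n" "D \<in> parts (Suc n)"
  with assms(2) show ?thesis by (simp add: lvl_node)
qed (rule that)

lemma parent_unique:
  assumes "{x, y} \<in> treeE" "{x, z} \<in> treeE" "lvl y \<le> lvl x" "lvl z \<le> lvl x"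
  shows "y = z"
proof -
  obtain C D n where 1: "y = C \<times> {n}" "x = D \<times> {Suc n}" "C \<in> parts n" "D \<in> parts (Suc n)" "D \<subseteq> C"
    using lower_edge[OF assms(1,3)] .
  obtain C' D' n' where 2: "z = C' \<times> {n'}" "x = D' \<times> {Suc n'}" "C' \<in> parts n'"
    "D' \<in> parts (Suc n')" "D' \<subseteq> C'"
    using lower_edge[OF assms(2,4)] .
  have "D = D'" "n = n'" using node_eq[OF 1(4), of D' "Suc n'"] 1(2) 2(2) by simp_all
  moreover obtain v where "v \<in> D" using parts_nonempty[OF 1(4)] by blast
  ultimately have "C = C'" using parts_disjoint[OF 1(3), of C' v] 1(5) 2(3,5) by blast
  then show ?thesis using 1(1) 2(1) \<open>n = n'\<close> by simp
qed

lemma connectedT: "connected_graph treeV treeE"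
  unfolding connected_graph_iff[OF graphT]
proof (intro conjI ballI)
  have "V \<times> {0} \<in> treeV" using treeV_I parts_0 by simp
  then show "treeV \<noteq> {}" by blast
  have root: "(C \<times> {n}, V \<times> {0}) \<in> (adj treeE)\<^sup>*" if "C \<in> parts n" for C n
    using that
  proof (induction n arbitrary: C)
    case 0
    then show ?case by (simp add: parts_0)
  next
    case (Suc n)
    then obtain D where D: "D \<in> parts n" "C \<subseteq> D" using parts_parent by blast
    then have "(C \<times> {Suc n}, D \<times> {n}) \<in> adj treeE"
      using treeE_I[OF D(1) Suc.prems D(2)] by (simp add: insert_commute)
    then show ?case using Suc.IH[OF D(1)] by (rule converse_rtrancl_into_rtrancl)
  qed
  fix x y assume "x \<in> treeV" "y \<in> treeV"
  obtain C n where x: "x = C \<times> {n}" "C \<in> parts n" using \<open>x \<in> treeV\<close> by (rule treeV_E)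
  obtain D m where y: "y = D \<times> {m}" "D \<in> parts m" using \<open>y \<in> treeV\<close> by (rule treeV_E)
  show "(x, y) \<in> (adj treeE)\<^sup>*"
    unfolding x(1) y(1) using root[OF x(2)] adj_rtrancl_sym[OF root[OF y(2)]] by (rule rtrancl_trans)
qed

text \<open>A node of maximal level on a cycle would have two distinct parents.\<close>

lemma acyclicT: "\<not> has_cycle treeV treeE"
proof
  assume "has_cycle treeV treeE"
  then obtain xs where xs: "walk treeV treeE xs" "distinct xs" "length xs \<ge> 3" "{last xs, hd xs} \<in> treeE"
    unfolding has_cycle_def by (elim exE conjE) (rule that)
  have ne: "xs \<noteq> []" using xs(3) by auto
  let ?l = "length xs"
  have "\<exists>i<?l. \<forall>j<?l. lvl (xs ! j) \<le> lvl (xs ! i)"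
  proof -
    let ?L = "(\<lambda>i. lvl (xs ! i)) ` {..<?l}"
    have "Max ?L \<in> ?L" using ne by (intro Max_in) auto
    then obtain i where "i < ?l" "Max ?L = lvl (xs ! i)" by auto
    moreover have "lvl (xs ! j) \<le> Max ?L" if "j < ?l" for j using that by (intro Max_ge) auto
    ultimately show ?thesis by auto
  qed
  then obtain i where i: "i < ?l" "\<And>j. j < ?l \<Longrightarrow> lvl (xs ! j) \<le> lvl (xs ! i)" by blast
  \<comment> \<open>\<open>nx\<close> and \<open>pr\<close> are the cyclic neighbours of
    \<open>i\<close>; they differ because the cycle has at least three vertices.\<close>
  define nx where "nx = (if Suc i = ?l then 0 else Suc i)"
  define pr where "pr = (if i = 0 then ?l - 1 else i - 1)"
  have lt: "nx < ?l" "pr < ?l" "nx \<noteq> pr" using i(1) xs(3) by (auto simp: nx_def pr_def)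
  have w: "{xs ! k, xs ! Suc k} \<in> treeE" if "Suc k < ?l" for k
    using xs(1) that by (simp add: walk_def)
  have cl: "{xs ! (?l - 1), xs ! 0} \<in> treeE" using xs(4) ne by (simp add: hd_conv_nth last_conv_nth)
  have "{xs ! i, xs ! nx} \<in> treeE"
  proof (cases "Suc i = ?l")
    case True
    then have "i = ?l - 1" by simp
    then show ?thesis using cl True by (simp add: nx_def)
  next
    case False
    then show ?thesis using w[of i] i(1) by (simp add: nx_def)
  qed
  moreover have "{xs ! i, xs ! pr} \<in> treeE"
  proof (cases "i = 0")
    case True
    then show ?thesis using cl by (simp add: pr_def insert_commute)
  next
    case False
    then show ?thesis using w[of "i - 1"] i(1) by (simp add: pr_def insert_commute)
  qed
  ultimately have "xs ! nx = xs ! pr" using parent_unique i(2) lt by blast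
  then show False using lt nth_eq_iff_index_eq[OF xs(2)] by blast
qed

lemma treeT: "is_tree treeV treeE"
  using graphT connectedT acyclicT by (simp add: is_tree_def)

section \<open>The map from vertices to nodes\<close>

definition node_of :: "'a \<Rightarrow> ('a \<times> nat) set" where
  "node_of v = (SOME x. \<exists>n C. x = C \<times> {n} \<and> C \<in> parts n \<and> v \<in> C \<and> v \<notin> \<Union>(parts (Suc n)))"

text \<open>The level is one less than the first level that misses \<open>v\<close>. Such a level
  exists by \<open>parts_leave\<close>, and it is not 0 because \<open>parts 0\<close> covers
  \<open>V\<close>.\<close>

lemma node_of_cases:
  assumes "v \<in> V"
  obtains C n where "node_of v = C \<times> {n}" "C \<in> parts n" "v \<in> C" "v \<notin> \<Union>(parts (Suc n))"
proof -
  define k where "k = (LEAST n. v \<notin> \<Union>(parts n))"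
  have k: "v \<notin> \<Union>(parts k)" unfolding k_def by (rule LeastI_ex[OF parts_leave[OF assms]])
  have "k \<noteq> 0"
  proof
    assume "k = 0"
    with k assms show False by (simp add: parts_0)
  qed
  then obtain n where n: "k = Suc n" by (cases k) auto
  then have "v \<in> \<Union>(parts n)" using not_less_Least[of n "\<lambda>n. v \<notin> \<Union>(parts n)"] k_def by auto
  then obtain C where "C \<in> parts n" "v \<in> C" by blast
  then have "\<exists>x n C. x = C \<times> {n} \<and> C \<in> parts n \<and> v \<in> C \<and> v \<notin> \<Union>(parts (Suc n))"
    using k n by blast
  from someI_ex[OF this] show ?thesis unfolding node_of_def[symmetric] by (elim exE conjE) (rule that)
qed

text \<open>The subtree hanging from the node of \<open>D\<close> at level \<open>m\<close>. The
  bound on the level excludes nodes above it that carry the same region.\<close>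

definition sub :: "nat \<Rightarrow> 'a set \<Rightarrow> ('a \<times> nat) set set" where
  "sub m D = {C \<times> {n} | C n. C \<in> parts n \<and> m \<le> n \<and> C \<subseteq> D}"

lemma sub_iff: "C \<in> parts n \<Longrightarrow> C \<times> {n} \<in> sub m D \<longleftrightarrow> m \<le> n \<and> C \<subseteq> D"
  unfolding sub_def using node_eq[of C n] by auto

lemma level_le:
  assumes "v \<in> C" "C \<in> parts m" "v \<notin> \<Union>(parts (Suc n))"
  shows "m \<le> n"
  using assms parts_mono[of "Suc n" m v] by (meson UnionI not_less_eq_eq)

lemma t_sub:
  assumes "v \<in> V" "D \<in> parts m"
  shows "node_of v \<in> sub m D \<longleftrightarrow> v \<in> D"
proof -
  obtain C n where t: "node_of v = C \<times> {n}" "C \<in> parts n" "v \<in> C" "v \<notin> \<Union>(parts (Suc n))"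
    using node_of_cases[OF assms(1)] .
  show ?thesis
    unfolding t(1) sub_iff[OF t(2)]
    using t(3) level_le[OF _ assms(2) t(4)] parts_nested[OF _ t(2) assms(2) t(3)]
    by blast
qed

text \<open>The only edge leaving the subtree joins its top node to the parent. For
  \<open>m = 0\<close> the set \<open>?P\<close> still gives a finite upper bound.\<close>

lemma sub_cut:
  assumes D: "D \<in> parts m"
  shows "fincut treeV treeE (sub m D)"
proof -
  let ?P = "{C \<in> parts (m - 1). D \<subseteq> C}"
  obtain d where d: "d \<in> D" using parts_nonempty[OF D] by blast
  have sub: "edge_boundary treeE (sub m D) \<subseteq> (\<lambda>C. {C \<times> {m - 1}, D \<times> {m}}) ` ?P"
  proof
    fix e assume e: "e \<in> edge_boundary treeE (sub m D)"
    then have "e \<in> treeE" by (simp add: edge_boundary_def)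
    then obtain C C' n where C: "e = {C \<times> {n}, C' \<times> {Suc n}}" "C \<in> parts n" "C' \<in> parts (Suc n)" "C' \<subseteq> C"
      by (rule treeE_E)
    obtain c where c: "c \<in> C'" using parts_nonempty[OF C(3)] by blast
    have "(C \<times> {n} \<in> sub m D) \<noteq> (C' \<times> {Suc n} \<in> sub m D)"
      using e C(1) by (auto simp: edge_boundary_def)
    then have C': "m \<le> Suc n" "C' \<subseteq> D" "\<not> (m \<le> n \<and> C \<subseteq> D)"
      using C(4) unfolding sub_iff[OF C(2)] sub_iff[OF C(3)] by auto
    have "\<not> m \<le> n"
    proof
      assume "m \<le> n"
      then have "C \<subseteq> D" using parts_nested[OF _ C(2) D, of c] c C(4) C'(2) by blast
      with \<open>m \<le> n\<close> C'(3) show False by blast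
    qed
    then have m: "m = Suc n" using C'(1) by simp
    then have "C' = D" using parts_disjoint[of C' m D c] C(3) D c C'(2) by blast
    then show "e \<in> (\<lambda>C. {C \<times> {m - 1}, D \<times> {m}}) ` ?P" using C m by auto
  qed
  have fin: "finite ?P"
  proof (rule finite_subset)
    show "?P \<subseteq> {THE C. C \<in> ?P}"
    proof
      fix C assume C: "C \<in> ?P"
      have "(THE C. C \<in> ?P) = C"
      proof (rule the_equality)
        fix C' assume "C' \<in> ?P"
        then show "C' = C" using C parts_disjoint[of C' "m - 1" C d] d by blast
      qed (rule C)
      then show "C \<in> {THE C. C \<in> ?P}" by simp
    qed
  qed simp
  have "finite (edge_boundary treeE (sub m D))" by (rule finite_surj[OF fin sub])
  moreover have "sub m D \<subseteq> treeV" unfolding sub_def treeV_def by blast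
  ultimately show ?thesis by (simp add: fincut_def)
qed

text \<open>Follow the parts containing \<open>w\<close> from \<open>C\<close> down to the node of
  \<open>w\<close>. This path leaves \<open>A\<close>, and the lower end of the edge by which it
  leaves is a region containing \<open>w\<close>.\<close>

lemma descend:
  assumes C: "C \<in> parts n" "w \<in> C" and A: "C \<times> {n} \<in> A" "node_of w \<notin> A"
  shows "\<exists>m D. n \<le> m \<and> D \<in> parts (Suc m) \<and> w \<in> D \<and> D \<times> {Suc m} \<in> \<Union>(edge_boundary treeE A)"
proof (rule ccontr)
  assume no: "\<not> ?thesis"
  have wV: "w \<in> V" using C parts_subset by blast
  obtain Z k where t: "node_of w = Z \<times> {k}" "Z \<in> parts k" "w \<in> Z" "w \<notin> \<Union>(parts (Suc k))"
    using node_of_cases[OF wV] .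
  have "P \<times> {j} \<in> A" if "n \<le> j" "P \<in> parts j" "w \<in> P" for j P
    using that
  proof (induction arbitrary: P rule: dec_induct)
    case base
    then have "P = C" using parts_disjoint C by blast
    then show ?case using A by simp
  next
    case (step j)
    obtain Q where Q: "Q \<in> parts j" "P \<subseteq> Q" using parts_parent[OF step.prems(1)] by blast
    then have QA: "Q \<times> {j} \<in> A" using step.IH step.prems by blast
    show ?case
    proof (rule ccontr)
      assume "P \<times> {Suc j} \<notin> A"
      then have "{Q \<times> {j}, P \<times> {Suc j}} \<in> edge_boundary treeE A"
        using treeE_I[OF Q(1) step.prems(1) Q(2)] QA by (intro edge_in_boundary)
      then have "P \<times> {Suc j} \<in> \<Union>(edge_boundary treeE A)" by blast
      then show False using no step.hyps(1) step.prems by blast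
    qed
  qed
  moreover have "n \<le> k" using level_le[OF C(2,1) t(4)] .
  ultimately show False using t A by simp
qed

text \<open>For an edge \<open>{u, v}\<close> crossing the preimage let \<open>Z\<close> be the
  deepest part containing both ends. One of the two downward paths from \<open>Z\<close> crosses the
  boundary of \<open>A\<close>, at a region that contains only one of \<open>u\<close> and
  \<open>v\<close>, so the edge is a boundary edge of that region. There are finitely many such
  regions, each with finite boundary.\<close>

lemma cut_pullback:
  assumes A: "fincut treeV treeE A"
  shows "fincut V E {v \<in> V. node_of v \<in> A}"
proof -
  let ?N = "\<Union>(edge_boundary treeE A)"
  let ?F = "{D. \<exists>m. D \<in> parts m \<and> D \<times> {m} \<in> ?N}"
  have "?F \<subseteq> (\<lambda>x. fst ` x) ` ?N"
  proof
    fix D assume "D \<in> ?F"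
    then obtain m where "D \<times> {m} \<in> ?N" by blast
    then show "D \<in> (\<lambda>x. fst ` x) ` ?N" by (rule rev_image_eqI) simp
  qed
  then have "finite ?F" by (rule finite_surj[OF finite_boundary_verts[OF graphT A]])
  moreover have "finite (edge_boundary E D)" if "D \<in> ?F" for D
    using that parts_cut unfolding fincut_def by blast
  ultimately have fin: "finite (\<Union>D\<in>?F. edge_boundary E D)" by (rule finite_UN_I)
  have "edge_boundary E {v \<in> V. node_of v \<in> A} \<subseteq> (\<Union>D\<in>?F. edge_boundary E D)"
  proof
    fix e assume "e \<in> edge_boundary E {v \<in> V. node_of v \<in> A}"
    then obtain u v where uv: "e = {u, v}" "{u, v} \<in> E" "u \<in> {v \<in> V. node_of v \<in> A}" "v \<notin> {v \<in> V. node_of v \<in> A}"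
      by (rule boundaryE[OF graph])
    have uV: "u \<in> V" and vV: "v \<in> V" using graphD[OF graph uv(2)] by auto
    then have tu: "node_of u \<in> A" and tv: "node_of v \<notin> A" using uv(3,4) by auto
    let ?P = "\<lambda>n. \<exists>Z\<in>parts n. u \<in> Z \<and> v \<in> Z"
    obtain k where k: "u \<notin> \<Union>(parts k)" using parts_leave[OF uV] by blast
    have bound: "n \<le> k" if "?P n" for n
      using that k parts_mono[of k n u] by (meson UnionI nat_le_linear)
    have "?P 0" using uV vV by (simp add: parts_0)
    then have Pn: "?P (Greatest ?P)" using bound by (rule GreatestI_nat)
    have top: "\<not> ?P m" if "Greatest ?P < m" for m
      using Greatest_le_nat[of ?P m k] bound that by (meson not_le)
    define n where "n = Greatest ?P"
    obtain Z where Z: "Z \<in> parts n" "u \<in> Z" "v \<in> Z" using Pn unfolding n_def by blast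
    have cross: "e \<in> (\<Union>D\<in>?F. edge_boundary E D)"
      if D: "n \<le> m" "D \<in> parts (Suc m)" "D \<times> {Suc m} \<in> ?N" "u \<in> D \<or> v \<in> D" for m D
    proof -
      have "\<not> (u \<in> D \<and> v \<in> D)" using top[of "Suc m"] D(1,2) unfolding n_def by auto
      then have "e \<in> edge_boundary E D" using D(4) uv(1,2) by (auto simp: edge_boundary_def)
      then show ?thesis using D(2,3) by blast
    qed
    show "e \<in> (\<Union>D\<in>?F. edge_boundary E D)"
    proof (cases "Z \<times> {n} \<in> A")
      case True
      then show ?thesis using descend[OF Z(1,3) True tv] cross by blast
    next
      case False
      \<comment> \<open>Now the path down to \<open>u\<close> enters \<open>A\<close>; passing to
        the complement keeps the boundary edges.\<close>
      then have "Z \<times> {n} \<in> treeV - A" using treeV_I[OF Z(1)] by blast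
      moreover have "edge_boundary treeE (treeV - A) = edge_boundary treeE A"
        using A by (intro boundary_Compl[OF graphT]) (simp add: fincut_def)
      moreover have "node_of u \<notin> treeV - A" using tu by simp
      ultimately obtain m D where "n \<le> m" "D \<in> parts (Suc m)" "u \<in> D" "D \<times> {Suc m} \<in> ?N"
        using descend[OF Z(1,2), of "treeV - A"] by metis
      then show ?thesis using cross by blast
    qed
  qed
  then show ?thesis using fin finite_subset unfolding fincut_def by blast
qed

lemma ray_cases:
  assumes R: "ray V E R"
  obtains (branch) "\<And>n. \<exists>C\<in>parts n. ev_in R C"
    | (stop) C n where "C \<in> parts n" "ev_in R C" "\<And>D. D \<in> parts (Suc n) \<Longrightarrow> \<not> ev_in R D"
proof (cases "\<forall>n. \<exists>C\<in>parts n. ev_in R C")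
  case True
  then show ?thesis using branch by blast
next
  case False
  have 0: "\<exists>C\<in>parts 0. ev_in R C" using rayD(2)[OF R] by (simp add: parts_0)
  have "\<exists>n. (\<exists>C\<in>parts n. ev_in R C) \<and> \<not> (\<exists>C\<in>parts (Suc n). ev_in R C)"
  proof (rule ccontr)
    assume *: "\<not> ?thesis"
    have "\<exists>C\<in>parts n. ev_in R C" for n
      by (induction n) (use 0 * in blast)+
    with False show False by blast
  qed
  then show ?thesis using stop by blast
qed

text \<open>A ray along a branch enters a part so deep that it avoids all ends of boundary edges of
  \<open>K\<close>; this part meets \<open>K\<close> and is connected, so it lies in
  \<open>K\<close>. If the ray stops at \<open>C\<close>, the subtrees of the finitely many leaves
  not contained in \<open>K\<close> are removed from the subtree of \<open>C\<close>.\<close>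

lemma cut_refine:
  assumes R: "ray V E R" and K: "fincut V E K" "ev_in R K"
  shows "\<exists>A. fincut treeV treeE A \<and> ev_in (\<lambda>i. node_of (R i)) A \<and>
    (\<forall>R'. ray V E R' \<and> ev_in (\<lambda>i. node_of (R' i)) A \<longrightarrow> ev_in R' K)"
  using R
proof (cases rule: ray_cases)
  case branch
  have "\<exists>n. \<forall>u\<in>U. u \<notin> \<Union>(parts n)" if "finite U" "U \<subseteq> V" for U
    using that
  proof (induction U rule: finite_induct)
    case (insert u U)
    then obtain n m where "\<forall>u\<in>U. u \<notin> \<Union>(parts n)" "u \<notin> \<Union>(parts m)"
      using parts_leave[of u] by auto
    then have "\<forall>u\<in>insert u U. u \<notin> \<Union>(parts (max n m))"
      using parts_mono[of n "max n m"] parts_mono[of m "max n m"] by (metis insert_iff max.cobounded1 max.cobounded2)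
    then show ?case by blast
  qed simp
  moreover have "\<Union>(edge_boundary E K) \<subseteq> V"
    using graph unfolding edge_boundary_def graph_def by blast
  ultimately obtain n where n: "\<forall>u\<in>\<Union>(edge_boundary E K). u \<notin> \<Union>(parts n)"
    using finite_boundary_verts[OF graph K(1)] by blast
  obtain C where C: "C \<in> parts n" "ev_in R C" using branch by blast
  obtain x where x: "x \<in> C" "x \<in> K" using ev_in_disjoint[OF C(2) K(2)] by blast
  have CK: "C \<subseteq> K"
  proof (rule connected_avoiding_boundary[OF graph _ x])
    show "connected_graph C (induced E C)" using parts_region[OF C(1)] by (simp add: region_iff)
    show "e \<inter> C = {}" if "e \<in> edge_boundary E K" for e using n C(1) that by blast
  qed
  have tC: "ev_in (\<lambda>i. node_of (S i)) (sub n C) \<longleftrightarrow> ev_in S C" if "ray V E S" for S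
    using t_sub[OF rayD(2)[OF that] C(1)] by simp
  show ?thesis
    using sub_cut[OF C(1)] tC R C(2) ev_in_mono[OF _ CK] by (intro exI[of _ "sub n C"]) blast
next
  case (stop C n)
  let ?D = "{D \<in> parts (Suc n). D \<subseteq> C \<and> \<not> D \<subseteq> K}"
  have fin: "finite ?D" by (rule parts_stop(1)[OF stop(1) K(1) R stop(2,3) K(2)])
  define A where "A = sub n C - \<Union>(sub (Suc n) ` ?D)"
  have "fincut treeV treeE A"
    unfolding A_def using fin sub_cut stop(1)
    by (intro fincut_Diff[OF graphT] fincut_Union) auto
  have A_iff: "node_of v \<in> A \<longleftrightarrow> v \<in> C \<and> (\<forall>D\<in>?D. v \<notin> D)" if "v \<in> V" for v
    using t_sub[OF that] stop(1) unfolding A_def by auto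
  have "\<forall>\<^sub>F i in sequentially. \<forall>D\<in>?D. R i \<in> V - D"
  proof (rule eventually_ball_finite[OF fin], rule ballI)
    fix D assume D: "D \<in> ?D"
    then show "ev_in R (V - D)"
      using ray_not_in_iff[OF R parts_cut[of D "Suc n"]] stop(3) by blast
  qed
  with stop(2) have "ev_in (\<lambda>i. node_of (R i)) A"
  proof eventually_elim
    case (elim i)
    then show ?case unfolding A_iff[OF rayD(2)[OF R]] by blast
  qed
  moreover have "ev_in R' K" if R': "ray V E R'" "ev_in (\<lambda>i. node_of (R' i)) A" for R'
  \<comment> \<open>Either \<open>R'\<close> enters a leaf that was not removed and so lies in
    \<open>K\<close>, or it stops at \<open>C\<close> just like \<open>R\<close>.\<close>
  proof (cases "\<exists>D\<in>parts (Suc n). ev_in R' D")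
    case True
    then obtain D where D: "D \<in> parts (Suc n)" "ev_in R' D" by blast
    obtain i where i: "R' i \<in> D" "node_of (R' i) \<in> A"
      using eventually_happens'[OF _ eventually_conj[OF D(2) R'(2)]] by auto
    then have "R' i \<in> C" "D \<notin> ?D" unfolding A_iff[OF rayD(2)[OF R'(1)]] by blast+
    moreover have "D \<subseteq> C" using parts_nested[OF _ D(1) stop(1) i(1)] \<open>R' i \<in> C\<close> by simp
    ultimately have "D \<subseteq> K" using D(1) by blast
    then show ?thesis using ev_in_mono[OF D(2)] by blast
  next
    case False
    have "ev_in R' C" using R'(2)
    proof (rule eventually_mono)
      fix i assume "node_of (R' i) \<in> A"
      then show "R' i \<in> C" unfolding A_iff[OF rayD(2)[OF R'(1)]] by blast
    qed
    then show ?thesis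
      using parts_stop(2)[OF stop(1) K(1) R stop(2,3) K(2) R'(1)] False by blast
  qed
  ultimately show ?thesis using \<open>fincut treeV treeE A\<close> by blast
qed

section \<open>Rays of the graph and points of the tree\<close>

lemma match_if:
  assumes R: "ray V E R" and P: "\<And>A. fincut treeV treeE A \<Longrightarrow> \<not> P A \<Longrightarrow> P (treeV - A)"
    and imp: "\<And>A. fincut treeV treeE A \<Longrightarrow> P A \<Longrightarrow> ev_in (\<lambda>i. node_of (R i)) A"
  shows "\<forall>A. fincut treeV treeE A \<longrightarrow> (P A \<longleftrightarrow> ev_in (\<lambda>i. node_of (R i)) A)"
proof (intro allI impI)
  fix A assume A: "fincut treeV treeE A"
  show "P A \<longleftrightarrow> ev_in (\<lambda>i. node_of (R i)) A"
  proof (cases "P A")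
    case False
    have "ev_in (\<lambda>i. node_of (R i)) (treeV - A)" by (rule imp[OF fincut_Compl[OF graphT A] P[OF A False]])
    then have "\<not> ev_in (\<lambda>i. node_of (R i)) A" using ev_in_disjoint[of "\<lambda>i. node_of (R i)" A "treeV - A"] by blast
    with False show ?thesis by simp
  qed (use imp[OF A] in simp)
qed

text \<open>Only finitely many nodes below \<open>C\<close> lie on boundary edges of
  \<open>A\<close>, and the ray eventually avoids their regions. By \<open>descend\<close>, nothing
  then leads its vertices out of \<open>A\<close>.\<close>

lemma match_stop:
  assumes R: "ray V E R" and C: "C \<in> parts n" "ev_in R C"
    and stop: "\<And>D. D \<in> parts (Suc n) \<Longrightarrow> \<not> ev_in R D"
  shows "\<forall>A. fincut treeV treeE A \<longrightarrow> (pt_in (Inl (C \<times> {n})) A \<longleftrightarrow> ev_in (\<lambda>i. node_of (R i)) A)"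
proof (rule match_if[OF R])
  show "pt_in (Inl (C \<times> {n})) (treeV - A)" if "\<not> pt_in (Inl (C \<times> {n})) A" for A
    using that treeV_I[OF C(1)] by simp
  fix A assume A: "fincut treeV treeE A" "pt_in (Inl (C \<times> {n})) A"
  let ?N = "\<Union>(edge_boundary treeE A)"
  let ?F = "{D. \<exists>m. n \<le> m \<and> D \<in> parts (Suc m) \<and> D \<times> {Suc m} \<in> ?N}"
  have "?F \<subseteq> (\<lambda>x. fst ` x) ` ?N"
  proof
    fix D assume "D \<in> ?F"
    then obtain m where "D \<times> {Suc m} \<in> ?N" by blast
    then show "D \<in> (\<lambda>x. fst ` x) ` ?N" by (rule rev_image_eqI) simp
  qed
  then have fin: "finite ?F" by (rule finite_surj[OF finite_boundary_verts[OF graphT A(1)]])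
  have "\<forall>\<^sub>F i in sequentially. \<forall>D\<in>?F. R i \<in> V - D"
  proof (rule eventually_ball_finite[OF fin], rule ballI)
    fix D assume "D \<in> ?F"
    then obtain m where m: "n \<le> m" "D \<in> parts (Suc m)" by blast
    then obtain D' where "D' \<in> parts (Suc n)" "D \<subseteq> D'"
      using parts_ancestor[of "Suc n" "Suc m" D] by auto
    then have "\<not> ev_in R D" using stop ev_in_mono[of R D D'] by blast
    then show "ev_in R (V - D)" using ray_not_in_iff[OF R parts_cut[OF m(2)]] by blast
  qed
  with C(2) show "ev_in (\<lambda>i. node_of (R i)) A"
  proof eventually_elim
    case (elim i)
    show ?case
    proof (rule ccontr)
      assume "node_of (R i) \<notin> A"
      with descend[OF C(1) elim(1), of A] A(2) elim(2) show False by auto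
    qed
  qed
qed

text \<open>Ends of boundary edges of \<open>A\<close> have bounded level, so no edge below a deep
  node of the branch crosses \<open>A\<close>, and all vertices in its region have their nodes on
  one side.\<close>

lemma match_branch:
  assumes R: "ray V E R" and c: "\<And>n. c n \<in> parts n" "\<And>n. ev_in R (c n)"
  shows "ray treeV treeE (\<lambda>n. c n \<times> {n})"
    and "\<forall>A. fincut treeV treeE A \<longrightarrow> (ev_in (\<lambda>n. c n \<times> {n}) A \<longleftrightarrow> ev_in (\<lambda>i. node_of (R i)) A)"
proof -
  let ?q = "\<lambda>n. c n \<times> {n}"
  have "c (Suc n) \<subseteq> c n" for n
  proof -
    obtain x where "x \<in> c (Suc n)" "x \<in> c n" using ev_in_disjoint[OF c(2) c(2)] by blast
    then show ?thesis using parts_nested[OF _ c(1) c(1)] by (meson le_SucI order_refl)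
  qed
  then show q: "ray treeV treeE ?q"
    unfolding ray_def using treeV_I[OF c(1)] treeE_I[OF c(1) c(1)] node_eq[OF c(1)]
    by (auto simp: inj_def simp del: times_eq_iff)
  show "\<forall>A. fincut treeV treeE A \<longrightarrow> (ev_in ?q A \<longleftrightarrow> ev_in (\<lambda>i. node_of (R i)) A)"
  proof (rule match_if[OF R])
    show "ev_in ?q (treeV - A)" if "fincut treeV treeE A" "\<not> ev_in ?q A" for A
      using ray_not_in_iff[OF q that(1)] that(2) by blast
    fix A assume A: "fincut treeV treeE A" "ev_in ?q A"
    obtain k where k: "\<And>i. i \<ge> k \<Longrightarrow> ?q i \<in> A" using A(2) by (auto simp: eventually_sequentially)
    have "finite (lvl ` \<Union>(edge_boundary treeE A))" using finite_boundary_verts[OF graphT A(1)] by simp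
    then obtain l where l: "\<forall>j\<in>lvl ` \<Union>(edge_boundary treeE A). j < l"
      using finite_nat_set_iff_bounded by blast
    define n where "n = max k l"
    show "ev_in (\<lambda>i. node_of (R i)) A"
      using c(2)[of n]
    proof eventually_elim
      case (elim i)
      show ?case
      proof (rule ccontr)
        assume "node_of (R i) \<notin> A"
        moreover have "c n \<times> {n} \<in> A" using k by (simp add: n_def)
        ultimately obtain m D where D: "n \<le> m" "D \<in> parts (Suc m)"
          "D \<times> {Suc m} \<in> \<Union>(edge_boundary treeE A)"
          using descend[OF c(1) elim, of A] by blast
        then have "lvl (D \<times> {Suc m}) < l" using l by blast
        then show False using lvl_node[OF D(2)] D(1) by (simp add: n_def)
      qed
    qed
  qed
qed

text \<open>Vertices chosen from the nested regions accumulate somewhere. They cannot accumulate at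
  a vertex, since every vertex leaves the regions; they accumulate at a ray, which lies eventually
  in each \<open>c n\<close> because only finitely many chosen vertices are outside.\<close>

lemma ray_along_branch:
  assumes c: "\<And>n. c n \<in> parts n" "\<And>n. c (Suc n) \<subseteq> c n"
  shows "\<exists>R. ray V E R \<and> (\<forall>n. ev_in R (c n))"
proof -
  have dec: "c n \<subseteq> c m" if "m \<le> n" for m n
    using that by (induction rule: dec_induct) (use c(2) in auto)
  define v where "v n = (SOME x. x \<in> c n)" for n
  have v: "v n \<in> c n" for n
    unfolding v_def using parts_nonempty[OF c(1)] by (simp add: some_in_eq)
  have leave: "\<exists>n. u \<notin> c n" if "u \<in> V" for u
    using parts_leave[OF that] c(1) by blast
  have fin: "finite ((V - c n) \<inter> range v)" for n
  proof (rule finite_subset)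
    show "(V - c n) \<inter> range v \<subseteq> v ` {..<n}"
    proof
      fix x assume "x \<in> (V - c n) \<inter> range v"
      then obtain m where m: "x = v m" "v m \<notin> c n" by blast
      then have "m < n" using v[of m] dec[of n m] by (meson not_le subsetD)
      then show "x \<in> v ` {..<n}" using m by blast
    qed
  qed simp
  have "infinite (range v)"
  proof
    assume "finite (range v)"
    then obtain x where x: "infinite {n. v n = x}"
      using inf_img_fin_dom[of v UNIV] by (auto simp: vimage_def)
    then have "x \<in> range v" using not_finite_existsD by blast
    then have "x \<in> V" using v parts_subset[OF c(1)] by blast
    then obtain n where "x \<notin> c n" using leave by blast
    then have "{n. v n = x} \<subseteq> {..<n}" using v dec by (auto simp: not_less[symmetric])
    then show False using x finite_subset by blast
  qed
  moreover have "range v \<subseteq> V" using v parts_subset[OF c(1)] by blast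
  ultimately consider u where "u \<in> V" "adherent (range v) (\<lambda>_. u)"
    | R where "ray V E R" "adherent (range v) R"
    using compactness by blast
  then show ?thesis
  proof cases
    case 1
    obtain n where "u \<notin> c n" using leave[OF 1(1)] by blast
    then have "infinite ((V - c n) \<inter> range v)"
      using 1 fincut_Compl[OF graph parts_cut[OF c(1)]] unfolding adherent_def by simp
    with fin show ?thesis by blast
  next
    case 2
    have "ev_in R (c n)" for n
    proof (rule ccontr)
      assume "\<not> ev_in R (c n)"
      then have "ev_in R (V - c n)" using ray_not_in_iff[OF 2(1) parts_cut[OF c(1)]] by blast
      then have "infinite ((V - c n) \<inter> range v)"
        using 2(2) fincut_Compl[OF graph parts_cut[OF c(1)]] unfolding adherent_def by blast
      with fin show False by blast
    qed
    with 2(1) show ?thesis by blast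
  qed
qed

text \<open>After a node of least level the ray moves away from the root. Turning back later would
  lead to the unique parent it has just come from, against injectivity.\<close>

lemma tree_ray_ascends:
  assumes p: "ray treeV treeE p"
  obtains i0 where "\<And>k. lvl (p (i0 + Suc k)) = Suc (lvl (p (i0 + k)))"
proof -
  define m where "m = (LEAST m. \<exists>i. lvl (p i) = m)"
  have "\<exists>i. lvl (p i) = m" unfolding m_def by (rule LeastI_ex) blast
  then obtain i0 where i0: "lvl (p i0) = m" by blast
  have m: "m \<le> lvl (p i)" for i unfolding m_def by (rule Least_le) blast
  have "lvl (p (i0 + Suc k)) = Suc (lvl (p (i0 + k)))" for k
  proof (induction k)
    case 0
    show ?case using edge_lvl[OF rayD(3)[OF p, of i0]] m[of "Suc i0"] i0 by auto
  next
    case (Suc k)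
    show ?case
    proof (rule ccontr)
      assume "\<not> ?case"
      then have l: "lvl (p (i0 + Suc k)) = Suc (lvl (p (i0 + Suc (Suc k))))"
        using edge_lvl[OF rayD(3)[OF p, of "i0 + Suc k"]] by auto
      have e: "{p (i0 + Suc k), p (i0 + Suc (Suc k))} \<in> treeE" "{p (i0 + Suc k), p (i0 + k)} \<in> treeE"
        using rayD(3)[OF p, of "i0 + Suc k"] rayD(3)[OF p, of "i0 + k"] by (simp_all add: insert_commute)
      have "p (i0 + Suc (Suc k)) = p (i0 + k)"
        by (rule parent_unique[OF e]) (use l Suc.IH in simp_all)
      then show False using rayD(1)[OF p] by (simp add: inj_eq)
    qed
  qed
  then show ?thesis using that by blast
qed

lemma match_tree_ray:
  assumes p: "ray treeV treeE p"
  shows "\<exists>R. ray V E R \<and> (\<forall>A. fincut treeV treeE A \<longrightarrow> (ev_in p A \<longleftrightarrow> ev_in (\<lambda>i. node_of (R i)) A))"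
proof -
  obtain i0 where asc: "\<And>k. lvl (p (i0 + Suc k)) = Suc (lvl (p (i0 + k)))"
    using tree_ray_ascends[OF p] by blast
  define n0 where "n0 = lvl (p i0)"
  define b where "b k = fst ` p (i0 + k)" for k
  have lv: "lvl (p (i0 + k)) = n0 + k" for k
    by (induction k) (use asc in \<open>simp_all add: n0_def\<close>)
  have node: "p (i0 + k) = b k \<times> {n0 + k}" "b k \<in> parts (n0 + k)" for k
  proof -
    obtain C n where C: "p (i0 + k) = C \<times> {n}" "C \<in> parts n" using rayD(2)[OF p] by (rule treeV_E)
    then have "n = n0 + k" using lvl_node[OF C(2)] lv[of k] by simp
    moreover have "b k = C" unfolding b_def C(1) by simp
    ultimately show "p (i0 + k) = b k \<times> {n0 + k}" "b k \<in> parts (n0 + k)" using C by simp_all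
  qed
  have bdec: "b (Suc k) \<subseteq> b k" for k
  proof -
    have "{p (i0 + Suc k), p (i0 + k)} \<in> treeE"
      using rayD(3)[OF p, of "i0 + k"] by (simp add: insert_commute)
    then obtain C D n where C: "p (i0 + k) = C \<times> {n}" "p (i0 + Suc k) = D \<times> {Suc n}" "D \<subseteq> C"
      using lower_edge[of "p (i0 + Suc k)" "p (i0 + k)"] asc[of k] by (metis le_SucI order_refl)
    then show ?thesis unfolding b_def by simp
  qed
  have bdec': "b n \<subseteq> b m" if "m \<le> n" for m n
    using that by (induction rule: dec_induct) (use bdec in auto)
  \<comment> \<open>\<open>b n\<close> sits at level \<open>n0 + n\<close>, so it has an ancestor at
    level \<open>n\<close>. These ancestors complete a tail of \<open>p\<close> to a branch starting
    at level 0.\<close>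
  define c where "c n = (SOME C. C \<in> parts n \<and> b n \<subseteq> C)" for n
  have c: "c n \<in> parts n" "b n \<subseteq> c n" for n
  proof -
    have "\<exists>C. C \<in> parts n \<and> b n \<subseteq> C" using parts_ancestor[OF _ node(2), of n n] by auto
    from someI_ex[OF this] show "c n \<in> parts n" "b n \<subseteq> c n" unfolding c_def by auto
  qed
  have bne: "\<exists>x. x \<in> b n" for n using parts_nonempty[OF node(2)] by blast
  have cdec: "c (Suc n) \<subseteq> c n" for n
  proof -
    obtain x where "x \<in> b (Suc n)" using bne by blast
    then show ?thesis
      using parts_nested[OF _ c(1) c(1), of n "Suc n" x] c(2) bdec by auto
  qed
  have cb: "c (k + n0) = b k" for k
  proof -
    obtain x where "x \<in> b (k + n0)" using bne by blast
    then have "x \<in> c (k + n0)" "x \<in> b k" using c(2) bdec'[of k "k + n0"] by auto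
    then show ?thesis using parts_disjoint[OF c(1)] node(2)[of k] by (simp add: add.commute)
  qed
  obtain R where R: "ray V E R" "\<And>n. ev_in R (c n)"
    using ray_along_branch[of c, OF c(1) cdec] by auto
  have "ev_in p A \<longleftrightarrow> ev_in (\<lambda>n. c n \<times> {n}) A" for A
  proof -
    have "p (k + i0) = c (k + n0) \<times> {k + n0}" for k
      unfolding cb node(1)[of k, symmetric, unfolded add.commute[of n0]] by (simp add: add.commute)
    then have "ev_in (\<lambda>k. p (k + i0)) A \<longleftrightarrow> ev_in (\<lambda>k. c (k + n0) \<times> {k + n0}) A" by (simp only:)
    then show ?thesis by (simp only: ev_in_shift[of p] ev_in_shift[of "\<lambda>n. c n \<times> {n}"])
  qed
  then show ?thesis using match_branch(2)[OF R(1) c(1) R(2)] R(1) by auto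
qed

text \<open>The subspace X of the theorem, described by rays and cuts so that no map on ends is
  needed. That it contains all ends of the tree rests on \<open>match_tree_ray\<close>.\<close>

definition ends_image :: "(('a \<times> nat) set + (nat \<Rightarrow> ('a \<times> nat) set) set) set" where
  "ends_image = {x \<in> pts treeV treeE. \<exists>R. ray V E R \<and>
    (\<forall>A. fincut treeV treeE A \<longrightarrow> (pt_in x A \<longleftrightarrow> ev_in (\<lambda>i. node_of (R i)) A))}"

lemma match_end:
  assumes "ray treeV treeE p" "\<forall>A. fincut treeV treeE A \<longrightarrow> (ev_in p A \<longleftrightarrow> Q A)"
  shows "\<forall>A. fincut treeV treeE A \<longrightarrow> (pt_in (Inr (end_of treeV treeE p)) A \<longleftrightarrow> Q A)"
  using end_in_end_of[OF graphT assms(1)] assms(2) by simp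

theorem end_space_tree:
  "edge_end_space V E homeomorphic_space subtopology (graph_space treeV treeE) ends_image"
proof (rule end_space_homeomorphic[where t = node_of])
  interpret T: tree treeV treeE using treeT by unfold_locales
  show "\<exists>A. fincut treeV treeE A \<and> pt_in x A \<and> \<not> pt_in y A"
    if "x \<in> pts treeV treeE" "y \<in> pts treeV treeE" "x \<noteq> y" for x y
    by (rule T.separate_points[OF that])
  show "ends_image \<subseteq> pts treeV treeE" unfolding ends_image_def by blast
  show "\<exists>R. ray V E R \<and> (\<forall>A. fincut treeV treeE A \<longrightarrow> (pt_in x A \<longleftrightarrow> ev_in (\<lambda>i. node_of (R i)) A))"
    if "x \<in> ends_image" for x
    using that unfolding ends_image_def by blast
  fix R assume R: "ray V E R"
  have "\<exists>x\<in>pts treeV treeE. \<forall>A. fincut treeV treeE A \<longrightarrow> (pt_in x A \<longleftrightarrow> ev_in (\<lambda>i. node_of (R i)) A)"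
    using R
  proof (cases rule: ray_cases)
    case branch
    then obtain c where c: "\<And>n. c n \<in> parts n" "\<And>n. ev_in R (c n)" by metis
    note m = match_branch[OF R c]
    show ?thesis
    proof
      show "Inr (end_of treeV treeE (\<lambda>n. c n \<times> {n})) \<in> pts treeV treeE"
        unfolding pts_def using end_of_in[OF m(1)] by blast
    qed (rule match_end[OF m])
  next
    case (stop C n)
    show ?thesis
    proof
      show "Inl (C \<times> {n}) \<in> pts treeV treeE"
        unfolding pts_def using treeV_I[OF stop(1)] by blast
    qed (rule match_stop[OF R stop])
  qed
  then show "\<exists>x\<in>ends_image. \<forall>A. fincut treeV treeE A \<longrightarrow> (pt_in x A \<longleftrightarrow> ev_in (\<lambda>i. node_of (R i)) A)"
    using R unfolding ends_image_def by blast
qed (fact graph graphT cut_pullback cut_refine)+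

lemma ends_subset_image: "Inr ` edge_ends treeV treeE \<subseteq> ends_image"
proof
  fix x :: "('a \<times> nat) set + (nat \<Rightarrow> ('a \<times> nat) set) set"
  assume "x \<in> Inr ` edge_ends treeV treeE"
  then obtain \<omega> where \<omega>: "x = Inr \<omega>" "\<omega> \<in> edge_ends treeV treeE" by blast
  obtain p where p: "ray treeV treeE p" "\<omega> = end_of treeV treeE p" by (rule end_ofE[OF graphT \<omega>(2)])
  obtain R where R: "ray V E R" "\<forall>A. fincut treeV treeE A \<longrightarrow> (ev_in p A \<longleftrightarrow> ev_in (\<lambda>i. node_of (R i)) A)"
    using match_tree_ray[OF p(1)] by blast
  have "x \<in> pts treeV treeE" using \<omega> by (simp add: pts_def)
  moreover note match_end[OF p(1) R(2)]
  ultimately show "x \<in> ends_image" unfolding ends_image_def \<omega>(1) p(2) using R(1) by blast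
qed

end

text \<open>The equivalence is stated as two implications because the vertex type of each
  constructed graph depends on the type of the given one, and types cannot be quantified inside a
  formula.\<close>

theorem theorem1p2:
  fixes Y :: "'y topology"
  shows
    "(\<forall>(V :: 'v set) E.
        graph V E \<and> connected_graph V E \<and> Y homeomorphic_space edge_end_space V E \<longrightarrow>
        (\<exists>(TV :: ('v \<times> nat) set set) TE X.
            is_tree TV TE \<and> X \<subseteq> topspace (graph_space TV TE) \<and>
            Inr ` edge_ends TV TE \<subseteq> X \<and>
            Y homeomorphic_space subtopology (graph_space TV TE) X))
   \<and>
    (\<forall>(TV :: 'w set) TE X.
        is_tree TV TE \<and> X \<subseteq> topspace (graph_space TV TE) \<and>
        Inr ` edge_ends TV TE \<subseteq> X \<and>
        Y homeomorphic_space subtopology (graph_space TV TE) X \<longrightarrow>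
        (\<exists>(V :: ('w \<times> nat) set set) E.
            graph V E \<and> connected_graph V E \<and> Y homeomorphic_space edge_end_space V E))"
proof (rule conjI; intro allI impI; elim conjE)
  fix V :: "'v set" and E
  assume "graph V E" "connected_graph V E" and Y: "Y homeomorphic_space edge_end_space V E"
  then interpret conn_graph V E by unfold_locales
  have "ends_image \<subseteq> topspace (graph_space treeV treeE)"
    unfolding topspace_graph_space[OF graphT] ends_image_def by blast
  moreover have "Y homeomorphic_space subtopology (graph_space treeV treeE) ends_image"
    using Y end_space_tree by (rule homeomorphic_space_trans)
  ultimately show "\<exists>(TV :: ('v \<times> nat) set set) TE X.
      is_tree TV TE \<and> X \<subseteq> topspace (graph_space TV TE) \<and> Inr ` edge_ends TV TE \<subseteq> X \<and>
      Y homeomorphic_space subtopology (graph_space TV TE) X"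
    using treeT ends_subset_image by blast
next
  fix TV :: "'w set" and TE X
  assume T: "is_tree TV TE" and X: "X \<subseteq> topspace (graph_space TV TE)"
    and ends: "Inr ` edge_ends TV TE \<subseteq> X"
    and Y: "Y homeomorphic_space subtopology (graph_space TV TE) X"
  have "graph TV TE" using T by (simp add: is_tree_def)
  then interpret clique_extension TV TE X
    using T X ends by unfold_locales (simp_all add: topspace_graph_space)
  have "Y homeomorphic_space edge_end_space VG EG"
    using Y end_space_clique_extension homeomorphic_space_sym homeomorphic_space_trans by blast
  then show "\<exists>(V :: ('w \<times> nat) set set) E.
      graph V E \<and> connected_graph V E \<and> Y homeomorphic_space edge_end_space V E"
    using graphG connectedG by blast
qed

end
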